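(* For a finitary biframe $\mathcal L$ the following are equivalent. (1) All bisubspaces of $\mathsf{bpt}(\mathcal L)$ are bisober. (2) The collection of bisober bisubspaces of $\mathsf{bpt}(\mathcal L)$ is closed under arbitrary unions. (3) The collection of bisober bisubspaces of $\mathsf{bpt}(\mathcal L)$ is closed under complementation. (4) The bisubspaces of the form $\mathsf{bpt}(\mathcal L)\setminus\{f\}$, for $f\in\mathsf{bpt}(\mathcal L)$, are bisober. (5) The bispace $\mathsf{bpt}(\mathcal L)$ is bi-$T_D$.
   Context: A biframe is a triple $\mathcal L=(L^+,L^-,L)$ of frames with injective frame maps $e_L^{\pm}:L^{\pm}\to L$ such that every element of $L$ (the main component) is a join of elements $e_L^+(x^+)\wedge e_L^-(x^-)$; we identify $x^{\pm}$ with $e_L^{\pm}(x^{\pm})$. A biframe map $(f^+,f^-):\mathcal L\to\mathcal M$ is a pair of frame maps $f^{\pm}:L^{\pm}\to M^{\pm}$ for which there is a (necessarily unique) frame map $f:L\to M$ with $f\circ e_L^{\pm}=e_M^{\pm}\circ f^{\pm}$. A relation $R$ on a frame is treated as a set of inequalities: the quotient by $R$ is the universal frame quotient $q$ with $q(a)\le q(b)$ for $(a,b)\in R$; the congruence generated by $R$ is the kernel of $q$. $\mathsf{fin}(L)\subseteq L$ is the set of finite joins of elements $x^+\wedge x^-$; a congruence on $L$ is finitary if generated by some $R\subseteq\mathsf{fin}(L)\times\mathsf{fin}(L)$. With $L^+\oplus L^-$ the frame coproduct and $C_L$ the kernel of the canonical surjection $L^+\oplus L^-\to L$, $\mathcal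 L$ is finitary if $C_L$ is a finitary congruence on $L^+\oplus L^-$ (the main component of $(L^+,L^-,L^+\oplus L^-)$). A bispace is a set $X$ with two topologies $\Omega^+(X),\Omega^-(X)$. A bisubspace is a subset with both subspace topologies. $X$ is bi-$T_D$ if every singleton is of the form $U^+\cap U^-\cap (X\setminus V^+)\cap(X\setminus V^-)$ with $U^+,V^+\in\Omega^+(X)$ and $U^-,V^-\in\Omega^-(X)$. $\mathsf{bpt}(\mathcal L)$ is the bispace of biframe maps $\mathcal L\to(2,2,2)$ with positive opens $\{f:f^+(a^+)=1\}$ ($a^+\in L^+$) and negative opens $\{f:f^-(a^-)=1\}$ ($a^-\in L^-$). $\mathsf{b}\Omega_{\mathsf{fin}}(X)=(\Omega^+(X),\Omega^-(X),\Omega_{\mathsf{fin}}(X))$, with $\Omega_{\mathsf{fin}}(X)$ the quotient of $\Omega^+(X)\oplus\Omega^-(X)$ by $\{(U^+\wedge U^-,V^+\vee V^-):U^+\cap U^-\subseteq V^+\cup V^-\}$. $X$ is bisober if $X\to\mathsf{bpt}(\mathsf{b}\Omega_{\mathsf{fin}}(X))$, $x\mapsto(N_x^+,N_x^-)$ with $N_x^{\pm}(U)=1$ iff $x\in U$, is a bihomeomorphism (a bijection that is a homeomorphism for both topologies). *)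

theory Defs
  imports "HOL-Algebra.Complete_Lattice" "HOL-Analysis.Abstract_Topology"
begin

section \<open>Frames\<close>

text \<open>
  The frames of opens of varying subspaces have to be treated on a par with the components of a
  given biframe, so frames are carrier-based ordered structures rather than a type class.
\<close>

locale frame = complete_lattice +
  assumes meet_Sup_distrib:
    "\<lbrakk>x \<in> carrier L; A \<subseteq> carrier L\<rbrakk> \<Longrightarrow> x \<sqinter> \<Squnion>A = \<Squnion>((\<lambda>a. x \<sqinter> a) ` A)"

definition frame_map :: "'a gorder \<Rightarrow> 'b gorder \<Rightarrow> ('a \<Rightarrow> 'b) \<Rightarrow> bool" where
  "frame_map L M f \<longleftrightarrow>
     f \<in> carrier L \<rightarrow> carrier M \<and> sup_pres L M f \<and> meet_pres L M f \<and> f \<top>\<^bsub>L\<^esub> = \<top>\<^bsub>M\<^esub>"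

definition kernel_rel :: "'a gorder \<Rightarrow> ('a \<Rightarrow> 'b) \<Rightarrow> ('a \<times> 'a) set" where
  "kernel_rel L f = {(a, b). a \<in> carrier L \<and> b \<in> carrier L \<and> f a = f b}"

definition two :: "bool gorder" where
  "two = \<lparr>carrier = UNIV, eq = (=), le = (\<le>)\<rparr>"

definition opens :: "'x topology \<Rightarrow> 'x set gorder" where
  "opens T = \<lparr>carrier = {U. openin T U}, eq = (=), le = (\<subseteq>)\<rparr>"


subsection \<open>Congruences and quotients\<close>

text \<open>The second closure condition says that a family of related pairs has related joins.\<close>

definition frame_congruence :: "'a gorder \<Rightarrow> ('a \<times> 'a) set \<Rightarrow> bool" where
  "frame_congruence L \<theta> \<longleftrightarrow>
     equiv (carrier L) \<theta> \<and>
     (\<forall>(a, b)\<in>\<theta>. \<forall>(c, d)\<in>\<theta>. (a \<sqinter>\<^bsub>L\<^esub> c, b \<sqinter>\<^bsub>L\<^esub> d) \<in> \<theta>) \<and>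
     (\<forall>S\<subseteq>\<theta>. (\<Squnion>\<^bsub>L\<^esub>(fst ` S), \<Squnion>\<^bsub>L\<^esub>(snd ` S)) \<in> \<theta>)"

text \<open>
  A pair \<open>(a, b)\<close> of a relation stands for the inequality \<open>a \<le> b\<close>, that is, for the equation
  \<open>a \<squnion> b = b\<close>.  That the quotient by the least such congruence is the universal frame quotient,
  with this congruence as its kernel, is proved below
  (\<open>quotient_frame_universal\<close>, \<open>kernel_quotient_map\<close>).
\<close>

definition generated_congruence :: "'a gorder \<Rightarrow> ('a \<times> 'a) set \<Rightarrow> ('a \<times> 'a) set" where
  "generated_congruence L R =
     \<Inter>{\<theta>. frame_congruence L \<theta> \<and> (\<forall>(a, b)\<in>R. (a \<squnion>\<^bsub>L\<^esub> b, b) \<in> \<theta>)}"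

definition quotient_frame :: "'a gorder \<Rightarrow> ('a \<times> 'a) set \<Rightarrow> 'a set gorder" where
  "quotient_frame L R =
     \<lparr>carrier = carrier L // generated_congruence L R, eq = (=),
      le = (\<lambda>A B. \<exists>a\<in>A. \<exists>b\<in>B. a \<sqsubseteq>\<^bsub>L\<^esub> b)\<rparr>"

definition quotient_map_of :: "'a gorder \<Rightarrow> ('a \<times> 'a) set \<Rightarrow> 'a \<Rightarrow> 'a set" where
  "quotient_map_of L R a = generated_congruence L R `` {a}"


subsection \<open>Binary coproducts\<close>

text \<open>
  The frame coproduct in its usual concrete form: down-sets of the product that are closed under
  joins in each coordinate separately (joins of the empty family included), ordered by inclusion.
  Its universal property is proved below (\<open>coproduct_universal\<close>).
\<close>

definition cp_ideal :: "'a gorder \<Rightarrow> 'b gorder \<Rightarrow> ('a \<times> 'b) set \<Rightarrow> bool" where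
  "cp_ideal L M D \<longleftrightarrow>
     D \<subseteq> carrier L \<times> carrier M \<and>
     (\<forall>(a, b)\<in>D. \<forall>a'\<in>carrier L. \<forall>b'\<in>carrier M.
        a' \<sqsubseteq>\<^bsub>L\<^esub> a \<and> b' \<sqsubseteq>\<^bsub>M\<^esub> b \<longrightarrow> (a', b') \<in> D) \<and>
     (\<forall>A\<subseteq>carrier L. \<forall>b\<in>carrier M. A \<times> {b} \<subseteq> D \<longrightarrow> (\<Squnion>\<^bsub>L\<^esub>A, b) \<in> D) \<and>
     (\<forall>a\<in>carrier L. \<forall>B\<subseteq>carrier M. {a} \<times> B \<subseteq> D \<longrightarrow> (a, \<Squnion>\<^bsub>M\<^esub>B) \<in> D)"

definition coproduct :: "'a gorder \<Rightarrow> 'b gorder \<Rightarrow> ('a \<times> 'b) set gorder" where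
  "coproduct L M = \<lparr>carrier = {D. cp_ideal L M D}, eq = (=), le = (\<subseteq>)\<rparr>"

definition inj_left :: "'a gorder \<Rightarrow> 'b gorder \<Rightarrow> 'a \<Rightarrow> ('a \<times> 'b) set" where
  "inj_left L M a =
     {(x, y). x \<in> carrier L \<and> y \<in> carrier M \<and> (x \<sqsubseteq>\<^bsub>L\<^esub> a \<or> y = \<bottom>\<^bsub>M\<^esub>)}"

definition inj_right :: "'a gorder \<Rightarrow> 'b gorder \<Rightarrow> 'b \<Rightarrow> ('a \<times> 'b) set" where
  "inj_right L M b =
     {(x, y). x \<in> carrier L \<and> y \<in> carrier M \<and> (x = \<bottom>\<^bsub>L\<^esub> \<or> y \<sqsubseteq>\<^bsub>M\<^esub> b)}"

definition copair :: "'c gorder \<Rightarrow> ('a \<Rightarrow> 'c) \<Rightarrow> ('b \<Rightarrow> 'c) \<Rightarrow> ('a \<times> 'b) set \<Rightarrow> 'c" where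
  "copair N f g D = \<Squnion>\<^bsub>N\<^esub>((\<lambda>(a, b). f a \<sqinter>\<^bsub>N\<^esub> g b) ` D)"


section \<open>Biframes\<close>

record ('p, 'n, 'm) biframe =
  pos_part :: "'p gorder"
  neg_part :: "'n gorder"
  main_part :: "'m gorder"
  pos_emb :: "'p \<Rightarrow> 'm"
  neg_emb :: "'n \<Rightarrow> 'm"

definition basic_meets :: "('p, 'n, 'm) biframe \<Rightarrow> 'm set" where
  "basic_meets L =
     {pos_emb L x \<sqinter>\<^bsub>main_part L\<^esub> neg_emb L y | x y.
        x \<in> carrier (pos_part L) \<and> y \<in> carrier (neg_part L)}"

locale biframe =
  fixes L :: "('p, 'n, 'm) biframe"
  assumes frame_pos: "frame (pos_part L)"
    and frame_neg: "frame (neg_part L)"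
    and frame_main: "frame (main_part L)"
    and frame_map_pos: "frame_map (pos_part L) (main_part L) (pos_emb L)"
    and frame_map_neg: "frame_map (neg_part L) (main_part L) (neg_emb L)"
    and inj_pos: "inj_on (pos_emb L) (carrier (pos_part L))"
    and inj_neg: "inj_on (neg_emb L) (carrier (neg_part L))"
    and generated: "z \<in> carrier (main_part L) \<Longrightarrow> \<exists>A\<subseteq>basic_meets L. z = \<Squnion>\<^bsub>main_part L\<^esub>A"

definition biframe_map ::
  "('p, 'n, 'm) biframe \<Rightarrow> ('p2, 'n2, 'm2) biframe \<Rightarrow> ('p \<Rightarrow> 'p2) \<Rightarrow> ('n \<Rightarrow> 'n2) \<Rightarrow> bool" where
  "biframe_map L M fp fn \<longleftrightarrow>
     frame_map (pos_part L) (pos_part M) fp \<and>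
     frame_map (neg_part L) (neg_part M) fn \<and>
     (\<exists>f. frame_map (main_part L) (main_part M) f \<and>
          (\<forall>a\<in>carrier (pos_part L). f (pos_emb L a) = pos_emb M (fp a)) \<and>
          (\<forall>a\<in>carrier (neg_part L). f (neg_emb L a) = neg_emb M (fn a)))"

definition fin_part :: "('p, 'n, 'm) biframe \<Rightarrow> 'm set" where
  "fin_part L = {\<Squnion>\<^bsub>main_part L\<^esub>A | A. finite A \<and> A \<subseteq> basic_meets L}"

definition finitary_congruence :: "('p, 'n, 'm) biframe \<Rightarrow> ('m \<times> 'm) set \<Rightarrow> bool" where
  "finitary_congruence L C \<longleftrightarrow>
     (\<exists>R\<subseteq>fin_part L \<times> fin_part L. C = generated_congruence (main_part L) R)"

definition coproduct_biframe ::
  "'p gorder \<Rightarrow> 'n gorder \<Rightarrow> ('p, 'n, ('p \<times> 'n) set) biframe" where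
  "coproduct_biframe P N =
     \<lparr>pos_part = P, neg_part = N, main_part = coproduct P N,
      pos_emb = inj_left P N, neg_emb = inj_right P N\<rparr>"

definition canonical_surj :: "('p, 'n, 'm) biframe \<Rightarrow> ('p \<times> 'n) set \<Rightarrow> 'm" where
  "canonical_surj L = copair (main_part L) (pos_emb L) (neg_emb L)"

definition finitary_biframe :: "('p, 'n, 'm) biframe \<Rightarrow> bool" where
  "finitary_biframe L \<longleftrightarrow>
     biframe L \<and>
     finitary_congruence (coproduct_biframe (pos_part L) (neg_part L))
       (kernel_rel (coproduct (pos_part L) (neg_part L)) (canonical_surj L))"

definition two_biframe :: "(bool, bool, bool) biframe" where
  "two_biframe =
     \<lparr>pos_part = two, neg_part = two, main_part = two, pos_emb = id, neg_emb = id\<rparr>"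


section \<open>Bispaces\<close>

record 'x bispace =
  pos_top :: "'x topology"
  neg_top :: "'x topology"

locale bispace =
  fixes X :: "'x bispace"
  assumes same_points: "topspace (neg_top X) = topspace (pos_top X)"

definition points :: "'x bispace \<Rightarrow> 'x set" where
  "points X = topspace (pos_top X)"

definition bisubspace :: "'x bispace \<Rightarrow> 'x set \<Rightarrow> 'x bispace" where
  "bisubspace X S =
     \<lparr>pos_top = subtopology (pos_top X) S, neg_top = subtopology (neg_top X) S\<rparr>"

definition bi_TD :: "'x bispace \<Rightarrow> bool" where
  "bi_TD X \<longleftrightarrow>
     (\<forall>x\<in>points X. \<exists>Up Vp Um Vm.
        openin (pos_top X) Up \<and> openin (pos_top X) Vp \<and>
        openin (neg_top X) Um \<and> openin (neg_top X) Vm \<and>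
        {x} = Up \<inter> Um \<inter> (points X - Vp) \<inter> (points X - Vm))"

definition bihomeomorphism :: "'x bispace \<Rightarrow> 'y bispace \<Rightarrow> ('x \<Rightarrow> 'y) \<Rightarrow> bool" where
  "bihomeomorphism X Y f \<longleftrightarrow>
     homeomorphic_map (pos_top X) (pos_top Y) f \<and> homeomorphic_map (neg_top X) (neg_top Y) f"


subsection \<open>The spectrum of a biframe\<close>

text \<open>
  Extensionality makes two points equal exactly when they agree on the two carriers.
\<close>

definition bpt_points :: "('p, 'n, 'm) biframe \<Rightarrow> (('p \<Rightarrow> bool) \<times> ('n \<Rightarrow> bool)) set" where
  "bpt_points L =
     {(fp, fn). fp \<in> extensional (carrier (pos_part L)) \<and>
                fn \<in> extensional (carrier (neg_part L)) \<and>
                biframe_map L two_biframe fp fn}"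

text \<open>
  The sets below are already closed under finite intersections and arbitrary unions
  (\<open>istopology_bpt\<close>), so they are all the opens, and no topology needs to be generated.
\<close>

definition bpt :: "('p, 'n, 'm) biframe \<Rightarrow> (('p \<Rightarrow> bool) \<times> ('n \<Rightarrow> bool)) bispace" where
  "bpt L =
     \<lparr>pos_top = topology (\<lambda>U. \<exists>a\<in>carrier (pos_part L). U = {f \<in> bpt_points L. fst f a}),
      neg_top = topology (\<lambda>U. \<exists>a\<in>carrier (neg_part L). U = {f \<in> bpt_points L. snd f a})\<rparr>"


subsection \<open>The finitary biframe of opens and bisobriety\<close>

definition opens_coproduct :: "'x bispace \<Rightarrow> ('x set \<times> 'x set) set gorder" where
  "opens_coproduct X = coproduct (opens (pos_top X)) (opens (neg_top X))"

definition pos_open :: "'x bispace \<Rightarrow> 'x set \<Rightarrow> ('x set \<times> 'x set) set" where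
  "pos_open X = inj_left (opens (pos_top X)) (opens (neg_top X))"

definition neg_open :: "'x bispace \<Rightarrow> 'x set \<Rightarrow> ('x set \<times> 'x set) set" where
  "neg_open X = inj_right (opens (pos_top X)) (opens (neg_top X))"

definition Omega_fin_rel :: "'x bispace \<Rightarrow> (('x set \<times> 'x set) set \<times> ('x set \<times> 'x set) set) set" where
  "Omega_fin_rel X =
     {(pos_open X Up \<sqinter>\<^bsub>opens_coproduct X\<^esub> neg_open X Um,
       pos_open X Vp \<squnion>\<^bsub>opens_coproduct X\<^esub> neg_open X Vm) | Up Um Vp Vm.
        openin (pos_top X) Up \<and> openin (pos_top X) Vp \<and>
        openin (neg_top X) Um \<and> openin (neg_top X) Vm \<and> Up \<inter> Um \<subseteq> Vp \<union> Vm}"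

definition bOmega_fin :: "'x bispace \<Rightarrow> ('x set, 'x set, ('x set \<times> 'x set) set set) biframe" where
  "bOmega_fin X =
     \<lparr>pos_part = opens (pos_top X), neg_part = opens (neg_top X),
      main_part = quotient_frame (opens_coproduct X) (Omega_fin_rel X),
      pos_emb = quotient_map_of (opens_coproduct X) (Omega_fin_rel X) \<circ> pos_open X,
      neg_emb = quotient_map_of (opens_coproduct X) (Omega_fin_rel X) \<circ> neg_open X\<rparr>"

definition neighbourhood_map ::
  "'x bispace \<Rightarrow> 'x \<Rightarrow> ('x set \<Rightarrow> bool) \<times> ('x set \<Rightarrow> bool)" where
  "neighbourhood_map X x =
     (\<lambda>U\<in>{U. openin (pos_top X) U}. x \<in> U, \<lambda>U\<in>{U. openin (neg_top X) U}. x \<in> U)"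

definition bisober :: "'x bispace \<Rightarrow> bool" where
  "bisober X \<longleftrightarrow> bihomeomorphism X (bpt (bOmega_fin X)) (neighbourhood_map X)"

definition bisober_bisubspaces :: "'x bispace \<Rightarrow> 'x set set" where
  "bisober_bisubspaces X = {S. S \<subseteq> points X \<and> bisober (bisubspace X S)}"


section \<open>The constructions have the expected universal properties\<close>

lemma frame_explicitI:
  fixes le :: "'a \<Rightarrow> 'a \<Rightarrow> bool"
  assumes h_refl: "\<And>x. x \<in> C \<Longrightarrow> le x x"
    and h_antisym: "\<And>x y. \<lbrakk>x \<in> C; y \<in> C; le x y; le y x\<rbrakk> \<Longrightarrow> x = y"
    and h_trans: "\<And>x y z. \<lbrakk>x \<in> C; y \<in> C; z \<in> C; le x y; le y z\<rbrakk> \<Longrightarrow> le x z"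
    and h_join: "\<And>A. A \<subseteq> C \<Longrightarrow> J A \<in> C"
    and h_join_upper: "\<And>A a. \<lbrakk>A \<subseteq> C; a \<in> A\<rbrakk> \<Longrightarrow> le a (J A)"
    and h_join_least: "\<And>A z. \<lbrakk>A \<subseteq> C; z \<in> C; \<And>a. a \<in> A \<Longrightarrow> le a z\<rbrakk> \<Longrightarrow> le (J A) z"
    and h_meet: "\<And>x y. \<lbrakk>x \<in> C; y \<in> C\<rbrakk> \<Longrightarrow> m x y \<in> C"
    and h_meet_left: "\<And>x y. \<lbrakk>x \<in> C; y \<in> C\<rbrakk> \<Longrightarrow> le (m x y) x"
    and h_meet_right: "\<And>x y. \<lbrakk>x \<in> C; y \<in> C\<rbrakk> \<Longrightarrow> le (m x y) y"
    and h_meet_greatest: "\<And>x y z. \<lbrakk>x \<in> C; y \<in> C; z \<in> C; le z x; le z y\<rbrakk> \<Longrightarrow> le z (m x y)"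
    and h_distrib: "\<And>x A. \<lbrakk>x \<in> C; A \<subseteq> C\<rbrakk> \<Longrightarrow> le (m x (J A)) (J (m x ` A))"
  defines "L \<equiv> \<lparr>carrier = C, eq = (=), le = le\<rparr>"
  shows "frame L"
    and "\<And>A. A \<subseteq> C \<Longrightarrow> \<Squnion>\<^bsub>L\<^esub>A = J A"
    and "\<And>x y. \<lbrakk>x \<in> C; y \<in> C\<rbrakk> \<Longrightarrow> x \<sqinter>\<^bsub>L\<^esub> y = m x y"
proof -
  have car: "carrier L = C" and leq: "\<And>x y. (x \<sqsubseteq>\<^bsub>L\<^esub> y) = le x y" and eqq: "\<And>x y. (x .=\<^bsub>L\<^esub> y) = (x = y)"
    by (simp_all add: L_def)
  interpret po: partial_order L
  proof unfold_locales
    show "\<And>x y. \<lbrakk>x \<sqsubseteq>\<^bsub>L\<^esub> y; y \<sqsubseteq>\<^bsub>L\<^esub> x; x \<in> carrier L; y \<in> carrier L\<rbrakk> \<Longrightarrow> x .=\<^bsub>L\<^esub> y"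
      unfolding car leq eqq by (rule h_antisym)
    show "\<And>x y z. \<lbrakk>x \<sqsubseteq>\<^bsub>L\<^esub> y; y \<sqsubseteq>\<^bsub>L\<^esub> z; x \<in> carrier L; y \<in> carrier L; z \<in> carrier L\<rbrakk>
        \<Longrightarrow> x \<sqsubseteq>\<^bsub>L\<^esub> z"
      unfolding car leq eqq using h_trans by blast
    show "(.=\<^bsub>L\<^esub>) = (=)" by (simp add: L_def)
  qed (simp_all add: car leq eqq h_refl)
  have lub: "least L (J A) (Upper L A)" if A: "A \<subseteq> C" for A
    unfolding least_def
  proof (intro conjI ballI)
    show "Upper L A \<subseteq> carrier L" by (auto simp: Upper_def)
    show "J A \<in> Upper L A"
      unfolding Upper_def car leq using h_join[OF A] h_join_upper[OF A] by blast
    show "J A \<sqsubseteq>\<^bsub>L\<^esub> x" if "x \<in> Upper L A" for x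
      using that A unfolding leq by (intro h_join_least) (auto simp: Upper_def car leq)
  qed
  interpret complete_lattice L
  proof unfold_locales
    fix A assume A: "A \<subseteq> carrier L"
    show "\<exists>s. least L s (Upper L A)" using lub A car by blast
    have sub: "Lower L A \<subseteq> C" by (auto simp: Lower_def car)
    have "greatest L (J (Lower L A)) (Lower L A)"
      unfolding greatest_def
    proof (intro conjI ballI)
      show "Lower L A \<subseteq> carrier L" using sub car by simp
      show "J (Lower L A) \<in> Lower L A"
      proof -
        have "le (J (Lower L A)) a" if "a \<in> A" for a
          using that A by (intro h_join_least[OF sub]) (auto simp: Lower_def car leq)
        then show ?thesis using h_join[OF sub] by (simp add: Lower_def car leq)
      qed
      show "\<And>x. x \<in> Lower L A \<Longrightarrow> x \<sqsubseteq>\<^bsub>L\<^esub> J (Lower L A)"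
        using h_join_upper[OF sub] by (simp add: leq)
    qed
    then show "\<exists>i. greatest L i (Lower L A)" by blast
  qed
  show J: "\<Squnion>\<^bsub>L\<^esub>A = J A" if "A \<subseteq> C" for A
    using po.least_unique[OF sup_lub lub[OF that]] that unfolding car by blast
  show m: "x \<sqinter>\<^bsub>L\<^esub> y = m x y" if "x \<in> C" "y \<in> C" for x y
  proof -
    have "greatest L (m x y) (Lower L {x, y})"
      unfolding greatest_def
    proof (intro conjI ballI)
      show "Lower L {x, y} \<subseteq> carrier L" by (auto simp: Lower_def)
      show "m x y \<in> Lower L {x, y}"
        using that h_meet h_meet_left h_meet_right by (simp add: Lower_def car leq)
      show "z \<sqsubseteq>\<^bsub>L\<^esub> m x y" if "z \<in> Lower L {x, y}" for z
        using that \<open>x \<in> C\<close> \<open>y \<in> C\<close> unfolding leq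
        by (intro h_meet_greatest) (simp_all add: Lower_def car leq)
    qed
    moreover have "greatest L (x \<sqinter>\<^bsub>L\<^esub> y) (Lower L {x, y})"
      unfolding meet_def using inf_glb[of "{x, y}"] that car by simp
    ultimately show ?thesis using po.greatest_unique by blast
  qed
  show "frame L"
  proof unfold_locales
    fix x A assume x: "x \<in> carrier L" and A: "A \<subseteq> carrier L"
    have im: "(\<lambda>a. x \<sqinter>\<^bsub>L\<^esub> a) ` A = m x ` A"
      using x A m car by (auto intro!: image_cong)
    have imC: "m x ` A \<subseteq> C" using x A h_meet car by auto
    have JA: "J A \<in> C" using A car h_join by simp
    have "m x (J A) = J (m x ` A)"
    proof (rule h_antisym)
      show "m x (J A) \<in> C" "J (m x ` A) \<in> C" using x JA car h_meet h_join imC by auto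
      show "le (m x (J A)) (J (m x ` A))" using h_distrib x A car by simp
      show "le (J (m x ` A)) (m x (J A))"
      proof (rule h_join_least[OF imC])
        show "m x (J A) \<in> C" using x JA car h_meet by auto
        fix b assume "b \<in> m x ` A"
        then obtain a where a: "a \<in> A" "b = m x a" by auto
        then have aC: "a \<in> C" using A car by auto
        have xC: "x \<in> C" using x car by simp
        have "le (m x a) (J A)"
          using h_trans[OF h_meet[OF xC aC] aC JA h_meet_right[OF xC aC]] h_join_upper A a car by simp
        then show "le b (m x (J A))"
          using a h_meet_greatest[OF xC JA h_meet[OF xC aC]] h_meet_left[OF xC aC] by simp
      qed
    qed
    then show "x \<sqinter>\<^bsub>L\<^esub> \<Squnion>\<^bsub>L\<^esub>A = \<Squnion>\<^bsub>L\<^esub>((\<lambda>a. x \<sqinter>\<^bsub>L\<^esub> a) ` A)"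
      using J[of A] J[OF imC] m[of x "J A"] x A JA car im by simp
  qed
qed

lemma frame_opens: "frame (opens T)"
  and Sup_opens: "\<And>A. A \<subseteq> {U. openin T U} \<Longrightarrow> \<Squnion>\<^bsub>opens T\<^esub>A = \<Union>A"
  and meet_opens: "\<And>U V. \<lbrakk>openin T U; openin T V\<rbrakk> \<Longrightarrow> U \<sqinter>\<^bsub>opens T\<^esub> V = U \<inter> V"
proof -
  let ?C = "{U. openin T U}"
  have J: "\<And>A. A \<subseteq> ?C \<Longrightarrow> \<Union>A \<in> ?C" by (auto intro: openin_Union)
  have m: "\<And>U V. \<lbrakk>U \<in> ?C; V \<in> ?C\<rbrakk> \<Longrightarrow> U \<inter> V \<in> ?C" by auto
  have d: "\<And>U A. U \<inter> \<Union>A \<subseteq> \<Union>((\<inter>) U ` A)" by auto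
  note I = frame_explicitI[of ?C "(\<subseteq>)" Union "(\<inter>)", folded opens_def,
      OF subset_refl subset_antisym subset_trans J Union_upper Union_least m Int_lower1 Int_lower2
        Int_greatest d]
  show "frame (opens T)" by (rule I(1))
  show "\<And>A. A \<subseteq> ?C \<Longrightarrow> \<Squnion>\<^bsub>opens T\<^esub>A = \<Union>A" by (rule I(2))
  show "\<And>U V. \<lbrakk>openin T U; openin T V\<rbrakk> \<Longrightarrow> U \<sqinter>\<^bsub>opens T\<^esub> V = U \<inter> V" by (rule I(3)) auto
qed

lemma frame_two: "frame two"
  and Sup_two: "\<Squnion>\<^bsub>two\<^esub>A = (True \<in> A)"
  and meet_two: "(a \<sqinter>\<^bsub>two\<^esub> b) = (a \<and> b)"
proof -
  note I = frame_explicitI[of UNIV "(\<le>)" "\<lambda>A. True \<in> A" "(\<and>)", folded two_def]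
  show "frame two" by (rule I(1)) auto
  show "\<Squnion>\<^bsub>two\<^esub>A = (True \<in> A)" by (rule I(2)) auto
  show "(a \<sqinter>\<^bsub>two\<^esub> b) = (a \<and> b)" by (rule I(3)) auto
qed


lemma frame_mapI:
  assumes "frame L" "frame M" "\<And>x. x \<in> carrier L \<Longrightarrow> f x \<in> carrier M"
    and "f \<top>\<^bsub>L\<^esub> = \<top>\<^bsub>M\<^esub>"
    and "\<And>x y. \<lbrakk>x \<in> carrier L; y \<in> carrier L\<rbrakk> \<Longrightarrow> f (x \<sqinter>\<^bsub>L\<^esub> y) = f x \<sqinter>\<^bsub>M\<^esub> f y"
    and "\<And>A. A \<subseteq> carrier L \<Longrightarrow> f (\<Squnion>\<^bsub>L\<^esub>A) = \<Squnion>\<^bsub>M\<^esub>(f ` A)"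
  shows "frame_map L M f"
  using assms
  by (simp add: frame_map_def sup_pres_def meet_pres_def frame_def)

lemma frame_mapD:
  assumes "frame_map L M f"
  shows "\<And>x. x \<in> carrier L \<Longrightarrow> f x \<in> carrier M"
    and "f \<top>\<^bsub>L\<^esub> = \<top>\<^bsub>M\<^esub>"
    and "\<And>x y. \<lbrakk>x \<in> carrier L; y \<in> carrier L\<rbrakk> \<Longrightarrow> f (x \<sqinter>\<^bsub>L\<^esub> y) = f x \<sqinter>\<^bsub>M\<^esub> f y"
    and "\<And>A. A \<subseteq> carrier L \<Longrightarrow> f (\<Squnion>\<^bsub>L\<^esub>A) = \<Squnion>\<^bsub>M\<^esub>(f ` A)"
  using assms by (auto simp: frame_map_def sup_pres_def meet_pres_def)

context frame
begin

lemma meet_le_iff: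
  "\<lbrakk>x \<in> carrier L; y \<in> carrier L\<rbrakk> \<Longrightarrow> x \<sqsubseteq> y \<longleftrightarrow> x \<sqinter> y = x"
  using le_iff_join by metis

lemma Sup_meet_distrib:
  "\<lbrakk>x \<in> carrier L; A \<subseteq> carrier L\<rbrakk> \<Longrightarrow> \<Squnion>A \<sqinter> x = \<Squnion>((\<lambda>a. a \<sqinter> x) ` A)"
  using meet_Sup_distrib[of x A] by (simp add: meet_comm[of _ x])

lemma Sup_empty: "\<Squnion>{} = \<bottom>"
  using weak_sup_empty eq_is_equal by simp

lemma bottom_unique: "\<lbrakk>x \<in> carrier L; x \<sqsubseteq> \<bottom>\<rbrakk> \<Longrightarrow> x = \<bottom>"
  by (rule le_antisym) auto

lemma top_unique: "\<lbrakk>x \<in> carrier L; \<top> \<sqsubseteq> x\<rbrakk> \<Longrightarrow> x = \<top>"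
  by (rule le_antisym) auto

lemma meet_top: "x \<in> carrier L \<Longrightarrow> x \<sqinter> \<top> = x"
  using meet_le_iff[of x \<top>] by simp

lemma meet_bottom: "x \<in> carrier L \<Longrightarrow> x \<sqinter> \<bottom> = \<bottom>"
  by (rule bottom_unique) (auto intro: meet_right)

lemma top_meet: "x \<in> carrier L \<Longrightarrow> \<top> \<sqinter> x = x"
  using meet_top[of x] meet_comm by metis

lemma bottom_meet: "x \<in> carrier L \<Longrightarrow> \<bottom> \<sqinter> x = \<bottom>"
  using meet_bottom[of x] meet_comm by metis

lemma meet_mono:
  "\<lbrakk>x \<sqsubseteq> x'; y \<sqsubseteq> y'; x \<in> carrier L; y \<in> carrier L; x' \<in> carrier L; y' \<in> carrier L\<rbrakk>
    \<Longrightarrow> x \<sqinter> y \<sqsubseteq> x' \<sqinter> y'"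
  by (meson le_trans meet_closed meet_le meet_left meet_right)

end

lemma frame_map_mono:
  assumes "frame L" "frame M" "frame_map L M f" "x \<in> carrier L" "y \<in> carrier L" "x \<sqsubseteq>\<^bsub>L\<^esub> y"
  shows "f x \<sqsubseteq>\<^bsub>M\<^esub> f y"
  using assms frame.meet_le_iff[OF assms(1), of x y] frame.meet_le_iff[OF assms(2), of "f x" "f y"]
    frame_mapD(1,3)[OF assms(3)] by metis

lemma frame_map_bottom:
  assumes "frame L" "frame M" "frame_map L M f"
  shows "f \<bottom>\<^bsub>L\<^esub> = \<bottom>\<^bsub>M\<^esub>"
  using frame_mapD(4)[OF assms(3), of "{}"] assms(1,2) by (simp add: frame.Sup_empty)


subsection \<open>Coproduct\<close>

lemma cp_idealI:
  assumes "\<And>x y. (x, y) \<in> D \<Longrightarrow> x \<in> carrier L \<and> y \<in> carrier M"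
    and "\<And>a b a' b'. \<lbrakk>(a, b) \<in> D; a' \<in> carrier L; b' \<in> carrier M; a' \<sqsubseteq>\<^bsub>L\<^esub> a; b' \<sqsubseteq>\<^bsub>M\<^esub> b\<rbrakk>
        \<Longrightarrow> (a', b') \<in> D"
    and "\<And>A b. \<lbrakk>A \<subseteq> carrier L; b \<in> carrier M; \<And>a. a \<in> A \<Longrightarrow> (a, b) \<in> D\<rbrakk> \<Longrightarrow> (\<Squnion>\<^bsub>L\<^esub>A, b) \<in> D"
    and "\<And>a B. \<lbrakk>a \<in> carrier L; B \<subseteq> carrier M; \<And>b. b \<in> B \<Longrightarrow> (a, b) \<in> D\<rbrakk> \<Longrightarrow> (a, \<Squnion>\<^bsub>M\<^esub>B) \<in> D"
  shows "cp_ideal L M D"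
  unfolding cp_ideal_def
proof (intro conjI allI impI ballI)
  show "D \<subseteq> carrier L \<times> carrier M" using assms(1) by auto
  show "case p of (a, b) \<Rightarrow> \<forall>a'\<in>carrier L. \<forall>b'\<in>carrier M.
          a' \<sqsubseteq>\<^bsub>L\<^esub> a \<and> b' \<sqsubseteq>\<^bsub>M\<^esub> b \<longrightarrow> (a', b') \<in> D" if "p \<in> D" for p
  proof -
    obtain a b where p: "p = (a, b)" by (cases p)
    have ab: "(a, b) \<in> D" using that p by simp
    show ?thesis unfolding p prod.case
      by (intro ballI impI, elim conjE) (rule assms(2)[OF ab])
  qed
  show "(\<Squnion>\<^bsub>L\<^esub>A, b) \<in> D" if "A \<subseteq> carrier L" "b \<in> carrier M" "A \<times> {b} \<subseteq> D" for A b
    by (rule assms(3)) (use that in auto)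
  show "(a, \<Squnion>\<^bsub>M\<^esub>B) \<in> D" if "a \<in> carrier L" "B \<subseteq> carrier M" "{a} \<times> B \<subseteq> D" for a B
    by (rule assms(4)) (use that in auto)
qed

lemma cp_idealD:
  assumes "cp_ideal L M D"
  shows "\<And>x y. (x, y) \<in> D \<Longrightarrow> x \<in> carrier L" "\<And>x y. (x, y) \<in> D \<Longrightarrow> y \<in> carrier M"
    and "\<And>a b a' b'. \<lbrakk>(a, b) \<in> D; a' \<in> carrier L; b' \<in> carrier M; a' \<sqsubseteq>\<^bsub>L\<^esub> a; b' \<sqsubseteq>\<^bsub>M\<^esub> b\<rbrakk>
        \<Longrightarrow> (a', b') \<in> D"
    and "\<And>A b. \<lbrakk>A \<subseteq> carrier L; b \<in> carrier M; \<And>a. a \<in> A \<Longrightarrow> (a, b) \<in> D\<rbrakk> \<Longrightarrow> (\<Squnion>\<^bsub>L\<^esub>A, b) \<in> D"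
    and "\<And>a B. \<lbrakk>a \<in> carrier L; B \<subseteq> carrier M; \<And>b. b \<in> B \<Longrightarrow> (a, b) \<in> D\<rbrakk> \<Longrightarrow> (a, \<Squnion>\<^bsub>M\<^esub>B) \<in> D"
proof -
  have 1: "D \<subseteq> carrier L \<times> carrier M"
    using assms unfolding cp_ideal_def by (elim conjE)
  have 2: "\<forall>(a, b)\<in>D. \<forall>a'\<in>carrier L. \<forall>b'\<in>carrier M.
          a' \<sqsubseteq>\<^bsub>L\<^esub> a \<and> b' \<sqsubseteq>\<^bsub>M\<^esub> b \<longrightarrow> (a', b') \<in> D"
    using assms unfolding cp_ideal_def by (elim conjE)
  have 3: "\<forall>A\<subseteq>carrier L. \<forall>b\<in>carrier M. A \<times> {b} \<subseteq> D \<longrightarrow> (\<Squnion>\<^bsub>L\<^esub>A, b) \<in> D"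
    using assms unfolding cp_ideal_def by (elim conjE)
  have 4: "\<forall>a\<in>carrier L. \<forall>B\<subseteq>carrier M. {a} \<times> B \<subseteq> D \<longrightarrow> (a, \<Squnion>\<^bsub>M\<^esub>B) \<in> D"
    using assms unfolding cp_ideal_def by (elim conjE)
  show "x \<in> carrier L" if "(x, y) \<in> D" for x y using 1 that by blast
  show "y \<in> carrier M" if "(x, y) \<in> D" for x y using 1 that by blast
  show "(a', b') \<in> D"
    if "(a, b) \<in> D" "a' \<in> carrier L" "b' \<in> carrier M" "a' \<sqsubseteq>\<^bsub>L\<^esub> a" "b' \<sqsubseteq>\<^bsub>M\<^esub> b" for a b a' b'
    using bspec[OF 2 that(1)] that by simp
  show "(\<Squnion>\<^bsub>L\<^esub>A, b) \<in> D"
    if "A \<subseteq> carrier L" "b \<in> carrier M" "\<And>a. a \<in> A \<Longrightarrow> (a, b) \<in> D" for A b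
  proof -
    have "A \<times> {b} \<subseteq> D" using that by auto
    then show ?thesis using 3 that by simp
  qed
  show "(a, \<Squnion>\<^bsub>M\<^esub>B) \<in> D"
    if "a \<in> carrier L" "B \<subseteq> carrier M" "\<And>b. b \<in> B \<Longrightarrow> (a, b) \<in> D" for a B
  proof -
    have "{a} \<times> B \<subseteq> D" using that by auto
    then show ?thesis using 4 that by simp
  qed
qed

lemma cp_ideal_subset: "cp_ideal L M D \<Longrightarrow> D \<subseteq> carrier L \<times> carrier M"
  unfolding cp_ideal_def by (elim conjE)

definition cp_closure :: "'a gorder \<Rightarrow> 'b gorder \<Rightarrow> ('a \<times> 'b) set \<Rightarrow> ('a \<times> 'b) set" where
  "cp_closure L M S = \<Inter>{D. cp_ideal L M D \<and> S \<subseteq> D}"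

context
  fixes L :: "'a gorder" and M :: "'b gorder"
  assumes frL: "frame L" and frM: "frame M"
begin

interpretation L: frame L by (rule frL)
interpretation M: frame M by (rule frM)

lemma cp_ideal_full: "cp_ideal L M (carrier L \<times> carrier M)"
  by (rule cp_idealI) auto

lemma cp_ideal_Int: "\<lbrakk>cp_ideal L M D; cp_ideal L M E\<rbrakk> \<Longrightarrow> cp_ideal L M (D \<inter> E)"
proof (rule cp_idealI)
  assume D: "cp_ideal L M D" and E: "cp_ideal L M E"
  show "x \<in> carrier L \<and> y \<in> carrier M" if "(x, y) \<in> D \<inter> E" for x y
    using that cp_idealD(1,2)[OF D] by blast
  show "(a', b') \<in> D \<inter> E"
    if "(a, b) \<in> D \<inter> E" "a' \<in> carrier L" "b' \<in> carrier M" "a' \<sqsubseteq>\<^bsub>L\<^esub> a" "b' \<sqsubseteq>\<^bsub>M\<^esub> b" for a b a' b'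
    using that cp_idealD(3)[OF D, of a b] cp_idealD(3)[OF E, of a b] by simp
  show "(\<Squnion>\<^bsub>L\<^esub>A, b) \<in> D \<inter> E"
    if "A \<subseteq> carrier L" "b \<in> carrier M" "\<And>a. a \<in> A \<Longrightarrow> (a, b) \<in> D \<inter> E" for A b
    using that cp_idealD(4)[OF D, of A b] cp_idealD(4)[OF E, of A b] by auto
  show "(a, \<Squnion>\<^bsub>M\<^esub>B) \<in> D \<inter> E"
    if "a \<in> carrier L" "B \<subseteq> carrier M" "\<And>b. b \<in> B \<Longrightarrow> (a, b) \<in> D \<inter> E" for a B
    using that cp_idealD(5)[OF D, of a B] cp_idealD(5)[OF E, of a B] by auto
qed

lemma cp_ideal_closure:
  assumes "S \<subseteq> carrier L \<times> carrier M"
  shows "cp_ideal L M (cp_closure L M S)"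
proof (rule cp_idealI)
  fix x y assume "(x, y) \<in> cp_closure L M S"
  then show "x \<in> carrier L \<and> y \<in> carrier M"
    using cp_ideal_full assms unfolding cp_closure_def by blast
next
  fix a b a' b'
  assume *: "(a, b) \<in> cp_closure L M S" "a' \<in> carrier L" "b' \<in> carrier M" "a' \<sqsubseteq>\<^bsub>L\<^esub> a" "b' \<sqsubseteq>\<^bsub>M\<^esub> b"
  have "(a', b') \<in> D" if "cp_ideal L M D" "S \<subseteq> D" for D
    using *(1) that unfolding cp_closure_def by (intro cp_idealD(3)[OF that(1) _ *(2-5)]) blast
  then show "(a', b') \<in> cp_closure L M S" unfolding cp_closure_def by blast
next
  fix A b
  assume *: "A \<subseteq> carrier L" "b \<in> carrier M" "\<And>a. a \<in> A \<Longrightarrow> (a, b) \<in> cp_closure L M S"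
  have "(\<Squnion>\<^bsub>L\<^esub>A, b) \<in> D" if "cp_ideal L M D" "S \<subseteq> D" for D
    using *(3) that unfolding cp_closure_def by (intro cp_idealD(4)[OF that(1) *(1,2)]) blast
  then show "(\<Squnion>\<^bsub>L\<^esub>A, b) \<in> cp_closure L M S" unfolding cp_closure_def by blast
next
  fix a B
  assume *: "a \<in> carrier L" "B \<subseteq> carrier M" "\<And>b. b \<in> B \<Longrightarrow> (a, b) \<in> cp_closure L M S"
  have "(a, \<Squnion>\<^bsub>M\<^esub>B) \<in> D" if "cp_ideal L M D" "S \<subseteq> D" for D
    using *(3) that unfolding cp_closure_def by (intro cp_idealD(5)[OF that(1) *(1,2)]) blast
  then show "(a, \<Squnion>\<^bsub>M\<^esub>B) \<in> cp_closure L M S" unfolding cp_closure_def by blast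
qed

lemma cp_closure_upper: "S \<subseteq> cp_closure L M S"
  unfolding cp_closure_def by blast

lemma cp_closure_least: "\<lbrakk>cp_ideal L M D; S \<subseteq> D\<rbrakk> \<Longrightarrow> cp_closure L M S \<subseteq> D"
  unfolding cp_closure_def by blast

lemma cp_ideal_bottom:
  assumes "cp_ideal L M D"
  shows "y \<in> carrier M \<Longrightarrow> (\<bottom>\<^bsub>L\<^esub>, y) \<in> D" "x \<in> carrier L \<Longrightarrow> (x, \<bottom>\<^bsub>M\<^esub>) \<in> D"
  using cp_idealD(4)[OF assms, of "{}" y] cp_idealD(5)[OF assms, of x "{}"]
  by (simp_all add: L.Sup_empty M.Sup_empty)

lemma cp_distrib:
  assumes D: "cp_ideal L M D" and \<A>: "\<A> \<subseteq> {D. cp_ideal L M D}"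
  shows "D \<inter> cp_closure L M (\<Union>\<A>) \<subseteq> cp_closure L M (\<Union>((\<inter>) D ` \<A>))"
proof -
  let ?E = "cp_closure L M (\<Union>((\<inter>) D ` \<A>))"
  let ?W = "{(x, y). x \<in> carrier L \<and> y \<in> carrier M \<and>
     (\<forall>x'\<in>carrier L. \<forall>y'\<in>carrier M. x' \<sqsubseteq>\<^bsub>L\<^esub> x \<longrightarrow> y' \<sqsubseteq>\<^bsub>M\<^esub> y \<longrightarrow> (x', y') \<in> D \<longrightarrow> (x', y') \<in> ?E)}"
  have E: "cp_ideal L M ?E"
    by (rule cp_ideal_closure) (use cp_idealD(1,2)[OF D] in auto)
  have W: "cp_ideal L M ?W"
  proof (rule cp_idealI)
    fix a b a' b'
    assume "(a, b) \<in> ?W" "a' \<in> carrier L" "b' \<in> carrier M" "a' \<sqsubseteq>\<^bsub>L\<^esub> a" "b' \<sqsubseteq>\<^bsub>M\<^esub> b"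
    then show "(a', b') \<in> ?W"
      by (clarsimp) (meson L.le_trans M.le_trans)
  next
    fix A b
    assume A: "A \<subseteq> carrier L" and b: "b \<in> carrier M" and AW: "\<And>a. a \<in> A \<Longrightarrow> (a, b) \<in> ?W"
    have "(x', y') \<in> ?E"
      if x': "x' \<in> carrier L" and y': "y' \<in> carrier M" and le: "x' \<sqsubseteq>\<^bsub>L\<^esub> \<Squnion>\<^bsub>L\<^esub>A" "y' \<sqsubseteq>\<^bsub>M\<^esub> b"
        and xyD: "(x', y') \<in> D" for x' y'
    proof -
      have eq: "x' = \<Squnion>\<^bsub>L\<^esub>((\<lambda>a. x' \<sqinter>\<^bsub>L\<^esub> a) ` A)"
        using L.meet_le_iff[of x' "\<Squnion>\<^bsub>L\<^esub>A"] L.meet_Sup_distrib[OF x' A] A x' le(1) by simp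
      have "(x' \<sqinter>\<^bsub>L\<^esub> a, y') \<in> ?E" if a: "a \<in> A" for a
      proof -
        have aL: "a \<in> carrier L" using a A by auto
        have "(x' \<sqinter>\<^bsub>L\<^esub> a, y') \<in> D"
          using cp_idealD(3)[OF D xyD] aL x' y' L.meet_left by simp
        then show ?thesis using AW[OF a] aL x' y' L.meet_right le(2) by simp
      qed
      then have "(\<Squnion>\<^bsub>L\<^esub>((\<lambda>a. x' \<sqinter>\<^bsub>L\<^esub> a) ` A), y') \<in> ?E"
        using A x' y' by (intro cp_idealD(4)[OF E]) auto
      then show ?thesis using eq by simp
    qed
    then show "(\<Squnion>\<^bsub>L\<^esub>A, b) \<in> ?W" using A b by simp
  next
    fix a B
    assume a: "a \<in> carrier L" and B: "B \<subseteq> carrier M" and BW: "\<And>b. b \<in> B \<Longrightarrow> (a, b) \<in> ?W"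
    have "(x', y') \<in> ?E"
      if x': "x' \<in> carrier L" and y': "y' \<in> carrier M" and le: "x' \<sqsubseteq>\<^bsub>L\<^esub> a" "y' \<sqsubseteq>\<^bsub>M\<^esub> \<Squnion>\<^bsub>M\<^esub>B"
        and xyD: "(x', y') \<in> D" for x' y'
    proof -
      have eq: "y' = \<Squnion>\<^bsub>M\<^esub>((\<lambda>b. y' \<sqinter>\<^bsub>M\<^esub> b) ` B)"
        using M.meet_le_iff[of y' "\<Squnion>\<^bsub>M\<^esub>B"] M.meet_Sup_distrib[OF y' B] B y' le(2) by simp
      have "(x', y' \<sqinter>\<^bsub>M\<^esub> b) \<in> ?E" if b: "b \<in> B" for b
      proof -
        have bM: "b \<in> carrier M" using b B by auto
        have "(x', y' \<sqinter>\<^bsub>M\<^esub> b) \<in> D"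
          using cp_idealD(3)[OF D xyD] bM x' y' M.meet_left by simp
        then show ?thesis using BW[OF b] bM x' y' M.meet_right le(1) by simp
      qed
      then have "(x', \<Squnion>\<^bsub>M\<^esub>((\<lambda>b. y' \<sqinter>\<^bsub>M\<^esub> b) ` B)) \<in> ?E"
        using B x' y' by (intro cp_idealD(5)[OF E]) auto
      then show ?thesis using eq by simp
    qed
    then show "(a, \<Squnion>\<^bsub>M\<^esub>B) \<in> ?W" using a B by simp
  qed auto
  have "\<Union>\<A> \<subseteq> ?W"
  proof clarify
    fix x y C assume C: "C \<in> \<A>" and xy: "(x, y) \<in> C"
    have Ci: "cp_ideal L M C" using C \<A> by auto
    have "(x', y') \<in> ?E"
      if "x' \<in> carrier L" "y' \<in> carrier M" "x' \<sqsubseteq>\<^bsub>L\<^esub> x" "y' \<sqsubseteq>\<^bsub>M\<^esub> y" "(x', y') \<in> D" for x' y'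
    proof (rule subsetD[OF cp_closure_upper])
      have "(x', y') \<in> C" by (rule cp_idealD(3)[OF Ci xy that(1-4)])
      then show "(x', y') \<in> \<Union>((\<inter>) D ` \<A>)" using that(5) C by auto
    qed
    then show "x \<in> carrier L \<and> y \<in> carrier M \<and>
     (\<forall>x'\<in>carrier L. \<forall>y'\<in>carrier M. x' \<sqsubseteq>\<^bsub>L\<^esub> x \<longrightarrow> y' \<sqsubseteq>\<^bsub>M\<^esub> y \<longrightarrow> (x', y') \<in> D \<longrightarrow> (x', y') \<in> ?E)"
      using cp_idealD(1,2)[OF Ci xy] by (intro conjI ballI impI)
  qed
  then have cW: "cp_closure L M (\<Union>\<A>) \<subseteq> ?W" by (rule cp_closure_least[OF W])
  show ?thesis
  proof clarify
    fix x y assume "(x, y) \<in> D" "(x, y) \<in> cp_closure L M (\<Union>\<A>)"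
    moreover from this(2) have "(x, y) \<in> ?W" by (rule subsetD[OF cW])
    ultimately show "(x, y) \<in> ?E" using L.le_refl M.le_refl by simp
  qed
qed

lemma carrier_coproduct: "carrier (coproduct L M) = {D. cp_ideal L M D}"
  and le_coproduct: "D \<sqsubseteq>\<^bsub>coproduct L M\<^esub> E \<longleftrightarrow> D \<subseteq> E"
  by (simp_all add: coproduct_def)

lemma frame_coproduct: "frame (coproduct L M)"
  and Sup_coproduct:
    "\<And>\<A>. \<A> \<subseteq> {D. cp_ideal L M D} \<Longrightarrow> \<Squnion>\<^bsub>coproduct L M\<^esub>\<A> = cp_closure L M (\<Union>\<A>)"
  and meet_coproduct:
    "\<And>D E. \<lbrakk>cp_ideal L M D; cp_ideal L M E\<rbrakk> \<Longrightarrow> D \<sqinter>\<^bsub>coproduct L M\<^esub> E = D \<inter> E"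
proof -
  let ?C = "{D. cp_ideal L M D}"
  let ?J = "\<lambda>\<A>. cp_closure L M (\<Union>\<A>)"
  have J: "\<And>A. A \<subseteq> ?C \<Longrightarrow> ?J A \<in> ?C"
    unfolding mem_Collect_eq
    by (rule cp_ideal_closure, rule Union_least) (auto dest: cp_ideal_subset)
  have up: "\<And>A D. \<lbrakk>A \<subseteq> ?C; D \<in> A\<rbrakk> \<Longrightarrow> D \<subseteq> ?J A"
    by (rule subset_trans[OF Union_upper cp_closure_upper])
  have least: "\<And>A E. \<lbrakk>A \<subseteq> ?C; E \<in> ?C; \<And>D. D \<in> A \<Longrightarrow> D \<subseteq> E\<rbrakk> \<Longrightarrow> ?J A \<subseteq> E"
    unfolding mem_Collect_eq by (rule cp_closure_least, assumption) (rule Union_least)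
  have m: "\<And>D E. \<lbrakk>D \<in> ?C; E \<in> ?C\<rbrakk> \<Longrightarrow> D \<inter> E \<in> ?C" unfolding mem_Collect_eq by (rule cp_ideal_Int)
  have d: "\<And>D A. \<lbrakk>D \<in> ?C; A \<subseteq> ?C\<rbrakk> \<Longrightarrow> D \<inter> ?J A \<subseteq> ?J ((\<inter>) D ` A)"
    unfolding mem_Collect_eq by (rule cp_distrib)
  note I = frame_explicitI[of ?C "(\<subseteq>)" ?J "(\<inter>)", folded coproduct_def,
      OF subset_refl subset_antisym subset_trans J up least m Int_lower1 Int_lower2
        Int_greatest d]
  show "frame (coproduct L M)" by (rule I(1))
  show "\<And>\<A>. \<A> \<subseteq> {D. cp_ideal L M D} \<Longrightarrow> \<Squnion>\<^bsub>coproduct L M\<^esub>\<A> = cp_closure L M (\<Union>\<A>)"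
    by (rule I(2))
  show "\<And>D E. \<lbrakk>cp_ideal L M D; cp_ideal L M E\<rbrakk> \<Longrightarrow> D \<sqinter>\<^bsub>coproduct L M\<^esub> E = D \<inter> E"
    by (rule I(3)) auto
qed

lemma top_coproduct: "\<top>\<^bsub>coproduct L M\<^esub> = carrier L \<times> carrier M"
proof -
  interpret F: frame "coproduct L M" by (rule frame_coproduct)
  show ?thesis
  proof
    show "\<top>\<^bsub>coproduct L M\<^esub> \<subseteq> carrier L \<times> carrier M"
      using F.top_closed cp_ideal_subset unfolding carrier_coproduct by blast
    show "carrier L \<times> carrier M \<subseteq> \<top>\<^bsub>coproduct L M\<^esub>"
      using F.top_higher cp_ideal_full unfolding carrier_coproduct le_coproduct by simp
  qed
qed

lemma cp_ideal_inj_left: "a \<in> carrier L \<Longrightarrow> cp_ideal L M (inj_left L M a)"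
proof (rule cp_idealI)
  fix x y x' y' assume *: "(x, y) \<in> inj_left L M a" "x' \<in> carrier L" "y' \<in> carrier M"
    "x' \<sqsubseteq>\<^bsub>L\<^esub> x" "y' \<sqsubseteq>\<^bsub>M\<^esub> y" and a: "a \<in> carrier L"
  show "(x', y') \<in> inj_left L M a"
    using * L.le_trans[OF *(4) _ *(2) _ a] M.bottom_unique[OF *(3)] by (auto simp: inj_left_def)
next
  fix A b assume A: "A \<subseteq> carrier L" "b \<in> carrier M" "\<And>x. x \<in> A \<Longrightarrow> (x, b) \<in> inj_left L M a"
    and a: "a \<in> carrier L"
  show "(\<Squnion>\<^bsub>L\<^esub>A, b) \<in> inj_left L M a"
    using A a L.sup_least[OF A(1) a] by (fastforce simp: inj_left_def)
next
  fix x B assume B: "x \<in> carrier L" "B \<subseteq> carrier M" "\<And>y. y \<in> B \<Longrightarrow> (x, y) \<in> inj_left L M a"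
    and a: "a \<in> carrier L"
  show "(x, \<Squnion>\<^bsub>M\<^esub>B) \<in> inj_left L M a"
  proof (cases "x \<sqsubseteq>\<^bsub>L\<^esub> a")
    case True then show ?thesis using B by (simp add: inj_left_def)
  next
    case False
    then have "\<And>y. y \<in> B \<Longrightarrow> y = \<bottom>\<^bsub>M\<^esub>" using B(3) by (auto simp: inj_left_def)
    then have "\<Squnion>\<^bsub>M\<^esub>B = \<bottom>\<^bsub>M\<^esub>"
      using B(2) by (intro M.bottom_unique M.sup_least) (auto intro: M.le_refl)
    then show ?thesis using B by (simp add: inj_left_def)
  qed
qed (auto simp: inj_left_def)

lemma cp_ideal_inj_right: "b \<in> carrier M \<Longrightarrow> cp_ideal L M (inj_right L M b)"
proof (rule cp_idealI)
  fix x y x' y' assume *: "(x, y) \<in> inj_right L M b" "x' \<in> carrier L" "y' \<in> carrier M"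
    "x' \<sqsubseteq>\<^bsub>L\<^esub> x" "y' \<sqsubseteq>\<^bsub>M\<^esub> y" and b: "b \<in> carrier M"
  show "(x', y') \<in> inj_right L M b"
    using * M.le_trans[OF *(5) _ *(3) _ b] L.bottom_unique[OF *(2)] by (auto simp: inj_right_def)
next
  fix a B assume B: "a \<in> carrier L" "B \<subseteq> carrier M" "\<And>y. y \<in> B \<Longrightarrow> (a, y) \<in> inj_right L M b"
    and b: "b \<in> carrier M"
  show "(a, \<Squnion>\<^bsub>M\<^esub>B) \<in> inj_right L M b"
    using B b M.sup_least[OF B(2) b] by (fastforce simp: inj_right_def)
next
  fix A y assume A: "A \<subseteq> carrier L" "y \<in> carrier M" "\<And>x. x \<in> A \<Longrightarrow> (x, y) \<in> inj_right L M b"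
    and b: "b \<in> carrier M"
  show "(\<Squnion>\<^bsub>L\<^esub>A, y) \<in> inj_right L M b"
  proof (cases "y \<sqsubseteq>\<^bsub>M\<^esub> b")
    case True then show ?thesis using A by (simp add: inj_right_def)
  next
    case False
    then have "\<And>x. x \<in> A \<Longrightarrow> x = \<bottom>\<^bsub>L\<^esub>" using A(3) by (auto simp: inj_right_def)
    then have "\<Squnion>\<^bsub>L\<^esub>A = \<bottom>\<^bsub>L\<^esub>"
      using A(1) by (intro L.bottom_unique L.sup_least) (auto intro: L.le_refl)
    then show ?thesis using A by (simp add: inj_right_def)
  qed
qed (auto simp: inj_right_def)

lemma frame_map_inj_left: "frame_map L (coproduct L M) (inj_left L M)"
proof (rule frame_mapI[OF frL frame_coproduct])
  show "inj_left L M x \<in> carrier (coproduct L M)" if "x \<in> carrier L" for x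
    using cp_ideal_inj_left[OF that] by (simp add: carrier_coproduct)
  show "inj_left L M \<top>\<^bsub>L\<^esub> = \<top>\<^bsub>coproduct L M\<^esub>"
    by (auto simp: inj_left_def top_coproduct)
  show "inj_left L M (a \<sqinter>\<^bsub>L\<^esub> b) = inj_left L M a \<sqinter>\<^bsub>coproduct L M\<^esub> inj_left L M b"
    if "a \<in> carrier L" "b \<in> carrier L" for a b
  proof -
    have "x \<sqsubseteq>\<^bsub>L\<^esub> a \<sqinter>\<^bsub>L\<^esub> b \<longleftrightarrow> x \<sqsubseteq>\<^bsub>L\<^esub> a \<and> x \<sqsubseteq>\<^bsub>L\<^esub> b" if "x \<in> carrier L" for x
      using that \<open>a \<in> _\<close> \<open>b \<in> _\<close>
      by (meson L.le_trans L.meet_closed L.meet_le L.meet_left L.meet_right)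
    then show ?thesis
      using meet_coproduct[OF cp_ideal_inj_left cp_ideal_inj_left] that by (auto simp: inj_left_def)
  qed
  show "inj_left L M (\<Squnion>\<^bsub>L\<^esub>A) = \<Squnion>\<^bsub>coproduct L M\<^esub>(inj_left L M ` A)" if A: "A \<subseteq> carrier L" for A
  proof -
    let ?E = "cp_closure L M (\<Union>(inj_left L M ` A))"
    have sub: "inj_left L M ` A \<subseteq> {D. cp_ideal L M D}" using A cp_ideal_inj_left by auto
    have E: "cp_ideal L M ?E"
      by (rule cp_ideal_closure) (auto simp: inj_left_def)
    have "?E \<subseteq> inj_left L M (\<Squnion>\<^bsub>L\<^esub>A)"
    proof (rule cp_closure_least)
      show "cp_ideal L M (inj_left L M (\<Squnion>\<^bsub>L\<^esub>A))" using A cp_ideal_inj_left by simp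
      have "x \<sqsubseteq>\<^bsub>L\<^esub> \<Squnion>\<^bsub>L\<^esub>A" if "a \<in> A" "x \<in> carrier L" "x \<sqsubseteq>\<^bsub>L\<^esub> a" for a x
        using that A L.sup_upper[OF A that(1)] by (meson L.le_trans L.sup_closed subsetD)
      then show "\<Union>(inj_left L M ` A) \<subseteq> inj_left L M (\<Squnion>\<^bsub>L\<^esub>A)" by (auto simp: inj_left_def)
    qed
    moreover have "inj_left L M (\<Squnion>\<^bsub>L\<^esub>A) \<subseteq> ?E"
    proof clarify
      fix x y assume "(x, y) \<in> inj_left L M (\<Squnion>\<^bsub>L\<^esub>A)"
      then have x: "x \<in> carrier L" and y: "y \<in> carrier M" and "x \<sqsubseteq>\<^bsub>L\<^esub> \<Squnion>\<^bsub>L\<^esub>A \<or> y = \<bottom>\<^bsub>M\<^esub>"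
        by (auto simp: inj_left_def)
      then consider "x \<sqsubseteq>\<^bsub>L\<^esub> \<Squnion>\<^bsub>L\<^esub>A" | "y = \<bottom>\<^bsub>M\<^esub>" by blast
      then show "(x, y) \<in> ?E"
      proof cases
        case 1
        then have eq: "x = \<Squnion>\<^bsub>L\<^esub>((\<lambda>a. x \<sqinter>\<^bsub>L\<^esub> a) ` A)"
          using L.meet_le_iff[of x "\<Squnion>\<^bsub>L\<^esub>A"] L.meet_Sup_distrib[OF x A] A x by simp
        have "(x \<sqinter>\<^bsub>L\<^esub> a, y) \<in> ?E" if "a \<in> A" for a
        proof -
          have "(x \<sqinter>\<^bsub>L\<^esub> a, y) \<in> inj_left L M a"
            using that A x y L.meet_right by (auto simp: inj_left_def)
          then show ?thesis using that by (intro subsetD[OF cp_closure_upper] UN_I)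
        qed
        then have "(\<Squnion>\<^bsub>L\<^esub>((\<lambda>a. x \<sqinter>\<^bsub>L\<^esub> a) ` A), y) \<in> ?E"
          using A x y by (intro cp_idealD(4)[OF E]) auto
        then show ?thesis using eq by simp
      next
        case 2 then show ?thesis using cp_ideal_bottom(2)[OF E x] by simp
      qed
    qed
    ultimately show ?thesis using Sup_coproduct[OF sub] by simp
  qed
qed

lemma frame_map_inj_right: "frame_map M (coproduct L M) (inj_right L M)"
proof (rule frame_mapI[OF frM frame_coproduct])
  show "inj_right L M x \<in> carrier (coproduct L M)" if "x \<in> carrier M" for x
    using cp_ideal_inj_right[OF that] by (simp add: carrier_coproduct)
  show "inj_right L M \<top>\<^bsub>M\<^esub> = \<top>\<^bsub>coproduct L M\<^esub>"
    by (auto simp: inj_right_def top_coproduct)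
  show "inj_right L M (a \<sqinter>\<^bsub>M\<^esub> b) = inj_right L M a \<sqinter>\<^bsub>coproduct L M\<^esub> inj_right L M b"
    if "a \<in> carrier M" "b \<in> carrier M" for a b
  proof -
    have "x \<sqsubseteq>\<^bsub>M\<^esub> a \<sqinter>\<^bsub>M\<^esub> b \<longleftrightarrow> x \<sqsubseteq>\<^bsub>M\<^esub> a \<and> x \<sqsubseteq>\<^bsub>M\<^esub> b" if "x \<in> carrier M" for x
      using that \<open>a \<in> _\<close> \<open>b \<in> _\<close>
      by (meson M.le_trans M.meet_closed M.meet_le M.meet_left M.meet_right)
    then show ?thesis
      using meet_coproduct[OF cp_ideal_inj_right cp_ideal_inj_right] that
      by (auto simp: inj_right_def)
  qed
  show "inj_right L M (\<Squnion>\<^bsub>M\<^esub>B) = \<Squnion>\<^bsub>coproduct L M\<^esub>(inj_right L M ` B)" if B: "B \<subseteq> carrier M" for B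
  proof -
    let ?E = "cp_closure L M (\<Union>(inj_right L M ` B))"
    have sub: "inj_right L M ` B \<subseteq> {D. cp_ideal L M D}" using B cp_ideal_inj_right by auto
    have E: "cp_ideal L M ?E"
      by (rule cp_ideal_closure) (auto simp: inj_right_def)
    have "?E \<subseteq> inj_right L M (\<Squnion>\<^bsub>M\<^esub>B)"
    proof (rule cp_closure_least)
      show "cp_ideal L M (inj_right L M (\<Squnion>\<^bsub>M\<^esub>B))" using B cp_ideal_inj_right by simp
      have "y \<sqsubseteq>\<^bsub>M\<^esub> \<Squnion>\<^bsub>M\<^esub>B" if "b \<in> B" "y \<in> carrier M" "y \<sqsubseteq>\<^bsub>M\<^esub> b" for b y
        using that B M.sup_upper[OF B that(1)] by (meson M.le_trans M.sup_closed subsetD)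
      then show "\<Union>(inj_right L M ` B) \<subseteq> inj_right L M (\<Squnion>\<^bsub>M\<^esub>B)" by (auto simp: inj_right_def)
    qed
    moreover have "inj_right L M (\<Squnion>\<^bsub>M\<^esub>B) \<subseteq> ?E"
    proof clarify
      fix x y assume "(x, y) \<in> inj_right L M (\<Squnion>\<^bsub>M\<^esub>B)"
      then have x: "x \<in> carrier L" and y: "y \<in> carrier M" and "x = \<bottom>\<^bsub>L\<^esub> \<or> y \<sqsubseteq>\<^bsub>M\<^esub> \<Squnion>\<^bsub>M\<^esub>B"
        by (auto simp: inj_right_def)
      then consider "y \<sqsubseteq>\<^bsub>M\<^esub> \<Squnion>\<^bsub>M\<^esub>B" | "x = \<bottom>\<^bsub>L\<^esub>" by blast
      then show "(x, y) \<in> ?E"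
      proof cases
        case 1
        then have eq: "y = \<Squnion>\<^bsub>M\<^esub>((\<lambda>b. y \<sqinter>\<^bsub>M\<^esub> b) ` B)"
          using M.meet_le_iff[of y "\<Squnion>\<^bsub>M\<^esub>B"] M.meet_Sup_distrib[OF y B] B y by simp
        have "(x, y \<sqinter>\<^bsub>M\<^esub> b) \<in> ?E" if "b \<in> B" for b
        proof -
          have "(x, y \<sqinter>\<^bsub>M\<^esub> b) \<in> inj_right L M b"
            using that B x y M.meet_right by (auto simp: inj_right_def)
          then show ?thesis using that by (intro subsetD[OF cp_closure_upper] UN_I)
        qed
        then have "(x, \<Squnion>\<^bsub>M\<^esub>((\<lambda>b. y \<sqinter>\<^bsub>M\<^esub> b) ` B)) \<in> ?E"
          using B x y by (intro cp_idealD(5)[OF E]) auto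
        then show ?thesis using eq by simp
      next
        case 2 then show ?thesis using cp_ideal_bottom(1)[OF E y] by simp
      qed
    qed
    ultimately show ?thesis using Sup_coproduct[OF sub] by simp
  qed
qed

lemma inj_left_meet_inj_right:
  assumes "a \<in> carrier L" "b \<in> carrier M"
  shows "inj_left L M a \<sqinter>\<^bsub>coproduct L M\<^esub> inj_right L M b =
    {(x, y). x \<in> carrier L \<and> y \<in> carrier M \<and>
      (x \<sqsubseteq>\<^bsub>L\<^esub> a \<and> y \<sqsubseteq>\<^bsub>M\<^esub> b \<or> x = \<bottom>\<^bsub>L\<^esub> \<or> y = \<bottom>\<^bsub>M\<^esub>)}"
  using meet_coproduct[OF cp_ideal_inj_left cp_ideal_inj_right] assms
  by (auto simp: inj_left_def inj_right_def)

lemma coproduct_generated: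
  assumes D: "cp_ideal L M D"
  shows "D = \<Squnion>\<^bsub>coproduct L M\<^esub>
    ((\<lambda>(a, b). inj_left L M a \<sqinter>\<^bsub>coproduct L M\<^esub> inj_right L M b) ` D)"
proof -
  interpret F: frame "coproduct L M" by (rule frame_coproduct)
  let ?r = "\<lambda>(a, b). inj_left L M a \<sqinter>\<^bsub>coproduct L M\<^esub> inj_right L M b"
  have sub: "?r ` D \<subseteq> {D. cp_ideal L M D}"
    using cp_idealD(1,2)[OF D] frame_mapD(1)[OF frame_map_inj_left]
      frame_mapD(1)[OF frame_map_inj_right] F.meet_closed
    by (fastforce simp: carrier_coproduct)
  have rD: "?r p \<subseteq> D" if "p \<in> D" for p
  proof -
    obtain a b where p: "p = (a, b)" by fastforce
    have ab: "a \<in> carrier L" "b \<in> carrier M" using that p cp_idealD(1,2)[OF D] by auto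
    show ?thesis
      using cp_idealD(3)[OF D, of a b] that p cp_ideal_bottom[OF D]
      by (auto simp: inj_left_meet_inj_right[OF ab])
  qed
  have pr: "p \<in> ?r p" if "p \<in> D" for p
  proof -
    obtain a b where p: "p = (a, b)" by fastforce
    have ab: "a \<in> carrier L" "b \<in> carrier M" using that p cp_idealD(1,2)[OF D] by auto
    show ?thesis using ab p by (auto simp: inj_left_meet_inj_right[OF ab])
  qed
  have "\<Union>(?r ` D) = D" using rD pr by blast
  moreover have "cp_closure L M D = D"
    using cp_closure_upper cp_closure_least[OF D] by blast
  ultimately show ?thesis using Sup_coproduct[OF sub] by simp
qed

lemma coproduct_universal:
  assumes frN: "frame N" and f: "frame_map L N f" and g: "frame_map M N g"
  shows "frame_map (coproduct L M) N (copair N f g)"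
    and "\<And>a. a \<in> carrier L \<Longrightarrow> copair N f g (inj_left L M a) = f a"
    and "\<And>b. b \<in> carrier M \<Longrightarrow> copair N f g (inj_right L M b) = g b"
    and "\<And>h D. \<lbrakk>frame_map (coproduct L M) N h;
        \<And>a. a \<in> carrier L \<Longrightarrow> h (inj_left L M a) = f a;
        \<And>b. b \<in> carrier M \<Longrightarrow> h (inj_right L M b) = g b; D \<in> carrier (coproduct L M)\<rbrakk>
      \<Longrightarrow> h D = copair N f g D"
proof -
  interpret N: frame N by (rule frN)
  note fc = frame_mapD(1)[OF f] and gc = frame_mapD(1)[OF g]
  note fmono = frame_map_mono[OF frL frN f] and gmono = frame_map_mono[OF frM frN g]
  let ?t = "\<lambda>(a, b). f a \<sqinter>\<^bsub>N\<^esub> g b"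
  let ?h = "copair N f g"
  let ?K = "\<lambda>z. {(a, b). a \<in> carrier L \<and> b \<in> carrier M \<and> f a \<sqinter>\<^bsub>N\<^esub> g b \<sqsubseteq>\<^bsub>N\<^esub> z}"
  have K: "cp_ideal L M (?K z)" if z: "z \<in> carrier N" for z
  proof (rule cp_idealI)
    fix a b a' b'
    assume *: "(a, b) \<in> ?K z" "a' \<in> carrier L" "b' \<in> carrier M" "a' \<sqsubseteq>\<^bsub>L\<^esub> a" "b' \<sqsubseteq>\<^bsub>M\<^esub> b"
    have "f a' \<sqinter>\<^bsub>N\<^esub> g b' \<sqsubseteq>\<^bsub>N\<^esub> f a \<sqinter>\<^bsub>N\<^esub> g b"
      using * fmono[of a' a] gmono[of b' b] fc gc by (intro N.meet_mono) auto
    then show "(a', b') \<in> ?K z"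
      using * z fc gc N.le_trans[of "f a' \<sqinter>\<^bsub>N\<^esub> g b'" "f a \<sqinter>\<^bsub>N\<^esub> g b" z] by simp
  next
    fix A b assume A: "A \<subseteq> carrier L" and b: "b \<in> carrier M" and AK: "\<And>a. a \<in> A \<Longrightarrow> (a, b) \<in> ?K z"
    have fA: "f ` A \<subseteq> carrier N" using A fc by auto
    have "f (\<Squnion>\<^bsub>L\<^esub>A) \<sqinter>\<^bsub>N\<^esub> g b = \<Squnion>\<^bsub>N\<^esub>((\<lambda>x. x \<sqinter>\<^bsub>N\<^esub> g b) ` f ` A)"
      using frame_mapD(4)[OF f A] N.Sup_meet_distrib[OF gc[OF b] fA] by simp
    also have "\<dots> \<sqsubseteq>\<^bsub>N\<^esub> z"
      using fA z AK gc[OF b] by (intro N.sup_least) auto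
    finally show "(\<Squnion>\<^bsub>L\<^esub>A, b) \<in> ?K z" using A b by simp
  next
    fix a B assume a: "a \<in> carrier L" and B: "B \<subseteq> carrier M" and BK: "\<And>b. b \<in> B \<Longrightarrow> (a, b) \<in> ?K z"
    have gB: "g ` B \<subseteq> carrier N" using B gc by auto
    have "f a \<sqinter>\<^bsub>N\<^esub> g (\<Squnion>\<^bsub>M\<^esub>B) = \<Squnion>\<^bsub>N\<^esub>((\<lambda>x. f a \<sqinter>\<^bsub>N\<^esub> x) ` g ` B)"
      using frame_mapD(4)[OF g B] N.meet_Sup_distrib[OF fc[OF a] gB] by simp
    also have "\<dots> \<sqsubseteq>\<^bsub>N\<^esub> z"
      using gB z BK fc[OF a] by (intro N.sup_least) auto
    finally show "(a, \<Squnion>\<^bsub>M\<^esub>B) \<in> ?K z" using a B by simp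
  qed auto
  have tD: "?t ` D \<subseteq> carrier N" if "cp_ideal L M D" for D
    using cp_ideal_subset[OF that] fc gc by auto
  have hc: "?h D \<in> carrier N" if "cp_ideal L M D" for D
    unfolding copair_def using tD[OF that] by (rule N.sup_closed)
  have t_le: "f a \<sqinter>\<^bsub>N\<^esub> g b \<sqsubseteq>\<^bsub>N\<^esub> ?h D" if "cp_ideal L M D" "(a, b) \<in> D" for D a b
    unfolding copair_def using that(2) by (intro N.sup_upper[OF tD[OF that(1)]] image_eqI[of _ _ "(a, b)"]) auto
  have h_le: "?h D \<sqsubseteq>\<^bsub>N\<^esub> z"
    if "cp_ideal L M D" "z \<in> carrier N" "\<And>a b. (a, b) \<in> D \<Longrightarrow> f a \<sqinter>\<^bsub>N\<^esub> g b \<sqsubseteq>\<^bsub>N\<^esub> z" for D z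
    unfolding copair_def using that(3) by (intro N.sup_least[OF tD[OF that(1)] that(2)]) auto
  have h_mono: "?h D \<sqsubseteq>\<^bsub>N\<^esub> ?h E" if "cp_ideal L M D" "cp_ideal L M E" "D \<subseteq> E" for D E
    using that t_le by (intro h_le hc) auto
  show hl: "?h (inj_left L M a) = f a" if a: "a \<in> carrier L" for a
  proof (rule N.le_antisym)
    note I = cp_ideal_inj_left[OF a]
    show "?h (inj_left L M a) \<sqsubseteq>\<^bsub>N\<^esub> f a"
    proof (rule h_le[OF I fc[OF a]])
      fix x y assume "(x, y) \<in> inj_left L M a"
      then have xy: "x \<in> carrier L" "y \<in> carrier M" and "x \<sqsubseteq>\<^bsub>L\<^esub> a \<or> y = \<bottom>\<^bsub>M\<^esub>"
        by (auto simp: inj_left_def)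
      then consider "x \<sqsubseteq>\<^bsub>L\<^esub> a" | "y = \<bottom>\<^bsub>M\<^esub>" by blast
      then show "f x \<sqinter>\<^bsub>N\<^esub> g y \<sqsubseteq>\<^bsub>N\<^esub> f a"
      proof cases
        case 1
        then show ?thesis
          using N.le_trans[OF N.meet_left[of "f x" "g y"] fmono[OF xy(1) a 1]] fc gc xy a by simp
      next
        case 2
        then show ?thesis
          using frame_map_bottom[OF frM frN g] N.meet_bottom fc xy a by simp
      qed
    qed
    have "(a, \<top>\<^bsub>M\<^esub>) \<in> inj_left L M a" using a by (simp add: inj_left_def)
    from t_le[OF I this] show "f a \<sqsubseteq>\<^bsub>N\<^esub> ?h (inj_left L M a)"
      using frame_mapD(2)[OF g] N.meet_top fc a by simp
  qed (use hc cp_ideal_inj_left a fc in auto)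
  show hr: "?h (inj_right L M b) = g b" if b: "b \<in> carrier M" for b
  proof (rule N.le_antisym)
    note I = cp_ideal_inj_right[OF b]
    show "?h (inj_right L M b) \<sqsubseteq>\<^bsub>N\<^esub> g b"
    proof (rule h_le[OF I gc[OF b]])
      fix x y assume "(x, y) \<in> inj_right L M b"
      then have xy: "x \<in> carrier L" "y \<in> carrier M" and "x = \<bottom>\<^bsub>L\<^esub> \<or> y \<sqsubseteq>\<^bsub>M\<^esub> b"
        by (auto simp: inj_right_def)
      then consider "y \<sqsubseteq>\<^bsub>M\<^esub> b" | "x = \<bottom>\<^bsub>L\<^esub>" by blast
      then show "f x \<sqinter>\<^bsub>N\<^esub> g y \<sqsubseteq>\<^bsub>N\<^esub> g b"
      proof cases
        case 1
        then show ?thesis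
          using N.le_trans[OF N.meet_right[of "f x" "g y"] gmono[OF xy(2) b 1]] fc gc xy b by simp
      next
        case 2
        then show ?thesis
          using frame_map_bottom[OF frL frN f] N.bottom_meet gc xy b by simp
      qed
    qed
    have "(\<top>\<^bsub>L\<^esub>, b) \<in> inj_right L M b" using b by (simp add: inj_right_def)
    from t_le[OF I this] show "g b \<sqsubseteq>\<^bsub>N\<^esub> ?h (inj_right L M b)"
      using frame_mapD(2)[OF f] N.top_meet gc b by simp
  qed (use hc cp_ideal_inj_right b gc in auto)
  show "frame_map (coproduct L M) N ?h"
  proof (rule frame_mapI[OF frame_coproduct frN])
    show "?h D \<in> carrier N" if "D \<in> carrier (coproduct L M)" for D
      using that hc by (simp add: carrier_coproduct)
    have "inj_left L M \<top>\<^bsub>L\<^esub> = \<top>\<^bsub>coproduct L M\<^esub>"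
      by (rule frame_mapD(2)[OF frame_map_inj_left])
    then show "?h \<top>\<^bsub>coproduct L M\<^esub> = \<top>\<^bsub>N\<^esub>"
      using hl[of "\<top>\<^bsub>L\<^esub>"] frame_mapD(2)[OF f] by simp
    show "?h (D \<sqinter>\<^bsub>coproduct L M\<^esub> E) = ?h D \<sqinter>\<^bsub>N\<^esub> ?h E"
      if "D \<in> carrier (coproduct L M)" "E \<in> carrier (coproduct L M)" for D E
    proof -
      have D: "cp_ideal L M D" and E: "cp_ideal L M E" using that by (auto simp: carrier_coproduct)
      have DE: "cp_ideal L M (D \<inter> E)" by (rule cp_ideal_Int[OF D E])
      have key: "(f a \<sqinter>\<^bsub>N\<^esub> g b) \<sqinter>\<^bsub>N\<^esub> (f a' \<sqinter>\<^bsub>N\<^esub> g b') \<sqsubseteq>\<^bsub>N\<^esub> ?h (D \<inter> E)"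
        if p: "(a, b) \<in> D" and r: "(a', b') \<in> E" for a b a' b'
      proof -
        have c: "a \<in> carrier L" "b \<in> carrier M" "a' \<in> carrier L" "b' \<in> carrier M"
          using p r cp_idealD(1,2)[OF D] cp_idealD(1,2)[OF E] by auto
        have "(a \<sqinter>\<^bsub>L\<^esub> a', b \<sqinter>\<^bsub>M\<^esub> b') \<in> D" "(a \<sqinter>\<^bsub>L\<^esub> a', b \<sqinter>\<^bsub>M\<^esub> b') \<in> E"
          using cp_idealD(3)[OF D p] cp_idealD(3)[OF E r] c
            L.meet_left M.meet_left L.meet_right M.meet_right by simp_all
        then have "f (a \<sqinter>\<^bsub>L\<^esub> a') \<sqinter>\<^bsub>N\<^esub> g (b \<sqinter>\<^bsub>M\<^esub> b') \<sqsubseteq>\<^bsub>N\<^esub> ?h (D \<inter> E)"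
          using t_le[OF DE] by simp
        moreover have "f (a \<sqinter>\<^bsub>L\<^esub> a') = f a \<sqinter>\<^bsub>N\<^esub> f a'" "g (b \<sqinter>\<^bsub>M\<^esub> b') = g b \<sqinter>\<^bsub>N\<^esub> g b'"
          using frame_mapD(3)[OF f] frame_mapD(3)[OF g] c by simp_all
        moreover have "(f a \<sqinter>\<^bsub>N\<^esub> g b) \<sqinter>\<^bsub>N\<^esub> (f a' \<sqinter>\<^bsub>N\<^esub> g b') \<sqsubseteq>\<^bsub>N\<^esub> (f a \<sqinter>\<^bsub>N\<^esub> f a') \<sqinter>\<^bsub>N\<^esub> (g b \<sqinter>\<^bsub>N\<^esub> g b')"
          using c fc gc by (intro N.meet_le N.meet_mono N.meet_left N.meet_right N.meet_closed) simp_all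
        ultimately show ?thesis
          using N.le_trans[of "(f a \<sqinter>\<^bsub>N\<^esub> g b) \<sqinter>\<^bsub>N\<^esub> (f a' \<sqinter>\<^bsub>N\<^esub> g b')"
              "(f a \<sqinter>\<^bsub>N\<^esub> f a') \<sqinter>\<^bsub>N\<^esub> (g b \<sqinter>\<^bsub>N\<^esub> g b')" "?h (D \<inter> E)"] c fc gc hc[OF DE] by simp
      qed
      have 1: "(f a \<sqinter>\<^bsub>N\<^esub> g b) \<sqinter>\<^bsub>N\<^esub> ?h E \<sqsubseteq>\<^bsub>N\<^esub> ?h (D \<inter> E)" if p: "(a, b) \<in> D" for a b
      proof -
        have ab: "f a \<sqinter>\<^bsub>N\<^esub> g b \<in> carrier N" using p cp_idealD(1,2)[OF D] fc gc by auto
        have "(f a \<sqinter>\<^bsub>N\<^esub> g b) \<sqinter>\<^bsub>N\<^esub> ?h E = \<Squnion>\<^bsub>N\<^esub>((\<lambda>x. (f a \<sqinter>\<^bsub>N\<^esub> g b) \<sqinter>\<^bsub>N\<^esub> x) ` ?t ` E)"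
          unfolding copair_def by (rule N.meet_Sup_distrib[OF ab tD[OF E]])
        also have "\<dots> \<sqsubseteq>\<^bsub>N\<^esub> ?h (D \<inter> E)"
        proof (rule N.sup_least[OF _ hc[OF DE]])
          show "(\<lambda>x. (f a \<sqinter>\<^bsub>N\<^esub> g b) \<sqinter>\<^bsub>N\<^esub> x) ` ?t ` E \<subseteq> carrier N" using tD[OF E] ab by auto
        qed (use key[OF p] in auto)
        finally show ?thesis .
      qed
      have "?h D \<sqinter>\<^bsub>N\<^esub> ?h E = \<Squnion>\<^bsub>N\<^esub>((\<lambda>x. x \<sqinter>\<^bsub>N\<^esub> ?h E) ` ?t ` D)"
        unfolding copair_def[of N f g D] by (rule N.Sup_meet_distrib[OF hc[OF E] tD[OF D]])
      also have "\<dots> \<sqsubseteq>\<^bsub>N\<^esub> ?h (D \<inter> E)"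
      proof (rule N.sup_least[OF _ hc[OF DE]])
        show "(\<lambda>x. x \<sqinter>\<^bsub>N\<^esub> ?h E) ` ?t ` D \<subseteq> carrier N" using tD[OF D] hc[OF E] by auto
      qed (use 1 in auto)
      finally have "?h D \<sqinter>\<^bsub>N\<^esub> ?h E \<sqsubseteq>\<^bsub>N\<^esub> ?h (D \<inter> E)" .
      moreover have "?h (D \<inter> E) \<sqsubseteq>\<^bsub>N\<^esub> ?h D \<sqinter>\<^bsub>N\<^esub> ?h E"
        using h_mono[OF DE D] h_mono[OF DE E] hc[OF D] hc[OF E] hc[OF DE] by (intro N.meet_le) auto
      ultimately have "?h (D \<inter> E) = ?h D \<sqinter>\<^bsub>N\<^esub> ?h E"
        using hc[OF D] hc[OF E] hc[OF DE] by (intro N.le_antisym) auto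
      then show ?thesis using meet_coproduct[OF D E] by simp
    qed
    show "?h (\<Squnion>\<^bsub>coproduct L M\<^esub>\<A>) = \<Squnion>\<^bsub>N\<^esub>(?h ` \<A>)" if "\<A> \<subseteq> carrier (coproduct L M)" for \<A>
    proof -
      have \<A>: "\<A> \<subseteq> {D. cp_ideal L M D}" using that by (simp add: carrier_coproduct)
      let ?E = "cp_closure L M (\<Union>\<A>)"
      have E: "cp_ideal L M ?E"
        by (rule cp_ideal_closure, rule Union_least) (use \<A> in \<open>auto dest: cp_ideal_subset\<close>)
      have hA: "?h ` \<A> \<subseteq> carrier N" using \<A> hc by auto
      have s: "\<Squnion>\<^bsub>N\<^esub>(?h ` \<A>) \<in> carrier N" using hA by (rule N.sup_closed)
      have "\<Union>\<A> \<subseteq> ?K (\<Squnion>\<^bsub>N\<^esub>(?h ` \<A>))"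
      proof clarify
        fix D a b assume DA: "D \<in> \<A>" and ab: "(a, b) \<in> D"
        then have D: "cp_ideal L M D" using \<A> by auto
        have c: "a \<in> carrier L" "b \<in> carrier M" using cp_idealD(1,2)[OF D ab] by auto
        have "?h D \<sqsubseteq>\<^bsub>N\<^esub> \<Squnion>\<^bsub>N\<^esub>(?h ` \<A>)" using N.sup_upper[OF hA] DA by simp
        then have "f a \<sqinter>\<^bsub>N\<^esub> g b \<sqsubseteq>\<^bsub>N\<^esub> \<Squnion>\<^bsub>N\<^esub>(?h ` \<A>)"
          using N.le_trans[OF t_le[OF D ab] _ _ hc[OF D] s] c fc gc by simp
        then show "a \<in> carrier L \<and> b \<in> carrier M \<and> f a \<sqinter>\<^bsub>N\<^esub> g b \<sqsubseteq>\<^bsub>N\<^esub> \<Squnion>\<^bsub>N\<^esub>(?h ` \<A>)"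
          using c by simp
      qed
      then have "?E \<subseteq> ?K (\<Squnion>\<^bsub>N\<^esub>(?h ` \<A>))" by (rule cp_closure_least[OF K[OF s]])
      then have "?h ?E \<sqsubseteq>\<^bsub>N\<^esub> \<Squnion>\<^bsub>N\<^esub>(?h ` \<A>)" by (intro h_le[OF E s]) auto
      moreover have "\<Squnion>\<^bsub>N\<^esub>(?h ` \<A>) \<sqsubseteq>\<^bsub>N\<^esub> ?h ?E"
      proof (rule N.sup_least[OF hA hc[OF E]])
        fix x assume "x \<in> ?h ` \<A>"
        then obtain D where D: "D \<in> \<A>" "x = ?h D" by auto
        have "D \<subseteq> ?E" using D(1) by (rule subset_trans[OF Union_upper cp_closure_upper])
        then show "x \<sqsubseteq>\<^bsub>N\<^esub> ?h ?E" using h_mono[OF _ E] D \<A> by auto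
      qed
      ultimately have "?h ?E = \<Squnion>\<^bsub>N\<^esub>(?h ` \<A>)" using hc[OF E] s by (intro N.le_antisym) auto
      then show ?thesis using Sup_coproduct[OF \<A>] by simp
    qed
  qed
  show "k D = ?h D"
    if k: "frame_map (coproduct L M) N k" "\<And>a. a \<in> carrier L \<Longrightarrow> k (inj_left L M a) = f a"
      "\<And>b. b \<in> carrier M \<Longrightarrow> k (inj_right L M b) = g b" "D \<in> carrier (coproduct L M)" for k D
  proof -
    have D: "cp_ideal L M D" using k(4) by (simp add: carrier_coproduct)
    interpret F: frame "coproduct L M" by (rule frame_coproduct)
    let ?r = "\<lambda>(a, b). inj_left L M a \<sqinter>\<^bsub>coproduct L M\<^esub> inj_right L M b"
    note lc = frame_mapD(1)[OF frame_map_inj_left] and rc = frame_mapD(1)[OF frame_map_inj_right]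
    have rc': "?r ` D \<subseteq> carrier (coproduct L M)"
      using cp_ideal_subset[OF D] lc rc by auto
    have "k (?r p) = ?t p" if "p \<in> D" for p
    proof -
      obtain a b where p: "p = (a, b)" by (cases p)
      have ab: "a \<in> carrier L" "b \<in> carrier M" using that p cp_idealD(1,2)[OF D] by auto
      show ?thesis using p frame_mapD(3)[OF k(1) lc[OF ab(1)] rc[OF ab(2)]] k(2,3) ab by simp
    qed
    then have im: "k ` ?r ` D = ?t ` D" unfolding image_image by (rule image_cong[OF refl])
    have "k D = \<Squnion>\<^bsub>N\<^esub>(k ` ?r ` D)"
      using frame_mapD(4)[OF k(1) rc'] coproduct_generated[OF D] by simp
    then show ?thesis unfolding copair_def im .
  qed
qed

end

subsection \<open>Quotient\<close>

lemma frame_congruenceD: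
  assumes "frame_congruence L \<theta>"
  shows "equiv (carrier L) \<theta>"
    and "\<And>a b c d. \<lbrakk>(a, b) \<in> \<theta>; (c, d) \<in> \<theta>\<rbrakk> \<Longrightarrow> (a \<sqinter>\<^bsub>L\<^esub> c, b \<sqinter>\<^bsub>L\<^esub> d) \<in> \<theta>"
    and "\<And>I f g. (\<And>i. i \<in> I \<Longrightarrow> (f i, g i) \<in> \<theta>) \<Longrightarrow> (\<Squnion>\<^bsub>L\<^esub>(f ` I), \<Squnion>\<^bsub>L\<^esub>(g ` I)) \<in> \<theta>"
proof -
  show "equiv (carrier L) \<theta>" using assms unfolding frame_congruence_def by (elim conjE)
  have 1: "\<forall>(a, b)\<in>\<theta>. \<forall>(c, d)\<in>\<theta>. (a \<sqinter>\<^bsub>L\<^esub> c, b \<sqinter>\<^bsub>L\<^esub> d) \<in> \<theta>"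
    using assms unfolding frame_congruence_def by (elim conjE)
  show "(a \<sqinter>\<^bsub>L\<^esub> c, b \<sqinter>\<^bsub>L\<^esub> d) \<in> \<theta>" if "(a, b) \<in> \<theta>" "(c, d) \<in> \<theta>" for a b c d
    using bspec[OF 1 that(1)] that(2) by auto
  have 2: "\<forall>S\<subseteq>\<theta>. (\<Squnion>\<^bsub>L\<^esub>(fst ` S), \<Squnion>\<^bsub>L\<^esub>(snd ` S)) \<in> \<theta>"
    using assms unfolding frame_congruence_def by (elim conjE)
  show "(\<Squnion>\<^bsub>L\<^esub>(f ` I), \<Squnion>\<^bsub>L\<^esub>(g ` I)) \<in> \<theta>" if "\<And>i. i \<in> I \<Longrightarrow> (f i, g i) \<in> \<theta>" for I f g
  proof -
    have "(\<lambda>i. (f i, g i)) ` I \<subseteq> \<theta>" using that by auto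
    from 2[rule_format, OF this] show ?thesis by (simp add: image_image)
  qed
qed

lemma frame_congruenceI:
  assumes "equiv (carrier L) \<theta>"
    and "\<And>a b c d. \<lbrakk>(a, b) \<in> \<theta>; (c, d) \<in> \<theta>\<rbrakk> \<Longrightarrow> (a \<sqinter>\<^bsub>L\<^esub> c, b \<sqinter>\<^bsub>L\<^esub> d) \<in> \<theta>"
    and "\<And>S. S \<subseteq> \<theta> \<Longrightarrow> (\<Squnion>\<^bsub>L\<^esub>(fst ` S), \<Squnion>\<^bsub>L\<^esub>(snd ` S)) \<in> \<theta>"
  shows "frame_congruence L \<theta>"
  unfolding frame_congruence_def using assms by auto

lemma frame_congruence_kernel:
  assumes "frame L" and f: "frame_map L M f"
  shows "frame_congruence L (kernel_rel L f)"
proof (rule frame_congruenceI)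
  interpret L: frame L by (rule assms)
  show "equiv (carrier L) (kernel_rel L f)"
    by (rule equivI) (auto simp: kernel_rel_def refl_on_def sym_def trans_def)
  show "(a \<sqinter>\<^bsub>L\<^esub> c, b \<sqinter>\<^bsub>L\<^esub> d) \<in> kernel_rel L f"
    if "(a, b) \<in> kernel_rel L f" "(c, d) \<in> kernel_rel L f" for a b c d
    using that frame_mapD(3)[OF f] by (simp add: kernel_rel_def)
  show "(\<Squnion>\<^bsub>L\<^esub>(fst ` S), \<Squnion>\<^bsub>L\<^esub>(snd ` S)) \<in> kernel_rel L f" if S: "S \<subseteq> kernel_rel L f" for S
  proof -
    have sub: "fst ` S \<subseteq> carrier L" "snd ` S \<subseteq> carrier L" using S by (auto simp: kernel_rel_def)
    have "f ` fst ` S = f ` snd ` S"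
      unfolding image_image by (rule image_cong[OF refl]) (use S in \<open>auto simp: kernel_rel_def\<close>)
    then show ?thesis using frame_mapD(4)[OF f] sub by (simp add: kernel_rel_def)
  qed
qed

lemma frame_congruence_full:
  assumes "frame L"
  shows "frame_congruence L (carrier L \<times> carrier L)"
proof -
  interpret L: frame L by (rule assms)
  show ?thesis
  proof (rule frame_congruenceI)
  show "equiv (carrier L) (carrier L \<times> carrier L)"
    by (rule equivI) (auto simp: refl_on_def sym_def trans_def)
  show "(\<Squnion>\<^bsub>L\<^esub>(fst ` S), \<Squnion>\<^bsub>L\<^esub>(snd ` S)) \<in> carrier L \<times> carrier L"
    if "S \<subseteq> carrier L \<times> carrier L" for S
    using that by (auto intro!: L.sup_closed)
  qed auto
qed

lemma frame_congruence_generated: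
  assumes L: "frame L" and R: "R \<subseteq> carrier L \<times> carrier L"
  shows "frame_congruence L (generated_congruence L R)"
    and "\<And>a b. (a, b) \<in> R \<Longrightarrow> (a \<squnion>\<^bsub>L\<^esub> b, b) \<in> generated_congruence L R"
    and "\<And>\<theta>. \<lbrakk>frame_congruence L \<theta>; \<And>a b. (a, b) \<in> R \<Longrightarrow> (a \<squnion>\<^bsub>L\<^esub> b, b) \<in> \<theta>\<rbrakk>
      \<Longrightarrow> generated_congruence L R \<subseteq> \<theta>"
proof -
  interpret L: frame L by (rule L)
  let ?F = "{\<theta>. frame_congruence L \<theta> \<and> (\<forall>(a, b)\<in>R. (a \<squnion>\<^bsub>L\<^esub> b, b) \<in> \<theta>)}"
  have full: "carrier L \<times> carrier L \<in> ?F"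
    using R frame_congruence_full[OF L] L.join_closed by auto
  show "\<And>a b. (a, b) \<in> R \<Longrightarrow> (a \<squnion>\<^bsub>L\<^esub> b, b) \<in> generated_congruence L R"
    unfolding generated_congruence_def by auto
  show "\<And>\<theta>. \<lbrakk>frame_congruence L \<theta>; \<And>a b. (a, b) \<in> R \<Longrightarrow> (a \<squnion>\<^bsub>L\<^esub> b, b) \<in> \<theta>\<rbrakk>
      \<Longrightarrow> generated_congruence L R \<subseteq> \<theta>"
    unfolding generated_congruence_def by (rule Inter_lower) auto
  show "frame_congruence L (generated_congruence L R)"
    unfolding generated_congruence_def
  proof (rule frame_congruenceI)
    have c: "frame_congruence L \<theta>" if "\<theta> \<in> ?F" for \<theta> using that by simp
    show "equiv (carrier L) (\<Inter>?F)"
    proof (rule equivI)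
      show "\<Inter>?F \<subseteq> carrier L \<times> carrier L" using full by (rule Inter_lower)
      show "refl_on (carrier L) (\<Inter>?F)"
        using frame_congruenceD(1)[OF c] full
        by (intro refl_onI InterI) (auto dest: equivE refl_onD elim!: equivE)
      show "sym (\<Inter>?F)"
      proof (rule symI, rule InterI)
        fix x y \<theta> assume xy: "(x, y) \<in> \<Inter>?F" and t: "\<theta> \<in> ?F"
        from frame_congruenceD(1)[OF c[OF t]] have "sym \<theta>" by (rule equivE)
        then show "(y, x) \<in> \<theta>" using InterD[OF xy t] by (rule symD)
      qed
      show "trans (\<Inter>?F)"
      proof (rule transI, rule InterI)
        fix x y z \<theta> assume xy: "(x, y) \<in> \<Inter>?F" "(y, z) \<in> \<Inter>?F" and t: "\<theta> \<in> ?F"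
        from frame_congruenceD(1)[OF c[OF t]] have "trans \<theta>" by (rule equivE)
        then show "(x, z) \<in> \<theta>" using InterD[OF xy(1) t] InterD[OF xy(2) t] by (rule transD)
      qed
    qed
    show "(a \<sqinter>\<^bsub>L\<^esub> p, b \<sqinter>\<^bsub>L\<^esub> d) \<in> \<Inter>?F" if "(a, b) \<in> \<Inter>?F" "(p, d) \<in> \<Inter>?F" for a b p d
    proof (rule InterI)
      fix \<theta> assume t: "\<theta> \<in> ?F"
      show "(a \<sqinter>\<^bsub>L\<^esub> p, b \<sqinter>\<^bsub>L\<^esub> d) \<in> \<theta>"
        by (rule frame_congruenceD(2)[OF c[OF t] InterD[OF that(1) t] InterD[OF that(2) t]])
    qed
    show "(\<Squnion>\<^bsub>L\<^esub>(fst ` S), \<Squnion>\<^bsub>L\<^esub>(snd ` S)) \<in> \<Inter>?F" if "S \<subseteq> \<Inter>?F" for S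
    proof (rule InterI)
      fix \<theta> assume t: "\<theta> \<in> ?F"
      have "(fst p, snd p) \<in> \<theta>" if "p \<in> S" for p using that \<open>S \<subseteq> \<Inter>?F\<close> t by auto
      then show "(\<Squnion>\<^bsub>L\<^esub>(fst ` S), \<Squnion>\<^bsub>L\<^esub>(snd ` S)) \<in> \<theta>"
        by (rule frame_congruenceD(3)[OF c[OF t]])
    qed
  qed
qed

locale quotient_by_congruence = frame +
  fixes \<theta> :: "('a \<times> 'a) set"
  assumes cong: "frame_congruence L \<theta>"
begin

abbreviation cls :: "'a \<Rightarrow> 'a set" where "cls a \<equiv> \<theta> `` {a}"

abbreviation leQ :: "'a set \<Rightarrow> 'a set \<Rightarrow> bool" where
  "leQ A B \<equiv> \<exists>a\<in>A. \<exists>b\<in>B. a \<sqsubseteq> b"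

definition rep :: "'a set \<Rightarrow> 'a" where "rep A = (SOME a. a \<in> A)"

abbreviation Q :: "'a set gorder" where
  "Q \<equiv> \<lparr>carrier = carrier L // \<theta>, eq = (=), le = leQ\<rparr>"

lemmas equiv = frame_congruenceD(1)[OF cong]
lemmas cmeet = frame_congruenceD(2)[OF cong]
lemmas cSup = frame_congruenceD(3)[OF cong]

lemma crefl: "a \<in> carrier L \<Longrightarrow> (a, a) \<in> \<theta>"
  using equiv by (auto elim: equivE dest: refl_onD)

lemma csym: "(a, b) \<in> \<theta> \<Longrightarrow> (b, a) \<in> \<theta>"
  using equiv by (auto elim!: equivE dest: symD)

lemma ctrans: "\<lbrakk>(a, b) \<in> \<theta>; (b, c) \<in> \<theta>\<rbrakk> \<Longrightarrow> (a, c) \<in> \<theta>"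
  using equiv by (auto elim!: equivE dest: transD)

lemma ccarrier: "(a, b) \<in> \<theta> \<Longrightarrow> a \<in> carrier L \<and> b \<in> carrier L"
  using equiv by (auto elim!: equivE)

lemma cls_eq: "\<lbrakk>a \<in> carrier L; b \<in> carrier L\<rbrakk> \<Longrightarrow> cls a = cls b \<longleftrightarrow> (a, b) \<in> \<theta>"
  using eq_equiv_class_iff[OF equiv] by blast

lemma rep:
  assumes "A \<in> carrier L // \<theta>"
  shows "rep A \<in> carrier L" "cls (rep A) = A"
proof -
  obtain a where a: "a \<in> carrier L" "A = cls a" using assms by (auto elim: quotientE)
  then have "a \<in> A" using crefl by simp
  then have "rep A \<in> A" unfolding rep_def by (rule someI)
  then have r: "(a, rep A) \<in> \<theta>" using a by simp
  then show "rep A \<in> carrier L" using ccarrier by blast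
  then show "cls (rep A) = A" using a cls_eq[of "rep A" a] csym[OF r] by simp
qed

lemma leQ_cls:
  assumes "a \<in> carrier L" "b \<in> carrier L"
  shows "leQ (cls a) (cls b) \<longleftrightarrow> (a \<sqinter> b, a) \<in> \<theta>"
proof
  assume "leQ (cls a) (cls b)"
  then obtain x y where xy: "(a, x) \<in> \<theta>" "(b, y) \<in> \<theta>" "x \<sqsubseteq> y" by auto
  then have "x \<sqinter> y = x" using meet_le_iff ccarrier by blast
  then have "(a \<sqinter> b, x) \<in> \<theta>" using cmeet[OF xy(1,2)] by simp
  then show "(a \<sqinter> b, a) \<in> \<theta>" using ctrans csym[OF xy(1)] by blast
next
  assume "(a \<sqinter> b, a) \<in> \<theta>"
  then have "a \<sqinter> b \<in> cls a" using csym by simp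
  moreover have "b \<in> cls b" "a \<sqinter> b \<sqsubseteq> b" using crefl assms meet_right by auto
  ultimately show "leQ (cls a) (cls b)" by blast
qed

lemma leQ_cls_mono: "\<lbrakk>a \<in> carrier L; b \<in> carrier L; a \<sqsubseteq> b\<rbrakk> \<Longrightarrow> leQ (cls a) (cls b)"
  using crefl by auto

lemma leQ_antisym:
  assumes "a \<in> carrier L" "b \<in> carrier L" "leQ (cls a) (cls b)" "leQ (cls b) (cls a)"
  shows "cls a = cls b"
proof -
  have 1: "(a, a \<sqinter> b) \<in> \<theta>" and 2: "(b \<sqinter> a, b) \<in> \<theta>"
    using assms leQ_cls csym by blast+
  then have "(a, b) \<in> \<theta>" using ctrans[OF 1, of b] meet_comm[where L=L and x=b and y=a] by simp
  then show ?thesis using cls_eq assms by blast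
qed

lemma leQ_trans:
  assumes c: "a \<in> carrier L" "b \<in> carrier L" "c \<in> carrier L"
    and "leQ (cls a) (cls b)" "leQ (cls b) (cls c)"
  shows "leQ (cls a) (cls c)"
proof -
  have ab: "(a \<sqinter> b, a) \<in> \<theta>" and bc: "(b \<sqinter> c, b) \<in> \<theta>" using assms leQ_cls by blast+
  have "(a \<sqinter> (b \<sqinter> c), a \<sqinter> b) \<in> \<theta>" using cmeet[OF crefl bc] c by simp
  moreover have "((a \<sqinter> b) \<sqinter> c, a \<sqinter> c) \<in> \<theta>" using cmeet[OF ab crefl] c by simp
  ultimately have "(a \<sqinter> c, a \<sqinter> b) \<in> \<theta>"
    using ctrans[OF csym] meet_assoc[of a b c] c by metis
  then have "(a \<sqinter> c, a) \<in> \<theta>" using ctrans ab by blast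
  then show ?thesis using leQ_cls c by blast
qed

lemma leQ_Sup:
  assumes A: "A \<subseteq> carrier L" and z: "z \<in> carrier L" and le: "\<And>a. a \<in> A \<Longrightarrow> leQ (cls a) (cls z)"
  shows "leQ (cls (\<Squnion>A)) (cls z)"
proof -
  have "(a \<sqinter> z, a) \<in> \<theta>" if "a \<in> A" for a using le[OF that] leQ_cls A z that by blast
  then have "(\<Squnion>((\<lambda>a. a \<sqinter> z) ` A), \<Squnion>((\<lambda>a. a) ` A)) \<in> \<theta>" by (rule cSup)
  then have "(\<Squnion>A \<sqinter> z, \<Squnion>A) \<in> \<theta>" using Sup_meet_distrib[OF z A] by simp
  then show ?thesis using leQ_cls A z by simp
qed

lemma leQ_meet:
  assumes c: "x \<in> carrier L" "y \<in> carrier L" "z \<in> carrier L"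
    and "leQ (cls z) (cls x)" "leQ (cls z) (cls y)"
  shows "leQ (cls z) (cls (x \<sqinter> y))"
proof -
  have zx: "(z \<sqinter> x, z) \<in> \<theta>" and zy: "(z \<sqinter> y, z) \<in> \<theta>" using assms leQ_cls by blast+
  have "((z \<sqinter> x) \<sqinter> y, z \<sqinter> y) \<in> \<theta>" using cmeet[OF zx crefl] c by simp
  then have "(z \<sqinter> (x \<sqinter> y), z) \<in> \<theta>" using ctrans[OF _ zy] meet_assoc[of z x y] c by simp
  then show ?thesis using leQ_cls c by simp
qed

lemma cls_in: "a \<in> carrier L \<Longrightarrow> cls a \<in> carrier L // \<theta>"
  by (rule quotientI)

lemma frame_Q: "frame Q"
  and Sup_Q: "\<And>\<A>. \<A> \<subseteq> carrier L // \<theta> \<Longrightarrow> \<Squnion>\<^bsub>Q\<^esub>\<A> = cls (\<Squnion>(rep ` \<A>))"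
  and meet_Q: "\<And>A B. \<lbrakk>A \<in> carrier L // \<theta>; B \<in> carrier L // \<theta>\<rbrakk>
      \<Longrightarrow> A \<sqinter>\<^bsub>Q\<^esub> B = cls (rep A \<sqinter> rep B)"
proof -
  let ?C = "carrier L // \<theta>"
  let ?J = "\<lambda>\<A>. cls (\<Squnion>(rep ` \<A>))"
  let ?m = "\<lambda>A B. cls (rep A \<sqinter> rep B)"
  have ra: "rep ` \<A> \<subseteq> carrier L" if "\<A> \<subseteq> ?C" for \<A> using that rep(1) by auto
  have sc: "\<Squnion>(rep ` \<A>) \<in> carrier L" if "\<A> \<subseteq> ?C" for \<A> using ra[OF that] by (rule sup_closed)
  have mc: "rep A \<sqinter> rep B \<in> carrier L" if "A \<in> ?C" "B \<in> ?C" for A B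
    using rep(1) that by simp
  have h1: "leQ A A" if "A \<in> ?C" for A
    using leQ_cls_mono[of "rep A" "rep A"] rep[OF that] by auto
  have h2: "A = B" if "A \<in> ?C" "B \<in> ?C" "leQ A B" "leQ B A" for A B
    using leQ_antisym[OF rep(1)[OF that(1)] rep(1)[OF that(2)]] that(3,4)
    unfolding rep(2)[OF that(1)] rep(2)[OF that(2)] by blast
  have h3: "leQ A C" if "A \<in> ?C" "B \<in> ?C" "C \<in> ?C" "leQ A B" "leQ B C" for A B C
    using leQ_trans[OF rep(1)[OF that(1)] rep(1)[OF that(2)] rep(1)[OF that(3)]] that(4,5)
    unfolding rep(2)[OF that(1)] rep(2)[OF that(2)] rep(2)[OF that(3)] by blast
  have h4: "?J \<A> \<in> ?C" if "\<A> \<subseteq> ?C" for \<A> by (rule cls_in[OF sc[OF that]])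
  have h5: "leQ A (?J \<A>)" if "\<A> \<subseteq> ?C" "A \<in> \<A>" for \<A> A
  proof -
    have A: "A \<in> ?C" using that by auto
    have "rep A \<sqsubseteq> \<Squnion>(rep ` \<A>)" using sup_upper[OF ra[OF that(1)]] that(2) by simp
    from leQ_cls_mono[OF rep(1)[OF A] sc[OF that(1)] this] show ?thesis unfolding rep(2)[OF A] .
  qed
  have h6: "leQ (?J \<A>) Z" if "\<A> \<subseteq> ?C" "Z \<in> ?C" "\<And>A. A \<in> \<A> \<Longrightarrow> leQ A Z" for \<A> Z
  proof -
    have "leQ (cls a) (cls (rep Z))" if "a \<in> rep ` \<A>" for a
    proof -
      from that obtain A where A: "A \<in> \<A>" "a = rep A" by auto
      then have "cls a = A" using rep(2) \<open>\<A> \<subseteq> ?C\<close> by blast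
      then show ?thesis using \<open>\<And>A. A \<in> \<A> \<Longrightarrow> leQ A Z\<close>[OF A(1)] rep(2)[OF \<open>Z \<in> ?C\<close>] by presburger
    qed
    from leQ_Sup[OF ra[OF that(1)] rep(1)[OF that(2)] this] show ?thesis
      unfolding rep(2)[OF that(2)] .
  qed
  have h7: "?m A B \<in> ?C" if "A \<in> ?C" "B \<in> ?C" for A B by (rule cls_in[OF mc[OF that]])
  have h8: "leQ (?m A B) A" if "A \<in> ?C" "B \<in> ?C" for A B
    using leQ_cls_mono[OF mc[OF that] rep(1)[OF that(1)] meet_left[OF rep(1)[OF that(1)] rep(1)[OF that(2)]]]
    unfolding rep(2)[OF that(1)] .
  have h9: "leQ (?m A B) B" if "A \<in> ?C" "B \<in> ?C" for A B
    using leQ_cls_mono[OF mc[OF that] rep(1)[OF that(2)] meet_right[OF rep(1)[OF that(1)] rep(1)[OF that(2)]]]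
    unfolding rep(2)[OF that(2)] .
  have h10: "leQ Z (?m A B)" if "A \<in> ?C" "B \<in> ?C" "Z \<in> ?C" "leQ Z A" "leQ Z B" for A B Z
    using leQ_meet[OF rep(1)[OF that(1)] rep(1)[OF that(2)] rep(1)[OF that(3)]] that(4,5)
    unfolding rep(2)[OF that(1)] rep(2)[OF that(2)] rep(2)[OF that(3)] by blast
  have cr: "(a, rep (cls a)) \<in> \<theta>" if "a \<in> carrier L" for a
    using rep[OF cls_in[OF that]] cls_eq[OF that] by blast
  have h11: "leQ (?m A (?J \<A>)) (?J (?m A ` \<A>))" if A: "A \<in> ?C" and \<A>: "\<A> \<subseteq> ?C" for A \<A>
  proof -
    have mA: "?m A ` \<A> \<subseteq> ?C" using h7[OF A] \<A> by blast
    have "(rep A \<sqinter> rep (?J \<A>), rep A \<sqinter> \<Squnion>(rep ` \<A>)) \<in> \<theta>"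
      by (rule cmeet[OF crefl[OF rep(1)[OF A]] csym[OF cr[OF sc[OF \<A>]]]])
    moreover have "rep A \<sqinter> \<Squnion>(rep ` \<A>) = \<Squnion>((\<lambda>B. rep A \<sqinter> rep B) ` \<A>)"
      using meet_Sup_distrib[OF rep(1)[OF A] ra[OF \<A>]] by (simp add: image_image)
    moreover have "(\<Squnion>((\<lambda>B. rep A \<sqinter> rep B) ` \<A>), \<Squnion>((\<lambda>B. rep (?m A B)) ` \<A>)) \<in> \<theta>"
    proof (rule cSup)
      fix B assume "B \<in> \<A>"
      then have "B \<in> ?C" using \<A> by blast
      then show "(rep A \<sqinter> rep B, rep (?m A B)) \<in> \<theta>" by (rule cr[OF mc[OF A]])
    qed
    ultimately have "(rep A \<sqinter> rep (?J \<A>), \<Squnion>(rep ` ?m A ` \<A>)) \<in> \<theta>"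
      using ctrans by (simp add: image_image)
    then have "?m A (?J \<A>) = ?J (?m A ` \<A>)"
      using cls_eq[OF mc[OF A h4[OF \<A>]] sc[OF mA]] by blast
    then show ?thesis using h1[OF h4[OF mA]] by presburger
  qed
  note I = frame_explicitI[of ?C leQ ?J ?m, OF h1 h2 h3 h4 h5 h6 h7 h8 h9 h10 h11]
  show "frame Q" by (rule I(1))
  show "\<And>\<A>. \<A> \<subseteq> carrier L // \<theta> \<Longrightarrow> \<Squnion>\<^bsub>Q\<^esub>\<A> = cls (\<Squnion>(rep ` \<A>))" by (rule I(2))
  show "\<And>A B. \<lbrakk>A \<in> carrier L // \<theta>; B \<in> carrier L // \<theta>\<rbrakk>
      \<Longrightarrow> A \<sqinter>\<^bsub>Q\<^esub> B = cls (rep A \<sqinter> rep B)" by (rule I(3))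
qed

lemma rep_cls: "a \<in> carrier L \<Longrightarrow> (a, rep (cls a)) \<in> \<theta>"
  using rep[OF cls_in] cls_eq by blast

lemma frame_map_cls: "frame_map L Q cls"
proof (rule frame_mapI)
  interpret F: frame Q by (rule frame_Q)
  show "frame L" by (rule frame_axioms)
  show "frame Q" by (rule frame_Q)
  show in_Q: "cls a \<in> carrier Q" if "a \<in> carrier L" for a using cls_in[OF that] by simp
  show "cls \<top> = \<top>\<^bsub>Q\<^esub>"
  proof (rule F.top_unique[OF in_Q[OF top_closed]])
    have T: "\<top>\<^bsub>Q\<^esub> \<in> carrier L // \<theta>" using F.top_closed by simp
    have "leQ (cls (rep \<top>\<^bsub>Q\<^esub>)) (cls \<top>)" using rep(1)[OF T] by (intro leQ_cls_mono) auto
    then show "\<top>\<^bsub>Q\<^esub> \<sqsubseteq>\<^bsub>Q\<^esub> cls \<top>" unfolding rep(2)[OF T] by simp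
  qed
  show "cls (a \<sqinter> b) = cls a \<sqinter>\<^bsub>Q\<^esub> cls b" if "a \<in> carrier L" "b \<in> carrier L" for a b
    using meet_Q[OF cls_in cls_in] cmeet[OF rep_cls rep_cls] that cls_eq rep(1)[OF cls_in] by simp
  show "cls (\<Squnion>A) = \<Squnion>\<^bsub>Q\<^esub>(cls ` A)" if A: "A \<subseteq> carrier L" for A
  proof -
    have sub: "cls ` A \<subseteq> carrier L // \<theta>" using A cls_in by blast
    have "(\<Squnion>((\<lambda>a. a) ` A), \<Squnion>((\<lambda>a. rep (cls a)) ` A)) \<in> \<theta>"
      by (rule cSup) (use rep_cls A in blast)
    then have "(\<Squnion>A, \<Squnion>(rep ` cls ` A)) \<in> \<theta>" by (simp add: image_image)
    then have "cls (\<Squnion>A) = cls (\<Squnion>(rep ` cls ` A))" using cls_eq ccarrier by blast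
    then show ?thesis using Sup_Q[OF sub] by simp
  qed
qed

end

context
  fixes L :: "'a gorder" and R :: "('a \<times> 'a) set"
  assumes frL: "frame L" and R: "R \<subseteq> carrier L \<times> carrier L"
begin

interpretation L: frame L by (rule frL)

lemma quotient_by_generated: "quotient_by_congruence L (generated_congruence L R)"
  using frame_congruence_generated(1)[OF frL R]
  by (simp add: quotient_by_congruence_def quotient_by_congruence_axioms_def frL)

interpretation Q: quotient_by_congruence L "generated_congruence L R"
  by (rule quotient_by_generated)

lemma frame_quotient: "frame (quotient_frame L R)"
  using Q.frame_Q by (simp add: quotient_frame_def)

lemma frame_map_quotient: "frame_map L (quotient_frame L R) (quotient_map_of L R)"
  using Q.frame_map_cls unfolding quotient_frame_def quotient_map_of_def .

lemma quotient_map_surj: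
  "quotient_map_of L R ` carrier L = carrier (quotient_frame L R)"
  by (auto simp: quotient_frame_def quotient_map_of_def quotient_def)

lemma kernel_quotient_map: "kernel_rel L (quotient_map_of L R) = generated_congruence L R"
proof (rule subset_antisym; rule subrelI)
  fix a b assume "(a, b) \<in> kernel_rel L (quotient_map_of L R)"
  then show "(a, b) \<in> generated_congruence L R"
    unfolding kernel_rel_def quotient_map_of_def using Q.cls_eq[of a b] by blast
next
  fix a b assume ab: "(a, b) \<in> generated_congruence L R"
  then have "Q.cls a = Q.cls b" using Q.cls_eq[of a b] Q.ccarrier[OF ab] by blast
  then show "(a, b) \<in> kernel_rel L (quotient_map_of L R)"
    unfolding kernel_rel_def quotient_map_of_def using Q.ccarrier[OF ab] by blast
qed

lemma quotient_map_rel: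
  assumes "(a, b) \<in> R"
  shows "quotient_map_of L R a \<sqsubseteq>\<^bsub>quotient_frame L R\<^esub> quotient_map_of L R b"
proof -
  have ab: "a \<in> carrier L" "b \<in> carrier L" using assms R by auto
  have "(a \<squnion>\<^bsub>L\<^esub> b, b) \<in> generated_congruence L R"
    by (rule frame_congruence_generated(2)[OF frL R assms])
  then have "b \<in> Q.cls b" "a \<squnion>\<^bsub>L\<^esub> b \<in> Q.cls b" using Q.crefl Q.csym ab by auto
  moreover have "a \<in> Q.cls a" using Q.crefl ab by simp
  ultimately show ?thesis
    using L.join_left[OF ab] unfolding quotient_frame_def quotient_map_of_def by auto
qed

lemma quotient_frame_universal:
  assumes frN: "frame N" and f: "frame_map L N f"
    and fR: "\<And>a b. (a, b) \<in> R \<Longrightarrow> f a \<sqsubseteq>\<^bsub>N\<^esub> f b"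
  shows "\<exists>g. frame_map (quotient_frame L R) N g \<and>
      (\<forall>a\<in>carrier L. g (quotient_map_of L R a) = f a)"
    and "\<And>g h A. \<lbrakk>\<forall>a\<in>carrier L. g (quotient_map_of L R a) = f a;
        \<forall>a\<in>carrier L. h (quotient_map_of L R a) = f a; A \<in> carrier (quotient_frame L R)\<rbrakk>
      \<Longrightarrow> g A = h A"
proof -
  interpret N: frame N by (rule frN)
  let ?q = "quotient_map_of L R"
  let ?F = "quotient_frame L R"
  interpret F: frame ?F by (rule frame_quotient)
  note fc = frame_mapD(1)[OF f] and q = frame_map_quotient
  note qc = frame_mapD(1)[OF q]
  have ker: "generated_congruence L R \<subseteq> kernel_rel L f"
  proof (rule frame_congruence_generated(3)[OF frL R frame_congruence_kernel[OF frL f]])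
    fix a b assume ab: "(a, b) \<in> R"
    then have c: "a \<in> carrier L" "b \<in> carrier L" using R by auto
    have "f (a \<squnion>\<^bsub>L\<^esub> b) = f a \<squnion>\<^bsub>N\<^esub> f b"
      using frame_mapD(4)[OF f, of "{a, b}"] c by (simp add: join_def)
    also have "\<dots> = f b" using N.le_iff_meet[of "f a" "f b"] fR[OF ab] fc c by simp
    finally show "(a \<squnion>\<^bsub>L\<^esub> b, b) \<in> kernel_rel L f" using c by (simp add: kernel_rel_def)
  qed
  define g where "g A = f (Q.rep A)" for A
  have gq: "g (?q a) = f a" if "a \<in> carrier L" for a
    using ker Q.rep_cls[OF that] by (auto simp: g_def quotient_map_of_def kernel_rel_def)
  have pre: "\<exists>a\<in>carrier L. A = ?q a" if "A \<in> carrier ?F" for A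
    using that quotient_map_surj by blast
  have "frame_map ?F N g"
  proof (rule frame_mapI[OF frame_quotient frN])
    show "g A \<in> carrier N" if "A \<in> carrier ?F" for A using pre[OF that] gq fc by auto
    show "g \<top>\<^bsub>?F\<^esub> = \<top>\<^bsub>N\<^esub>"
      using frame_mapD(2)[OF q] frame_mapD(2)[OF f] gq[of "\<top>\<^bsub>L\<^esub>"] by simp
    show "g (A \<sqinter>\<^bsub>?F\<^esub> B) = g A \<sqinter>\<^bsub>N\<^esub> g B" if A: "A \<in> carrier ?F" and B: "B \<in> carrier ?F" for A B
    proof -
      obtain a b where ab: "a \<in> carrier L" "A = ?q a" "b \<in> carrier L" "B = ?q b"
        using pre[OF A] pre[OF B] by blast
      then show ?thesis
        using frame_mapD(3)[OF q, of a b, symmetric] frame_mapD(3)[OF f, of a b] gq by simp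
    qed
    show "g (\<Squnion>\<^bsub>?F\<^esub>\<A>) = \<Squnion>\<^bsub>N\<^esub>(g ` \<A>)" if \<A>: "\<A> \<subseteq> carrier ?F" for \<A>
    proof -
      define A where "A = {a \<in> carrier L. ?q a \<in> \<A>}"
      have A: "A \<subseteq> carrier L" by (auto simp: A_def)
      have qA: "?q ` A = \<A>"
      proof
        show "\<A> \<subseteq> ?q ` A"
        proof
          fix B assume B: "B \<in> \<A>"
          then obtain a where "a \<in> carrier L" "B = ?q a" using pre \<A> by blast
          then show "B \<in> ?q ` A" using B by (simp add: A_def)
        qed
      qed (auto simp: A_def)
      have "g ` ?q ` A = f ` A" unfolding image_image by (rule image_cong[OF refl]) (use gq A in auto)
      then show ?thesis
        using frame_mapD(4)[OF q A] frame_mapD(4)[OF f A] gq[of "\<Squnion>\<^bsub>L\<^esub>A"] A qA by simp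
    qed
  qed
  then show "\<exists>g. frame_map ?F N g \<and> (\<forall>a\<in>carrier L. g (?q a) = f a)" using gq by blast
  show "g' A = h A"
    if "\<forall>a\<in>carrier L. g' (?q a) = f a" "\<forall>a\<in>carrier L. h (?q a) = f a" "A \<in> carrier ?F" for g' h A
    using pre[OF that(3)] that(1,2) by auto
qed

end

subsection \<open>Biframes\<close>

lemma top_two: "\<top>\<^bsub>two\<^esub> = True"
proof -
  interpret F: frame two by (rule frame_two)
  show ?thesis using F.top_unique[of True] by (simp add: two_def)
qed

lemma frame_map_two_iff:
  assumes f: "frame_map L two f"
  shows "f \<top>\<^bsub>L\<^esub>"
    and "\<And>x y. \<lbrakk>x \<in> carrier L; y \<in> carrier L\<rbrakk> \<Longrightarrow> f (x \<sqinter>\<^bsub>L\<^esub> y) \<longleftrightarrow> f x \<and> f y"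
    and "\<And>A. A \<subseteq> carrier L \<Longrightarrow> f (\<Squnion>\<^bsub>L\<^esub>A) \<longleftrightarrow> (\<exists>a\<in>A. f a)"
  using frame_mapD(2-4)[OF f] by (auto simp: top_two meet_two Sup_two)

lemma frame_map_id: "frame L \<Longrightarrow> frame_map L L id"
  by (rule frame_mapI) simp_all

lemma basic_meetsI:
  "\<lbrakk>a \<in> carrier (pos_part L); b \<in> carrier (neg_part L)\<rbrakk>
    \<Longrightarrow> pos_emb L a \<sqinter>\<^bsub>main_part L\<^esub> neg_emb L b \<in> basic_meets L"
  unfolding basic_meets_def by blast

lemma biframe_two: "biframe two_biframe"
proof (rule biframe.intro)
  show "\<exists>A\<subseteq>basic_meets two_biframe. z = \<Squnion>\<^bsub>main_part two_biframe\<^esub>A" for z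
  proof (intro exI conjI)
    have "z = (z \<sqinter>\<^bsub>two\<^esub> True)" by (simp add: meet_two)
    then have "z \<in> basic_meets two_biframe"
      unfolding basic_meets_def mem_Collect_eq two_biframe_def biframe.simps id_apply
      by (intro exI[of _ z] exI[of _ True]) (simp add: two_def)
    then show "{z} \<subseteq> basic_meets two_biframe" by simp
    show "z = \<Squnion>\<^bsub>main_part two_biframe\<^esub>{z}" by (simp add: two_biframe_def Sup_two)
  qed
qed (simp_all add: two_biframe_def frame_two frame_map_id)

lemma biframe_coproduct:
  assumes P: "frame P" and N: "frame N" and nontriv: "\<bottom>\<^bsub>P\<^esub> = \<top>\<^bsub>P\<^esub> \<longleftrightarrow> \<bottom>\<^bsub>N\<^esub> = \<top>\<^bsub>N\<^esub>"
  shows "biframe (coproduct_biframe P N)"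
proof (rule biframe.intro)
  interpret P: frame P by (rule P)
  interpret N: frame N by (rule N)
  have triv: "x = y" if "\<bottom>\<^bsub>P\<^esub> = \<top>\<^bsub>P\<^esub>" "x \<in> carrier P" "y \<in> carrier P" for x y
    using P.bottom_unique P.top_higher that by metis
  have triv': "x = y" if "\<bottom>\<^bsub>N\<^esub> = \<top>\<^bsub>N\<^esub>" "x \<in> carrier N" "y \<in> carrier N" for x y
    using N.bottom_unique N.top_higher that by metis
  have leP: "x \<sqsubseteq>\<^bsub>P\<^esub> y \<or> \<top>\<^bsub>N\<^esub> = \<bottom>\<^bsub>N\<^esub>"
    if "inj_left P N x = inj_left P N y" "x \<in> carrier P" for x y
  proof -
    have "(x, \<top>\<^bsub>N\<^esub>) \<in> inj_left P N y"
      unfolding that(1)[symmetric] using that(2) by (simp add: inj_left_def)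
    then show ?thesis by (simp add: inj_left_def)
  qed
  have leN: "x \<sqsubseteq>\<^bsub>N\<^esub> y \<or> \<top>\<^bsub>P\<^esub> = \<bottom>\<^bsub>P\<^esub>"
    if "inj_right P N x = inj_right P N y" "x \<in> carrier N" for x y
  proof -
    have "(\<top>\<^bsub>P\<^esub>, x) \<in> inj_right P N y"
      unfolding that(1)[symmetric] using that(2) by (simp add: inj_right_def)
    then show ?thesis by (auto simp: inj_right_def)
  qed
  show "inj_on (pos_emb (coproduct_biframe P N)) (carrier (pos_part (coproduct_biframe P N)))"
  proof (rule inj_onI, simp add: coproduct_biframe_def)
    fix x y assume "x \<in> carrier P" "y \<in> carrier P" "inj_left P N x = inj_left P N y"
    then show "x = y" using leP[of x y] leP[of y x] triv nontriv P.le_antisym by metis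
  qed
  show "inj_on (neg_emb (coproduct_biframe P N)) (carrier (neg_part (coproduct_biframe P N)))"
  proof (rule inj_onI, simp add: coproduct_biframe_def)
    fix x y assume "x \<in> carrier N" "y \<in> carrier N" "inj_right P N x = inj_right P N y"
    then show "x = y" using leN[of x y] leN[of y x] triv' nontriv N.le_antisym by metis
  qed
  show "\<exists>A\<subseteq>basic_meets (coproduct_biframe P N). z = \<Squnion>\<^bsub>main_part (coproduct_biframe P N)\<^esub>A"
    if "z \<in> carrier (main_part (coproduct_biframe P N))" for z
  proof (intro exI conjI)
    have z: "cp_ideal P N z" using that by (simp add: coproduct_biframe_def coproduct_def)
    show "z = \<Squnion>\<^bsub>main_part (coproduct_biframe P N)\<^esub>
      ((\<lambda>(a, b). inj_left P N a \<sqinter>\<^bsub>coproduct P N\<^esub> inj_right P N b) ` z)"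
      using coproduct_generated[OF P N z] by (simp add: coproduct_biframe_def)
    show "(\<lambda>(a, b). inj_left P N a \<sqinter>\<^bsub>coproduct P N\<^esub> inj_right P N b) ` z
        \<subseteq> basic_meets (coproduct_biframe P N)"
    proof clarify
      fix a b assume "(a, b) \<in> z"
      then have ab: "a \<in> carrier P" "b \<in> carrier N" using cp_ideal_subset[OF z] by auto
      show "inj_left P N a \<sqinter>\<^bsub>coproduct P N\<^esub> inj_right P N b \<in> basic_meets (coproduct_biframe P N)"
        using basic_meetsI[of a "coproduct_biframe P N" b] ab by (simp add: coproduct_biframe_def)
    qed
  qed
qed (simp_all add: coproduct_biframe_def P N frame_coproduct frame_map_inj_left frame_map_inj_right)

context biframe
begin

lemma biframe_coproduct_parts: "biframe (coproduct_biframe (pos_part L) (neg_part L))"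
proof (rule biframe_coproduct[OF frame_pos frame_neg])
  interpret P: frame "pos_part L" by (rule frame_pos)
  interpret N: frame "neg_part L" by (rule frame_neg)
  have "\<bottom>\<^bsub>pos_part L\<^esub> = \<top>\<^bsub>pos_part L\<^esub> \<longleftrightarrow> \<bottom>\<^bsub>main_part L\<^esub> = \<top>\<^bsub>main_part L\<^esub>"
    using inj_on_eq_iff[OF inj_pos P.bottom_closed P.top_closed]
      frame_map_bottom[OF frame_pos frame_main frame_map_pos] frame_mapD(2)[OF frame_map_pos] by simp
  moreover have "\<bottom>\<^bsub>neg_part L\<^esub> = \<top>\<^bsub>neg_part L\<^esub> \<longleftrightarrow> \<bottom>\<^bsub>main_part L\<^esub> = \<top>\<^bsub>main_part L\<^esub>"
    using inj_on_eq_iff[OF inj_neg N.bottom_closed N.top_closed]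
      frame_map_bottom[OF frame_neg frame_main frame_map_neg] frame_mapD(2)[OF frame_map_neg] by simp
  ultimately show "\<bottom>\<^bsub>pos_part L\<^esub> = \<top>\<^bsub>pos_part L\<^esub> \<longleftrightarrow> \<bottom>\<^bsub>neg_part L\<^esub> = \<top>\<^bsub>neg_part L\<^esub>" by simp
qed

lemma frame_map_canonical_surj:
  "frame_map (coproduct (pos_part L) (neg_part L)) (main_part L) (canonical_surj L)"
  unfolding canonical_surj_def
  by (rule coproduct_universal(1)[OF frame_pos frame_neg frame_main frame_map_pos frame_map_neg])

lemma canonical_surj_inj:
  "a \<in> carrier (pos_part L) \<Longrightarrow>
    canonical_surj L (inj_left (pos_part L) (neg_part L) a) = pos_emb L a"
  "b \<in> carrier (neg_part L) \<Longrightarrow>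
    canonical_surj L (inj_right (pos_part L) (neg_part L) b) = neg_emb L b"
  unfolding canonical_surj_def
  using coproduct_universal(2,3)[OF frame_pos frame_neg frame_main frame_map_pos frame_map_neg]
  by blast+

lemma canonical_surj_surj:
  "canonical_surj L ` carrier (coproduct (pos_part L) (neg_part L)) = carrier (main_part L)"
proof
  note fm = frame_map_canonical_surj
  let ?C = "coproduct (pos_part L) (neg_part L)"
  interpret C: frame ?C by (rule frame_coproduct[OF frame_pos frame_neg])
  note lc = frame_mapD(1)[OF frame_map_inj_left[OF frame_pos frame_neg]]
    and rc = frame_mapD(1)[OF frame_map_inj_right[OF frame_pos frame_neg]]
  show "canonical_surj L ` carrier ?C \<subseteq> carrier (main_part L)"
    using frame_mapD(1)[OF fm] by auto
  have bm: "x \<in> canonical_surj L ` carrier ?C" if x: "x \<in> basic_meets L" for x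
  proof -
    obtain a b where ab: "a \<in> carrier (pos_part L)" "b \<in> carrier (neg_part L)"
      "x = pos_emb L a \<sqinter>\<^bsub>main_part L\<^esub> neg_emb L b"
      using x unfolding basic_meets_def by blast
    let ?d = "inj_left (pos_part L) (neg_part L) a \<sqinter>\<^bsub>?C\<^esub> inj_right (pos_part L) (neg_part L) b"
    have "canonical_surj L ?d = x"
      using frame_mapD(3)[OF fm lc[OF ab(1)] rc[OF ab(2)]] canonical_surj_inj ab by simp
    moreover have "?d \<in> carrier ?C" using lc[OF ab(1)] rc[OF ab(2)] by simp
    ultimately show ?thesis by blast
  qed
  show "carrier (main_part L) \<subseteq> canonical_surj L ` carrier ?C"
  proof
    fix z assume "z \<in> carrier (main_part L)"
    from generated[OF this] obtain A where A: "A \<subseteq> basic_meets L" "z = \<Squnion>\<^bsub>main_part L\<^esub>A" by blast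
    have "A \<subseteq> canonical_surj L ` carrier ?C" using A(1) bm by blast
    then obtain B where B: "B \<subseteq> carrier ?C" "A = canonical_surj L ` B" by (auto simp: subset_image_iff)
    have "z = canonical_surj L (\<Squnion>\<^bsub>?C\<^esub>B)" using frame_mapD(4)[OF fm B(1)] A(2) B(2) by simp
    then show "z \<in> canonical_surj L ` carrier ?C" using C.sup_closed[OF B(1)] by blast
  qed
qed

end


subsection \<open>The spectrum\<close>

lemma bpt_pointsD:
  assumes "f \<in> bpt_points L"
  shows "frame_map (pos_part L) two (fst f)" "frame_map (neg_part L) two (snd f)"
  using assms by (auto simp: bpt_points_def biframe_map_def two_biframe_def)

lemma istopology_bpt:
  assumes "frame (pos_part L)" "frame (neg_part L)"
  shows "istopology (\<lambda>U. \<exists>a\<in>carrier (pos_part L). U = {f \<in> bpt_points L. fst f a})"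
    and "istopology (\<lambda>U. \<exists>a\<in>carrier (neg_part L). U = {f \<in> bpt_points L. snd f a})"
proof -
  have gen: "istopology (\<lambda>U. \<exists>a\<in>carrier K. U = {f \<in> pts. p f a})"
    if K: "frame K" and p: "\<And>f. f \<in> pts \<Longrightarrow> frame_map K two (p f)"
    for K :: "'z gorder" and pts :: "'y set" and p
    unfolding istopology_def
  proof (intro conjI allI impI)
    interpret K: frame K by (rule K)
    fix S T assume "\<exists>a\<in>carrier K. S = {f \<in> pts. p f a}" "\<exists>a\<in>carrier K. T = {f \<in> pts. p f a}"
    then obtain a b where ab: "a \<in> carrier K" "S = {f \<in> pts. p f a}"
      "b \<in> carrier K" "T = {f \<in> pts. p f b}" by blast
    show "\<exists>a\<in>carrier K. S \<inter> T = {f \<in> pts. p f a}"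
      by (rule bexI[of _ "a \<sqinter>\<^bsub>K\<^esub> b"]) (use ab frame_map_two_iff(2)[OF p] in auto)
  next
    interpret K: frame K by (rule K)
    fix \<U> assume U: "\<forall>S\<in>\<U>. \<exists>a\<in>carrier K. S = {f \<in> pts. p f a}"
    define A where "A = {a \<in> carrier K. {f \<in> pts. p f a} \<in> \<U>}"
    have A: "A \<subseteq> carrier K" by (auto simp: A_def)
    have UA: "\<U> = (\<lambda>a. {f \<in> pts. p f a}) ` A"
    proof
      show "\<U> \<subseteq> (\<lambda>a. {f \<in> pts. p f a}) ` A"
      proof
        fix S assume S: "S \<in> \<U>"
        then obtain a where "a \<in> carrier K" "S = {f \<in> pts. p f a}" using U by blast
        then show "S \<in> (\<lambda>a. {f \<in> pts. p f a}) ` A" using S by (auto simp: A_def)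
      qed
    qed (auto simp: A_def)
    show "\<exists>a\<in>carrier K. \<Union>\<U> = {f \<in> pts. p f a}"
    proof (rule bexI[of _ "\<Squnion>\<^bsub>K\<^esub>A"])
      show "\<Union>\<U> = {f \<in> pts. p f (\<Squnion>\<^bsub>K\<^esub>A)}"
        unfolding UA using frame_map_two_iff(3)[OF p A] by blast
    qed (use A in simp)
  qed
  show "istopology (\<lambda>U. \<exists>a\<in>carrier (pos_part L). U = {f \<in> bpt_points L. fst f a})"
    by (rule gen[OF assms(1) bpt_pointsD(1)])
  show "istopology (\<lambda>U. \<exists>a\<in>carrier (neg_part L). U = {f \<in> bpt_points L. snd f a})"
    by (rule gen[OF assms(2) bpt_pointsD(2)])
qed

lemma openin_bpt:
  assumes "frame (pos_part L)" "frame (neg_part L)"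
  shows "openin (pos_top (bpt L)) U \<longleftrightarrow> (\<exists>a\<in>carrier (pos_part L). U = {f \<in> bpt_points L. fst f a})"
    and "openin (neg_top (bpt L)) U \<longleftrightarrow> (\<exists>a\<in>carrier (neg_part L). U = {f \<in> bpt_points L. snd f a})"
  using topology_inverse'[OF istopology_bpt(1)[OF assms]]
    topology_inverse'[OF istopology_bpt(2)[OF assms]]
  by (simp_all add: bpt_def)

lemma topspace_bpt:
  assumes "frame (pos_part L)" "frame (neg_part L)"
  shows "topspace (pos_top (bpt L)) = bpt_points L" "topspace (neg_top (bpt L)) = bpt_points L"
proof -
  interpret P: frame "pos_part L" by (rule assms(1))
  interpret N: frame "neg_part L" by (rule assms(2))
  have "bpt_points L = {f \<in> bpt_points L. fst f \<top>\<^bsub>pos_part L\<^esub>}"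
    using frame_map_two_iff(1)[OF bpt_pointsD(1)] by auto
  then have "openin (pos_top (bpt L)) (bpt_points L)" using openin_bpt(1)[OF assms] P.top_closed by blast
  moreover have "topspace (pos_top (bpt L)) \<subseteq> bpt_points L"
    using openin_bpt(1)[OF assms, of "topspace (pos_top (bpt L))"] by auto
  ultimately show "topspace (pos_top (bpt L)) = bpt_points L"
    using openin_subset by blast
  have "bpt_points L = {f \<in> bpt_points L. snd f \<top>\<^bsub>neg_part L\<^esub>}"
    using frame_map_two_iff(1)[OF bpt_pointsD(2)] by auto
  then have "openin (neg_top (bpt L)) (bpt_points L)" using openin_bpt(2)[OF assms] N.top_closed by blast
  moreover have "topspace (neg_top (bpt L)) \<subseteq> bpt_points L"
    using openin_bpt(2)[OF assms, of "topspace (neg_top (bpt L))"] by auto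
  ultimately show "topspace (neg_top (bpt L)) = bpt_points L"
    using openin_subset by blast
qed

lemma bispace_bpt: "biframe L \<Longrightarrow> bispace (bpt L)"
  by (rule bispace.intro) (simp add: topspace_bpt biframe.frame_pos biframe.frame_neg)

lemma points_bpt: "biframe L \<Longrightarrow> points (bpt L) = bpt_points L"
  by (simp add: points_def topspace_bpt biframe.frame_pos biframe.frame_neg)

lemma bispace_bisubspace: "bispace X \<Longrightarrow> bispace (bisubspace X S)"
  by (auto simp: bispace_def bisubspace_def)


subsection \<open>The finitary biframe of opens\<close>

lemma carrier_opens: "carrier (opens T) = {U. openin T U}"
  by (simp add: opens_def)

lemma top_opens: "\<top>\<^bsub>opens T\<^esub> = topspace T"
proof -
  interpret F: frame "opens T" by (rule frame_opens)
  have "topspace T \<subseteq> \<top>\<^bsub>opens T\<^esub>" using F.top_higher[of "topspace T"] by (simp add: opens_def)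
  moreover have "\<top>\<^bsub>opens T\<^esub> \<subseteq> topspace T" using F.top_closed openin_subset by (auto simp: opens_def)
  ultimately show ?thesis by blast
qed

lemma bottom_opens: "\<bottom>\<^bsub>opens T\<^esub> = {}"
  using frame.Sup_empty[OF frame_opens[of T]] Sup_opens[of "{}" T] by simp

context bispace
begin

lemma Omega_fin_rel_carrier:
  "Omega_fin_rel X \<subseteq> carrier (opens_coproduct X) \<times> carrier (opens_coproduct X)"
proof -
  interpret C: frame "opens_coproduct X"
    unfolding opens_coproduct_def by (rule frame_coproduct[OF frame_opens frame_opens])
  have "pos_open X U \<in> carrier (opens_coproduct X)" if "openin (pos_top X) U" for U
    using frame_mapD(1)[OF frame_map_inj_left[OF frame_opens frame_opens]] that
    by (simp add: opens_coproduct_def pos_open_def carrier_opens)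
  moreover have "neg_open X U \<in> carrier (opens_coproduct X)" if "openin (neg_top X) U" for U
    using frame_mapD(1)[OF frame_map_inj_right[OF frame_opens frame_opens]] that
    by (simp add: opens_coproduct_def neg_open_def carrier_opens)
  ultimately show ?thesis by (auto simp: Omega_fin_rel_def)
qed

lemma biframe_bOmega_fin: "biframe (bOmega_fin X)"
proof (rule biframe.intro)
  let ?C = "opens_coproduct X" and ?R = "Omega_fin_rel X"
  let ?q = "quotient_map_of ?C ?R" and ?F = "quotient_frame ?C ?R"
  have frC: "frame ?C" unfolding opens_coproduct_def by (rule frame_coproduct[OF frame_opens frame_opens])
  interpret C: frame ?C by (rule frC)
  note frF = frame_quotient[OF frC Omega_fin_rel_carrier]
    and q = frame_map_quotient[OF frC Omega_fin_rel_carrier]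
  have l: "frame_map (opens (pos_top X)) ?C (pos_open X)"
    unfolding opens_coproduct_def pos_open_def by (rule frame_map_inj_left[OF frame_opens frame_opens])
  have r: "frame_map (opens (neg_top X)) ?C (neg_open X)"
    unfolding opens_coproduct_def neg_open_def by (rule frame_map_inj_right[OF frame_opens frame_opens])
  have comp: "frame_map A D (g \<circ> f)" if "frame A" "frame D" "frame_map A B f" "frame_map B D g"
    for A :: "'z1 gorder" and B :: "'z2 gorder" and D :: "'z3 gorder" and f g
  proof (rule frame_mapI[OF that(1,2)])
    note f = frame_mapD[OF that(3)] and g = frame_mapD[OF that(4)]
    show "(g \<circ> f) (\<Squnion>\<^bsub>A\<^esub>S) = \<Squnion>\<^bsub>D\<^esub>((g \<circ> f) ` S)" if "S \<subseteq> carrier A" for S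
    proof -
      have "f ` S \<subseteq> carrier B" using that f(1) by auto
      then show ?thesis using f(4)[OF that] g(4) by (simp add: image_comp)
    qed
  qed (simp_all add: frame_mapD(1-3)[OF that(3)] frame_mapD(1-3)[OF that(4)])
  let ?P = "opens (discrete_topology (points X))"
  have sp: "topspace (pos_top X) = points X" "topspace (neg_top X) = points X"
    using same_points by (simp_all add: points_def)
  have inc: "frame_map (opens T) ?P id" if T: "topspace T = points X" for T
  proof (rule frame_mapI[OF frame_opens frame_opens])
    have P: "openin (discrete_topology (points X)) U" if "openin T U" for U
      using openin_subset[OF that] T by simp
    show "id U \<in> carrier ?P" if "U \<in> carrier (opens T)" for U using that P by (simp add: carrier_opens)
    show "id \<top>\<^bsub>opens T\<^esub> = \<top>\<^bsub>?P\<^esub>" by (simp add: top_opens T)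
    show "id (U \<sqinter>\<^bsub>opens T\<^esub> V) = id U \<sqinter>\<^bsub>?P\<^esub> id V"
      if "U \<in> carrier (opens T)" "V \<in> carrier (opens T)" for U V
      using that P meet_opens[of T U V] meet_opens[of "discrete_topology (points X)" U V]
      by (simp add: carrier_opens)
    show "id (\<Squnion>\<^bsub>opens T\<^esub>A) = \<Squnion>\<^bsub>?P\<^esub>(id ` A)" if A: "A \<subseteq> carrier (opens T)" for A
    proof -
      have "A \<subseteq> {U. openin T U}" using A by (simp add: carrier_opens)
      moreover from this have "A \<subseteq> {U. openin (discrete_topology (points X)) U}" using P by blast
      ultimately show ?thesis using Sup_opens[of A T] Sup_opens[of A "discrete_topology (points X)"]
        by simp
    qed
  qed
  note U = coproduct_universal[OF frame_opens frame_opens frame_opens inc[OF sp(1)] inc[OF sp(2)],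
      folded opens_coproduct_def pos_open_def neg_open_def]
  let ?h = "copair ?P id id"
  interpret P: frame ?P by (rule frame_opens)
  have hp: "?h (pos_open X V) = V" if "openin (pos_top X) V" for V
    using U(2)[of V] that by (simp add: carrier_opens pos_open_def)
  have hn: "?h (neg_open X V) = V" if "openin (neg_top X) V" for V
    using U(3)[of V] that by (simp add: carrier_opens neg_open_def)
  have pc: "pos_open X V \<in> carrier ?C" if "openin (pos_top X) V" for V
    using frame_mapD(1)[OF l, of V] that by (simp add: carrier_opens)
  have nc: "neg_open X V \<in> carrier ?C" if "openin (neg_top X) V" for V
    using frame_mapD(1)[OF r, of V] that by (simp add: carrier_opens)
  have disc: "openin (discrete_topology (points X)) V"
    if "openin (pos_top X) V \<or> openin (neg_top X) V" for V
    using that openin_subset sp by fastforce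
  have "?h a \<sqsubseteq>\<^bsub>?P\<^esub> ?h b" if R: "(a, b) \<in> ?R" for a b
  proof -
    obtain Up Um Vp Vm where ab: "a = pos_open X Up \<sqinter>\<^bsub>?C\<^esub> neg_open X Um"
      "b = pos_open X Vp \<squnion>\<^bsub>?C\<^esub> neg_open X Vm"
      and o: "openin (pos_top X) Up" "openin (pos_top X) Vp"
        "openin (neg_top X) Um" "openin (neg_top X) Vm" and sub: "Up \<inter> Um \<subseteq> Vp \<union> Vm"
      using R unfolding Omega_fin_rel_def by blast
    have "?h a = Up \<inter> Um"
      using frame_mapD(3)[OF U(1) pc[OF o(1)] nc[OF o(3)]] hp[OF o(1)] hn[OF o(3)] ab(1)
        meet_opens[OF disc disc, of Up Um] o by simp
    moreover have "?h b = Vp \<union> Vm"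
      using frame_mapD(4)[OF U(1), of "{pos_open X Vp, neg_open X Vm}"] pc[OF o(2)] nc[OF o(4)]
        hp[OF o(2)] hn[OF o(4)] ab(2) Sup_opens[of "{Vp, Vm}" "discrete_topology (points X)"]
        disc[of Vp] disc[of Vm] o by (simp add: join_def)
    ultimately show ?thesis using sub by (simp add: opens_def)
  qed
  from quotient_frame_universal(1)[OF frC Omega_fin_rel_carrier frame_opens U(1) this]
  obtain g where g: "\<And>a. a \<in> carrier ?C \<Longrightarrow> g (?q a) = ?h a" by blast
  show "inj_on (pos_emb (bOmega_fin X)) (carrier (pos_part (bOmega_fin X)))"
    by (rule inj_on_inverseI[of _ g]) (simp add: bOmega_fin_def g pc hp carrier_opens)
  show "inj_on (neg_emb (bOmega_fin X)) (carrier (neg_part (bOmega_fin X)))"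
    by (rule inj_on_inverseI[of _ g]) (simp add: bOmega_fin_def g nc hn carrier_opens)
  show "frame_map (pos_part (bOmega_fin X)) (main_part (bOmega_fin X)) (pos_emb (bOmega_fin X))"
    using comp[OF frame_opens frF l q] by (simp add: bOmega_fin_def)
  show "frame_map (neg_part (bOmega_fin X)) (main_part (bOmega_fin X)) (neg_emb (bOmega_fin X))"
    using comp[OF frame_opens frF r q] by (simp add: bOmega_fin_def)
  show "\<exists>A\<subseteq>basic_meets (bOmega_fin X). z = \<Squnion>\<^bsub>main_part (bOmega_fin X)\<^esub>A"
    if "z \<in> carrier (main_part (bOmega_fin X))" for z
  proof -
    have "z \<in> carrier ?F" using that by (simp add: bOmega_fin_def)
    then obtain D where D: "D \<in> carrier ?C" "z = ?q D"
      using quotient_map_surj[OF frC Omega_fin_rel_carrier] by blast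
    have cp: "cp_ideal (opens (pos_top X)) (opens (neg_top X)) D"
      using D(1) by (simp add: opens_coproduct_def coproduct_def)
    let ?r = "\<lambda>(a, b). pos_open X a \<sqinter>\<^bsub>?C\<^esub> neg_open X b"
    have Deq: "D = \<Squnion>\<^bsub>?C\<^esub>(?r ` D)"
      using coproduct_generated[OF frame_opens frame_opens cp]
      unfolding opens_coproduct_def pos_open_def neg_open_def .
    have o: "openin (pos_top X) a" "openin (neg_top X) b" if "(a, b) \<in> D" for a b
      using cp_idealD(1,2)[OF cp that] by (simp_all add: carrier_opens)
    have sub: "?r ` D \<subseteq> carrier ?C" using o pc nc by auto
    have "z = \<Squnion>\<^bsub>?F\<^esub>(?q ` ?r ` D)" using frame_mapD(4)[OF q sub] Deq D(2) by simp
    moreover have "?q ` ?r ` D \<subseteq> basic_meets (bOmega_fin X)"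
    proof clarify
      fix a b assume "(a, b) \<in> D"
      then have ab: "openin (pos_top X) a" "openin (neg_top X) b" by (fact o)+
      show "?q (pos_open X a \<sqinter>\<^bsub>?C\<^esub> neg_open X b) \<in> basic_meets (bOmega_fin X)"
        using basic_meetsI[of a "bOmega_fin X" b] ab
        by (simp add: bOmega_fin_def carrier_opens frame_mapD(3)[OF q pc[OF ab(1)] nc[OF ab(2)]])
    qed
    ultimately show ?thesis by (auto simp: bOmega_fin_def)
  qed
  show "frame (main_part (bOmega_fin X))" using frF by (simp add: bOmega_fin_def)
qed (simp_all add: bOmega_fin_def frame_opens)

end

end

theory Submission
  imports Defs
begin

text \<open>
  A bisubspace of \<open>bpt L\<close> is bisober exactly when it is closed in the Skula topology, the one
  generated by all positive opens, all negative opens and their complements.  Indeed a point of the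
  finitary biframe of opens of a subset restricts to a point of \<open>L\<close>, and the points of \<open>L\<close> that
  arise in this way are those in the Skula closure of the subset.  Singletons are Skula closed, and
  all five conditions say that the Skula topology is discrete.
\<close>

section \<open>Points as pairs of completely prime filters\<close>

text \<open>The obstacle is the main component: for the biframe of opens it is a quotient of a
  coproduct, whose order is never computed. It can be avoided because a point is a pair of maps on
  the two outer components, and because the existence of a map on the main component amounts to one
  condition on four elements: whenever \<open>x \<sqinter> y\<close> lies below
  \<open>u \<squnion> v\<close> and the point accepts \<open>x\<close> and \<open>y\<close>, it
  accepts \<open>u\<close> or \<open>v\<close>. For a subset \<open>S\<close> of the spectrum, the
  relation defining the biframe of opens imposes the same condition, with the order of
  \<open>L\<close> replaced by inclusion of traces on \<open>S\<close>. A quadruple at which a point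
  of \<open>L\<close> breaks this condition is exactly a basic Skula neighbourhood of the point that
  misses \<open>S\<close>; this is where the Skula closure comes from. Quadruples suffice because
  positive opens, and likewise negative opens, are closed under finite intersections and unions. In
  the same language bi-T_D says that every point has a basic Skula neighbourhood containing nothing
  else.\<close>

context biframe
begin

lemma pos_emb_closed: "a \<in> carrier (pos_part L) \<Longrightarrow> pos_emb L a \<in> carrier (main_part L)"
  by (rule frame_mapD(1)[OF frame_map_pos])

lemma neg_emb_closed: "a \<in> carrier (neg_part L) \<Longrightarrow> neg_emb L a \<in> carrier (main_part L)"
  by (rule frame_mapD(1)[OF frame_map_neg])

text \<open>
  If \<open>u\<close> and \<open>v\<close> are the largest elements rejected by \<open>p\<close> and \<open>n\<close>, then every
  basic meet rejected by \<open>(p, n)\<close> lies below \<open>u \<squnion> v\<close>; hence the condition on the right also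
  controls infinite joins of basic meets.
\<close>

lemma frame_map_main_two:
  assumes p: "frame_map (pos_part L) two p" and n: "frame_map (neg_part L) two n"
    and ok: "\<And>x y u v. \<lbrakk>x \<in> carrier (pos_part L); u \<in> carrier (pos_part L);
        y \<in> carrier (neg_part L); v \<in> carrier (neg_part L);
        pos_emb L x \<sqinter>\<^bsub>main_part L\<^esub> neg_emb L y
          \<sqsubseteq>\<^bsub>main_part L\<^esub> pos_emb L u \<squnion>\<^bsub>main_part L\<^esub> neg_emb L v; p x; n y\<rbrakk>
      \<Longrightarrow> p u \<or> n v"
  defines "g \<equiv> \<lambda>z. \<exists>x\<in>carrier (pos_part L). \<exists>y\<in>carrier (neg_part L).
      pos_emb L x \<sqinter>\<^bsub>main_part L\<^esub> neg_emb L y \<sqsubseteq>\<^bsub>main_part L\<^esub> z \<and> p x \<and> n y"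
  shows "frame_map (main_part L) two g"
    and "\<And>a. a \<in> carrier (pos_part L) \<Longrightarrow> g (pos_emb L a) = p a"
    and "\<And>a. a \<in> carrier (neg_part L) \<Longrightarrow> g (neg_emb L a) = n a"
proof -
  let ?M = "main_part L" and ?P = "pos_part L" and ?N = "neg_part L"
  interpret P: frame ?P by (rule frame_pos)
  interpret N: frame ?N by (rule frame_neg)
  interpret M: frame ?M by (rule frame_main)
  note pI = frame_map_two_iff[OF p] and nI = frame_map_two_iff[OF n]
  note closed = pos_emb_closed neg_emb_closed
  define U where "U = \<Squnion>\<^bsub>?P\<^esub>{u \<in> carrier ?P. \<not> p u}"
  define V where "V = \<Squnion>\<^bsub>?N\<^esub>{v \<in> carrier ?N. \<not> n v}"
  have U: "U \<in> carrier ?P" "\<not> p U"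
    using pI(3)[of "{u \<in> carrier ?P. \<not> p u}"] by (auto simp: U_def intro!: P.sup_closed)
  have V: "V \<in> carrier ?N" "\<not> n V"
    using nI(3)[of "{v \<in> carrier ?N. \<not> n v}"] by (auto simp: V_def intro!: N.sup_closed)
  let ?w = "pos_emb L U \<squnion>\<^bsub>?M\<^esub> neg_emb L V"
  have w: "?w \<in> carrier ?M" using U(1) V(1) closed by simp
  have g_mono: "g z'" if "g z" "z \<sqsubseteq>\<^bsub>?M\<^esub> z'" "z \<in> carrier ?M" "z' \<in> carrier ?M" for z z'
    using that unfolding g_def by (meson M.le_trans M.meet_closed closed)
  have below: "z \<sqsubseteq>\<^bsub>?M\<^esub> ?w" if z: "z \<in> carrier ?M" and ng: "\<not> g z" for z
  proof -
    obtain A where A: "A \<subseteq> basic_meets L" "z = \<Squnion>\<^bsub>?M\<^esub>A" using generated[OF z] by blast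
    have Ac: "A \<subseteq> carrier ?M" using A(1) closed by (auto simp: basic_meets_def)
    have "a \<sqsubseteq>\<^bsub>?M\<^esub> ?w" if a: "a \<in> A" for a
    proof -
      obtain x y where xy: "x \<in> carrier ?P" "y \<in> carrier ?N"
        and a_eq: "a = pos_emb L x \<sqinter>\<^bsub>?M\<^esub> neg_emb L y"
        using A(1) a by (auto simp: basic_meets_def)
      have c: "pos_emb L x \<in> carrier ?M" "neg_emb L y \<in> carrier ?M"
        "pos_emb L U \<in> carrier ?M" "neg_emb L V \<in> carrier ?M" using xy U V closed by auto
      have "a \<sqsubseteq>\<^bsub>?M\<^esub> z" unfolding A(2) using Ac a by (rule M.sup_upper)
      then have "\<not> p x \<or> \<not> n y" using ng xy a_eq unfolding g_def by blast
      then show ?thesis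
      proof
        assume "\<not> p x"
        then have "x \<sqsubseteq>\<^bsub>?P\<^esub> U" unfolding U_def using xy by (intro P.sup_upper) auto
        then have "pos_emb L x \<sqsubseteq>\<^bsub>?M\<^esub> pos_emb L U"
          using frame_map_mono[OF frame_pos frame_main frame_map_pos] xy U by blast
        then show ?thesis unfolding a_eq
          using c by (meson M.join_closed M.join_left M.le_trans M.meet_closed M.meet_left)
      next
        assume "\<not> n y"
        then have "y \<sqsubseteq>\<^bsub>?N\<^esub> V" unfolding V_def using xy by (intro N.sup_upper) auto
        then have "neg_emb L y \<sqsubseteq>\<^bsub>?M\<^esub> neg_emb L V"
          using frame_map_mono[OF frame_neg frame_main frame_map_neg] xy V by blast
        then show ?thesis unfolding a_eq
          using c by (meson M.join_closed M.join_right M.le_trans M.meet_closed M.meet_right)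
      qed
    qed
    then show ?thesis unfolding A(2) using Ac w by (intro M.sup_least) auto
  qed
  \<comment> \<open>Here \<open>ok\<close> is applied to \<open>U\<close> and \<open>V\<close>,
    which \<open>p\<close> and \<open>n\<close> reject. With \<open>below\<close> and
    \<open>g_mono\<close> this makes the elements rejected by \<open>g\<close> exactly those below
    \<open>?w\<close>, so a join of rejected elements is rejected.\<close>
  have not_w: "\<not> g ?w" using ok U V unfolding g_def by blast
  show "frame_map ?M two g"
  proof (rule frame_mapI[OF frame_main frame_two])
    have "g \<top>\<^bsub>?M\<^esub>" unfolding g_def using pI(1) nI(1) closed
      by (intro bexI[of _ "\<top>\<^bsub>?P\<^esub>"] bexI[of _ "\<top>\<^bsub>?N\<^esub>"]) auto
    then show "g \<top>\<^bsub>?M\<^esub> = \<top>\<^bsub>two\<^esub>" by (simp add: top_two)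
  next
    fix z z' assume z: "z \<in> carrier ?M" "z' \<in> carrier ?M"
    have "g (z \<sqinter>\<^bsub>?M\<^esub> z')" if "g z" "g z'"
    proof -
      obtain x y where xy: "x \<in> carrier ?P" "y \<in> carrier ?N"
        "pos_emb L x \<sqinter>\<^bsub>?M\<^esub> neg_emb L y \<sqsubseteq>\<^bsub>?M\<^esub> z" "p x" "n y" using \<open>g z\<close> g_def by blast
      obtain x' y' where xy': "x' \<in> carrier ?P" "y' \<in> carrier ?N"
        "pos_emb L x' \<sqinter>\<^bsub>?M\<^esub> neg_emb L y' \<sqsubseteq>\<^bsub>?M\<^esub> z'" "p x'" "n y'" using \<open>g z'\<close> g_def by blast
      let ?x = "x \<sqinter>\<^bsub>?P\<^esub> x'" and ?y = "y \<sqinter>\<^bsub>?N\<^esub> y'"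
      have c: "?x \<in> carrier ?P" "?y \<in> carrier ?N" using xy xy' by auto
      have px: "pos_emb L ?x \<sqsubseteq>\<^bsub>?M\<^esub> pos_emb L x" "pos_emb L ?x \<sqsubseteq>\<^bsub>?M\<^esub> pos_emb L x'"
        using frame_map_mono[OF frame_pos frame_main frame_map_pos] xy xy' c
        by (simp_all add: P.meet_left P.meet_right)
      have ny: "neg_emb L ?y \<sqsubseteq>\<^bsub>?M\<^esub> neg_emb L y" "neg_emb L ?y \<sqsubseteq>\<^bsub>?M\<^esub> neg_emb L y'"
        using frame_map_mono[OF frame_neg frame_main frame_map_neg] xy xy' c
        by (simp_all add: N.meet_left N.meet_right)
      have mc: "pos_emb L ?x \<in> carrier ?M" "neg_emb L ?y \<in> carrier ?M"
        "pos_emb L x \<in> carrier ?M" "neg_emb L y \<in> carrier ?M"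
        "pos_emb L x' \<in> carrier ?M" "neg_emb L y' \<in> carrier ?M" using c xy xy' closed by auto
      have "pos_emb L ?x \<sqinter>\<^bsub>?M\<^esub> neg_emb L ?y \<sqsubseteq>\<^bsub>?M\<^esub> z"
        using M.le_trans[OF M.meet_mono[OF px(1) ny(1)] xy(3)] mc z by simp
      moreover have "pos_emb L ?x \<sqinter>\<^bsub>?M\<^esub> neg_emb L ?y \<sqsubseteq>\<^bsub>?M\<^esub> z'"
        using M.le_trans[OF M.meet_mono[OF px(2) ny(2)] xy'(3)] mc z by simp
      ultimately have "pos_emb L ?x \<sqinter>\<^bsub>?M\<^esub> neg_emb L ?y \<sqsubseteq>\<^bsub>?M\<^esub> z \<sqinter>\<^bsub>?M\<^esub> z'"
        using mc z by (intro M.meet_le) auto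
      moreover have "p ?x" "n ?y" using pI(2) nI(2) xy xy' by auto
      ultimately show ?thesis using c g_def by blast
    qed
    moreover have "g z \<and> g z'" if "g (z \<sqinter>\<^bsub>?M\<^esub> z')"
      using g_mono[OF that] z by (simp add: M.meet_left M.meet_right)
    ultimately show "g (z \<sqinter>\<^bsub>?M\<^esub> z') = g z \<sqinter>\<^bsub>two\<^esub> g z'" by (auto simp: meet_two)
  next
    fix A assume A: "A \<subseteq> carrier ?M"
    have "\<exists>a\<in>A. g a" if gA: "g (\<Squnion>\<^bsub>?M\<^esub>A)"
    proof (rule ccontr)
      assume "\<not> (\<exists>a\<in>A. g a)"
      then have "\<Squnion>\<^bsub>?M\<^esub>A \<sqsubseteq>\<^bsub>?M\<^esub> ?w" using below A w by (intro M.sup_least) auto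
      then show False using g_mono[OF gA] not_w A w by simp
    qed
    moreover have "g (\<Squnion>\<^bsub>?M\<^esub>A)" if "a \<in> A" "g a" for a
      using g_mono[OF that(2) M.sup_upper[OF A that(1)]] A that(1) by auto
    ultimately show "g (\<Squnion>\<^bsub>?M\<^esub>A) = \<Squnion>\<^bsub>two\<^esub>(g ` A)" by (auto simp: Sup_two image_iff)
  qed (simp add: two_def)
  have nbot: "\<not> n \<bottom>\<^bsub>?N\<^esub>" using nI(3)[of "{}"] N.Sup_empty by simp
  have pbot: "\<not> p \<bottom>\<^bsub>?P\<^esub>" using pI(3)[of "{}"] P.Sup_empty by simp
  show "g (pos_emb L a) = p a" if a: "a \<in> carrier ?P" for a
  proof
    assume "g (pos_emb L a)"
    then obtain x y where xy: "x \<in> carrier ?P" "y \<in> carrier ?N"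
      "pos_emb L x \<sqinter>\<^bsub>?M\<^esub> neg_emb L y \<sqsubseteq>\<^bsub>?M\<^esub> pos_emb L a" "p x" "n y" using g_def by blast
    \<comment> \<open>The hypothesis \<open>ok\<close> needs a join on the right. The negative
      bottom fills the empty slot, and since \<open>n\<close> rejects it, the resulting disjunction
      leaves \<open>p a\<close>.\<close>
    have "pos_emb L a \<sqsubseteq>\<^bsub>?M\<^esub> pos_emb L a \<squnion>\<^bsub>?M\<^esub> neg_emb L \<bottom>\<^bsub>?N\<^esub>"
      using a closed by (intro M.join_left) auto
    then have "pos_emb L x \<sqinter>\<^bsub>?M\<^esub> neg_emb L y \<sqsubseteq>\<^bsub>?M\<^esub> pos_emb L a \<squnion>\<^bsub>?M\<^esub> neg_emb L \<bottom>\<^bsub>?N\<^esub>"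
      using M.le_trans[OF xy(3)] xy a closed by simp
    then show "p a" using ok[OF xy(1) a xy(2) N.bottom_closed _ xy(4,5)] nbot by blast
  next
    assume "p a"
    moreover have "pos_emb L a \<sqinter>\<^bsub>?M\<^esub> neg_emb L \<top>\<^bsub>?N\<^esub> \<sqsubseteq>\<^bsub>?M\<^esub> pos_emb L a"
      using a closed by (intro M.meet_left) auto
    ultimately show "g (pos_emb L a)" using a nI(1) N.top_closed unfolding g_def by blast
  qed
  show "g (neg_emb L a) = n a" if a: "a \<in> carrier ?N" for a
  proof
    assume "g (neg_emb L a)"
    then obtain x y where xy: "x \<in> carrier ?P" "y \<in> carrier ?N"
      "pos_emb L x \<sqinter>\<^bsub>?M\<^esub> neg_emb L y \<sqsubseteq>\<^bsub>?M\<^esub> neg_emb L a" "p x" "n y" using g_def by blast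
    have "neg_emb L a \<sqsubseteq>\<^bsub>?M\<^esub> pos_emb L \<bottom>\<^bsub>?P\<^esub> \<squnion>\<^bsub>?M\<^esub> neg_emb L a"
      using a closed by (intro M.join_right) auto
    then have "pos_emb L x \<sqinter>\<^bsub>?M\<^esub> neg_emb L y \<sqsubseteq>\<^bsub>?M\<^esub> pos_emb L \<bottom>\<^bsub>?P\<^esub> \<squnion>\<^bsub>?M\<^esub> neg_emb L a"
      using M.le_trans[OF xy(3)] xy a closed by simp
    then show "n a" using ok[OF xy(1) P.bottom_closed xy(2) a _ xy(4,5)] pbot by blast
  next
    assume "n a"
    moreover have "pos_emb L \<top>\<^bsub>?P\<^esub> \<sqinter>\<^bsub>?M\<^esub> neg_emb L a \<sqsubseteq>\<^bsub>?M\<^esub> neg_emb L a"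
      using a closed by (intro M.meet_right) auto
    ultimately show "g (neg_emb L a)" using a pI(1) P.top_closed unfolding g_def by blast
  qed
qed

text \<open>The main map, which the definition of a point only asserts to exist, is traded for a
  condition that mentions no map out of the main component. A main map forces the condition because
  it preserves the inequality; conversely \<open>frame_map_main_two\<close> builds the map from the
  condition.\<close>

lemma bpt_points_iff:
  "(p, n) \<in> bpt_points L \<longleftrightarrow>
     p \<in> extensional (carrier (pos_part L)) \<and> n \<in> extensional (carrier (neg_part L)) \<and>
     frame_map (pos_part L) two p \<and> frame_map (neg_part L) two n \<and>
     (\<forall>x\<in>carrier (pos_part L). \<forall>u\<in>carrier (pos_part L).
      \<forall>y\<in>carrier (neg_part L). \<forall>v\<in>carrier (neg_part L).
        pos_emb L x \<sqinter>\<^bsub>main_part L\<^esub> neg_emb L y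
          \<sqsubseteq>\<^bsub>main_part L\<^esub> pos_emb L u \<squnion>\<^bsub>main_part L\<^esub> neg_emb L v \<longrightarrow> p x \<longrightarrow> n y \<longrightarrow> p u \<or> n v)"
    (is "?l \<longleftrightarrow> ?r")
proof
  let ?M = "main_part L"
  interpret M: frame ?M by (rule frame_main)
  assume ?l
  then obtain f where f: "frame_map ?M two f"
    "\<And>a. a \<in> carrier (pos_part L) \<Longrightarrow> f (pos_emb L a) = p a"
    "\<And>a. a \<in> carrier (neg_part L) \<Longrightarrow> f (neg_emb L a) = n a"
    unfolding bpt_points_def biframe_map_def by (auto simp: two_biframe_def)
  note fI = frame_map_two_iff[OF f(1)]
  have "p u \<or> n v"
    if c: "x \<in> carrier (pos_part L)" "u \<in> carrier (pos_part L)"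
        "y \<in> carrier (neg_part L)" "v \<in> carrier (neg_part L)"
      and le: "pos_emb L x \<sqinter>\<^bsub>?M\<^esub> neg_emb L y \<sqsubseteq>\<^bsub>?M\<^esub> pos_emb L u \<squnion>\<^bsub>?M\<^esub> neg_emb L v"
      and "p x" "n y" for x u y v
  proof -
    have mc: "pos_emb L x \<in> carrier ?M" "neg_emb L y \<in> carrier ?M"
        "pos_emb L u \<in> carrier ?M" "neg_emb L v \<in> carrier ?M"
      using c pos_emb_closed neg_emb_closed by auto
    have "f (pos_emb L x \<sqinter>\<^bsub>?M\<^esub> neg_emb L y)" using fI(2) mc f c that by simp
    then have "f (pos_emb L u \<squnion>\<^bsub>?M\<^esub> neg_emb L v)"
      using frame_map_mono[OF frame_main frame_two f(1) _ _ le] mc by (simp add: two_def)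
    then show ?thesis using fI(3)[of "{pos_emb L u, neg_emb L v}"] mc f c by (simp add: join_def)
  qed
  then show ?r using \<open>?l\<close> bpt_pointsD[OF \<open>?l\<close>] by (auto simp: bpt_points_def)
next
  assume r: ?r
  then have p: "frame_map (pos_part L) two p" and n: "frame_map (neg_part L) two n" by auto
  note g = frame_map_main_two[OF p n]
  have "biframe_map L two_biframe p n"
    unfolding biframe_map_def two_biframe_def biframe.simps id_apply
    by (intro conjI exI ballI p n; (rule g; use r in blast))
  then show ?l using r by (simp add: bpt_points_def)
qed

end

lemma bpt_points_eqI:
  assumes "f \<in> bpt_points L" "g \<in> bpt_points L"
    and "\<And>a. a \<in> carrier (pos_part L) \<Longrightarrow> fst f a = fst g a"
    and "\<And>a. a \<in> carrier (neg_part L) \<Longrightarrow> snd f a = snd g a"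
  shows "f = g"
proof (rule prod_eqI)
  show "fst f = fst g" using assms
    by (intro extensionalityI[of _ "carrier (pos_part L)"]) (auto simp: bpt_points_def)
  show "snd f = snd g" using assms
    by (intro extensionalityI[of _ "carrier (neg_part L)"]) (auto simp: bpt_points_def)
qed

section \<open>Points of the finitary biframe of opens\<close>

context bispace
begin

text \<open>Compared with \<open>bpt_points_iff\<close>, the order of the quotient is replaced by
  inclusion of sets. From left to right, only the generating inequalities of the quotient are used.
  From right to left, \<open>p\<close> and \<open>n\<close> are copaired on the coproduct, the
  condition says that the copairing respects the generating relation, and the universal property of
  the quotient supplies the main map.\<close>

lemma bpt_points_bOmega_fin_iff:
  "(p, n) \<in> bpt_points (bOmega_fin X) \<longleftrightarrow>
     p \<in> extensional {U. openin (pos_top X) U} \<and> n \<in> extensional {U. openin (neg_top X) U} \<and>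
     frame_map (opens (pos_top X)) two p \<and> frame_map (opens (neg_top X)) two n \<and>
     (\<forall>Up Um Vp Vm. openin (pos_top X) Up \<longrightarrow> openin (pos_top X) Vp \<longrightarrow>
        openin (neg_top X) Um \<longrightarrow> openin (neg_top X) Vm \<longrightarrow>
        Up \<inter> Um \<subseteq> Vp \<union> Vm \<longrightarrow> p Up \<longrightarrow> n Um \<longrightarrow> p Vp \<or> n Vm)"
    (is "?l \<longleftrightarrow> ?r")
proof
  let ?C = "opens_coproduct X" and ?R = "Omega_fin_rel X"
  let ?q = "quotient_map_of ?C ?R" and ?F = "quotient_frame ?C ?R"
  have frC: "frame ?C"
    unfolding opens_coproduct_def by (rule frame_coproduct[OF frame_opens frame_opens])
  note q = frame_map_quotient[OF frC Omega_fin_rel_carrier]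
  have l: "frame_map (opens (pos_top X)) ?C (pos_open X)"
    unfolding opens_coproduct_def pos_open_def by (rule frame_map_inj_left[OF frame_opens frame_opens])
  have r: "frame_map (opens (neg_top X)) ?C (neg_open X)"
    unfolding opens_coproduct_def neg_open_def by (rule frame_map_inj_right[OF frame_opens frame_opens])
  have pc: "pos_open X V \<in> carrier ?C" if "openin (pos_top X) V" for V
    using frame_mapD(1)[OF l, of V] that by (simp add: carrier_opens)
  have nc: "neg_open X V \<in> carrier ?C" if "openin (neg_top X) V" for V
    using frame_mapD(1)[OF r, of V] that by (simp add: carrier_opens)
  {
    assume l: ?l
    have "p Vp \<or> n Vm" if o: "openin (pos_top X) Up" "openin (pos_top X) Vp"
        "openin (neg_top X) Um" "openin (neg_top X) Vm"
      and sub: "Up \<inter> Um \<subseteq> Vp \<union> Vm" and "p Up" "n Um" for Up Um Vp Vm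
    proof -
      have "?q (pos_open X Up \<sqinter>\<^bsub>?C\<^esub> neg_open X Um)
          \<sqsubseteq>\<^bsub>?F\<^esub> ?q (pos_open X Vp \<squnion>\<^bsub>?C\<^esub> neg_open X Vm)"
        using o sub by (intro quotient_map_rel[OF frC Omega_fin_rel_carrier])
          (auto simp: Omega_fin_rel_def)
      then have "?q (pos_open X Up) \<sqinter>\<^bsub>?F\<^esub> ?q (neg_open X Um)
          \<sqsubseteq>\<^bsub>?F\<^esub> ?q (pos_open X Vp) \<squnion>\<^bsub>?F\<^esub> ?q (neg_open X Vm)"
        using frame_mapD(3)[OF q pc[OF o(1)] nc[OF o(3)]]
          frame_mapD(4)[OF q, of "{pos_open X Vp, neg_open X Vm}"] pc[OF o(2)] nc[OF o(4)]
        by (simp add: join_def)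
      then show ?thesis
        using l that biframe.bpt_points_iff[OF biframe_bOmega_fin, of p n]
        by (simp add: bOmega_fin_def carrier_opens)
    qed
    then show ?r
      using l biframe.bpt_points_iff[OF biframe_bOmega_fin, of p n]
      by (auto simp: bOmega_fin_def carrier_opens)
  next
    assume rr: ?r
    then have p: "frame_map (opens (pos_top X)) two p" and n: "frame_map (opens (neg_top X)) two n"
      by auto
    note U = coproduct_universal[OF frame_opens frame_opens frame_two p n,
        folded opens_coproduct_def pos_open_def neg_open_def]
    let ?h = "copair two p n"
    have hp: "?h (pos_open X V) = p V" if "openin (pos_top X) V" for V
      using U(2)[of V] that by (simp add: carrier_opens pos_open_def)
    have hn: "?h (neg_open X V) = n V" if "openin (neg_top X) V" for V
      using U(3)[of V] that by (simp add: carrier_opens neg_open_def)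
    have "?h a \<sqsubseteq>\<^bsub>two\<^esub> ?h b" if R: "(a, b) \<in> ?R" for a b
    proof -
      obtain Up Um Vp Vm where ab: "a = pos_open X Up \<sqinter>\<^bsub>?C\<^esub> neg_open X Um"
        "b = pos_open X Vp \<squnion>\<^bsub>?C\<^esub> neg_open X Vm"
        and o: "openin (pos_top X) Up" "openin (pos_top X) Vp"
          "openin (neg_top X) Um" "openin (neg_top X) Vm" and sub: "Up \<inter> Um \<subseteq> Vp \<union> Vm"
        using R unfolding Omega_fin_rel_def by blast
      have "?h a \<longleftrightarrow> p Up \<and> n Um"
        using frame_map_two_iff(2)[OF U(1) pc[OF o(1)] nc[OF o(3)]] hp[OF o(1)] hn[OF o(3)] ab(1)
        by simp
      moreover have "?h b \<longleftrightarrow> p Vp \<or> n Vm"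
        using frame_map_two_iff(3)[OF U(1), of "{pos_open X Vp, neg_open X Vm}"] pc[OF o(2)]
          nc[OF o(4)] hp[OF o(2)] hn[OF o(4)] ab(2) by (simp add: join_def)
      ultimately show ?thesis using rr o sub by (simp add: two_def)
    qed
    from quotient_frame_universal(1)[OF frC Omega_fin_rel_carrier frame_two U(1) this]
    obtain g where "frame_map ?F two g" "\<And>a. a \<in> carrier ?C \<Longrightarrow> g (?q a) = ?h a" by blast
    then have "biframe_map (bOmega_fin X) two_biframe p n"
      unfolding biframe_map_def using p n
      by (auto simp: bOmega_fin_def two_biframe_def carrier_opens pc nc hp hn)
    then show ?l using rr by (auto simp: bpt_points_def bOmega_fin_def carrier_opens)
  }
qed

text \<open>Every open set of this spectrum is the set of points accepting some open
  \<open>U\<close> of \<open>X\<close>, and the neighbourhood map pulls that set back to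
  \<open>U\<close>. A bijective neighbourhood map is therefore automatically continuous and open for
  both topologies.\<close>

lemma bisober_iff_bij:
  "bisober X \<longleftrightarrow> bij_betw (neighbourhood_map X) (points X) (bpt_points (bOmega_fin X))"
proof
  let ?B = "bOmega_fin X" and ?e = "neighbourhood_map X"
  have fr: "frame (pos_part ?B)" "frame (neg_part ?B)"
    by (simp_all add: bOmega_fin_def frame_opens)
  have sp: "topspace (pos_top X) = points X" "topspace (neg_top X) = points X"
    using same_points by (simp_all add: points_def)
  {
    assume "bisober X"
    then have h: "homeomorphic_map (pos_top X) (pos_top (bpt ?B)) ?e"
      by (simp add: bisober_def bihomeomorphism_def)
    show "bij_betw ?e (points X) (bpt_points ?B)"
      using homeomorphic_imp_injective_map[OF h] homeomorphic_imp_surjective_map[OF h]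
      by (simp add: bij_betw_def topspace_bpt[OF fr] sp)
  next
    assume bij: "bij_betw ?e (points X) (bpt_points ?B)"
    \<comment> \<open>Both topologies are treated at once: \<open>k\<close> is \<open>fst\<close> or
      \<open>snd\<close>, the evaluation of a point at an open set of \<open>T\<close>.\<close>
    have gen: "homeomorphic_map T T' ?e"
      if T: "topspace T = points X" and T': "topspace T' = bpt_points ?B"
        and op: "\<And>W. openin T' W \<longleftrightarrow> (\<exists>U. openin T U \<and> W = {f \<in> bpt_points ?B. k f U})"
        and k: "\<And>x U. openin T U \<Longrightarrow> x \<in> points X \<Longrightarrow> k (?e x) U \<longleftrightarrow> x \<in> U"
      for T :: "'x topology" and T' and k :: "('x set \<Rightarrow> bool) \<times> ('x set \<Rightarrow> bool) \<Rightarrow> 'x set \<Rightarrow> bool"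
    proof -
      have im: "?e ` U = {f \<in> bpt_points ?B. k f U}" if U: "openin T U" for U
      proof -
        have "U \<subseteq> points X" using openin_subset[OF U] T by simp
        moreover have "bpt_points ?B = ?e ` points X" using bij by (simp add: bij_betw_def)
        ultimately show ?thesis using k[OF U] by auto
      qed
      have "open_map T T' ?e"
        unfolding open_map_def
      proof (intro allI impI)
        fix U assume "openin T U"
        then show "openin T' (?e ` U)" unfolding op by (intro exI[of _ U] conjI im)
      qed
      moreover have "continuous_map T T' ?e"
        unfolding continuous_map_def
      proof (intro conjI allI impI)
        show "?e \<in> topspace T \<rightarrow> topspace T'" using bij T T' by (auto simp: bij_betw_def)
        fix W assume "openin T' W"
        then obtain U where U: "openin T U" "W = {f \<in> bpt_points ?B. k f U}" unfolding op by blast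
        have "{x \<in> topspace T. ?e x \<in> W} = U"
          using U(2) k[OF U(1)] T openin_subset[OF U(1)] bij_betwE[OF bij] by auto
        then show "openin T {x \<in> topspace T. ?e x \<in> W}" using U(1) by simp
      qed
      ultimately show ?thesis
        using bij T T' by (intro bijective_open_imp_homeomorphic_map) (auto simp: bij_betw_def)
    qed
    have "homeomorphic_map (pos_top X) (pos_top (bpt ?B)) ?e"
    proof (rule gen[of _ _ fst])
      show "openin (pos_top (bpt ?B)) W \<longleftrightarrow>
          (\<exists>U. openin (pos_top X) U \<and> W = {f \<in> bpt_points ?B. fst f U})" for W
        unfolding openin_bpt(1)[OF fr] by (auto simp: bOmega_fin_def carrier_opens)
    qed (simp_all add: sp topspace_bpt[OF fr] neighbourhood_map_def)
    moreover have "homeomorphic_map (neg_top X) (neg_top (bpt ?B)) ?e"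
    proof (rule gen[of _ _ snd])
      show "openin (neg_top (bpt ?B)) W \<longleftrightarrow>
          (\<exists>U. openin (neg_top X) U \<and> W = {f \<in> bpt_points ?B. snd f U})" for W
        unfolding openin_bpt(2)[OF fr] by (auto simp: bOmega_fin_def carrier_opens)
    qed (simp_all add: sp topspace_bpt[OF fr] neighbourhood_map_def)
    ultimately show "bisober X" by (simp add: bisober_def bihomeomorphism_def)
  }
qed

lemma neighbourhood_map_in: "x \<in> points X \<Longrightarrow> neighbourhood_map X x \<in> bpt_points (bOmega_fin X)"
proof -
  assume x: "x \<in> points X"
  have gen: "frame_map (opens T) two (\<lambda>U\<in>{U. openin T U}. x \<in> U)"
    if T: "topspace T = points X" for T :: "'x topology"
  proof (rule frame_mapI[OF frame_opens frame_two])
    show "(\<lambda>U\<in>{U. openin T U}. x \<in> U) \<top>\<^bsub>opens T\<^esub> = \<top>\<^bsub>two\<^esub>"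
      using x T openin_topspace[of T] by (simp add: top_opens top_two)
    show "(\<lambda>U\<in>{U. openin T U}. x \<in> U) (U \<sqinter>\<^bsub>opens T\<^esub> V) =
        (\<lambda>U\<in>{U. openin T U}. x \<in> U) U \<sqinter>\<^bsub>two\<^esub> (\<lambda>U\<in>{U. openin T U}. x \<in> U) V"
      if "U \<in> carrier (opens T)" "V \<in> carrier (opens T)" for U V
      using that by (simp add: carrier_opens meet_opens meet_two openin_Int)
    show "(\<lambda>U\<in>{U. openin T U}. x \<in> U) (\<Squnion>\<^bsub>opens T\<^esub>A) =
        \<Squnion>\<^bsub>two\<^esub>((\<lambda>U\<in>{U. openin T U}. x \<in> U) ` A)" if A: "A \<subseteq> carrier (opens T)" for A
    proof -
      have A': "A \<subseteq> {U. openin T U}" using A by (simp add: carrier_opens)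
      then have "openin T (\<Union>A)" by (intro openin_Union) auto
      moreover have "(\<lambda>U\<in>{U. openin T U}. x \<in> U) ` A = (\<lambda>U. x \<in> U) ` A"
        using A' by (intro image_cong) auto
      ultimately show ?thesis unfolding Sup_opens[OF A'] Sup_two by auto
    qed
  qed (simp add: two_def)
  have sp: "topspace (pos_top X) = points X" "topspace (neg_top X) = points X"
    using same_points by (simp_all add: points_def)
  show ?thesis
    unfolding neighbourhood_map_def bpt_points_bOmega_fin_iff
  proof (intro conjI allI impI restrict_extensional gen sp)
    fix Up Um Vp Vm assume o: "openin (pos_top X) Up" "openin (pos_top X) Vp"
      "openin (neg_top X) Um" "openin (neg_top X) Vm" and sub: "Up \<inter> Um \<subseteq> Vp \<union> Vm"
    assume "(\<lambda>U\<in>{U. openin (pos_top X) U}. x \<in> U) Up" "(\<lambda>U\<in>{U. openin (neg_top X) U}. x \<in> U) Um"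
    then have "x \<in> Vp \<union> Vm" using o sub by auto
    then show "(\<lambda>U\<in>{U. openin (pos_top X) U}. x \<in> U) Vp \<or> (\<lambda>U\<in>{U. openin (neg_top X) U}. x \<in> U) Vm"
      using o by simp
  qed
qed

end


section \<open>Bisober bisubspaces are the Skula closed ones\<close>

text \<open>Each outside point has a basic Skula neighbourhood missing \<open>S\<close>. The
  emptiness of the intersection is written as an inclusion so that it has the shape of the pairs in
  \<open>Omega_fin_rel\<close>.\<close>

definition skula_closed :: "'x bispace \<Rightarrow> 'x set \<Rightarrow> bool" where
  "skula_closed X S \<longleftrightarrow> S \<subseteq> points X \<and>
     (\<forall>x\<in>points X - S. \<exists>Up Vp Um Vm.
        openin (pos_top X) Up \<and> openin (pos_top X) Vp \<and>
        openin (neg_top X) Um \<and> openin (neg_top X) Vm \<and>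
        x \<in> Up \<inter> Um \<inter> (points X - Vp) \<inter> (points X - Vm) \<and> S \<inter> Up \<inter> Um \<subseteq> Vp \<union> Vm)"

text \<open>Since each \<open>e g\<close> is a frame map, sending \<open>a\<close> to its trace
  \<open>{g \<in> S. e g a}\<close> preserves tops, binary meets and joins; the lemma composes
  \<open>q\<close> with this map. The evaluation \<open>e\<close> is kept abstract so that one proof
  serves both components.\<close>

lemma frame_map_two_trace:
  assumes K: "frame K" and T: "\<And>U. openin T U \<longleftrightarrow> (\<exists>a\<in>carrier K. U = {g \<in> S. e g a})"
    and e: "\<And>g. g \<in> S \<Longrightarrow> frame_map K two (e g)"
    and q: "frame_map (opens T) two q"
  shows "frame_map K two (\<lambda>a\<in>carrier K. q {g \<in> S. e g a})"
proof -
  interpret K: frame K by (rule K)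
  note I = frame_map_two_iff[OF e] and qI = frame_map_two_iff[OF q]
  have o: "openin T {g \<in> S. e g a}" if "a \<in> carrier K" for a using T that by blast
  show ?thesis
  proof (rule frame_mapI[OF K frame_two])
    have "{g \<in> S. e g \<top>\<^bsub>K\<^esub>} = topspace T"
    proof
      show "{g \<in> S. e g \<top>\<^bsub>K\<^esub>} \<subseteq> topspace T" using openin_subset[OF o[OF K.top_closed]] .
      have "topspace T \<subseteq> S" using T[of "topspace T"] by auto
      then show "topspace T \<subseteq> {g \<in> S. e g \<top>\<^bsub>K\<^esub>}" using I(1) by auto
    qed
    then show "(\<lambda>a\<in>carrier K. q {g \<in> S. e g a}) \<top>\<^bsub>K\<^esub> = \<top>\<^bsub>two\<^esub>"
      using qI(1) by (simp add: top_opens top_two)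
  next
    fix x y assume c: "x \<in> carrier K" "y \<in> carrier K"
    have "{g \<in> S. e g (x \<sqinter>\<^bsub>K\<^esub> y)} = {g \<in> S. e g x} \<sqinter>\<^bsub>opens T\<^esub> {g \<in> S. e g y}"
      using I(2) c by (auto simp: meet_opens o)
    then show "(\<lambda>a\<in>carrier K. q {g \<in> S. e g a}) (x \<sqinter>\<^bsub>K\<^esub> y) =
        (\<lambda>a\<in>carrier K. q {g \<in> S. e g a}) x \<sqinter>\<^bsub>two\<^esub> (\<lambda>a\<in>carrier K. q {g \<in> S. e g a}) y"
      using qI(2) c o by (simp add: carrier_opens meet_two)
  next
    fix A assume A: "A \<subseteq> carrier K"
    let ?\<A> = "(\<lambda>a. {g \<in> S. e g a}) ` A"
    have s: "?\<A> \<subseteq> {U. openin T U}" using o A by auto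
    have "{g \<in> S. e g (\<Squnion>\<^bsub>K\<^esub>A)} = \<Squnion>\<^bsub>opens T\<^esub>?\<A>"
      unfolding Sup_opens[OF s] using I(3)[OF _ A] by auto
    then have "q {g \<in> S. e g (\<Squnion>\<^bsub>K\<^esub>A)} \<longleftrightarrow> (\<exists>a\<in>A. q {g \<in> S. e g a})"
      using qI(3)[of ?\<A>] s by (simp add: carrier_opens)
    then show "(\<lambda>a\<in>carrier K. q {g \<in> S. e g a}) (\<Squnion>\<^bsub>K\<^esub>A) =
        \<Squnion>\<^bsub>two\<^esub>((\<lambda>a\<in>carrier K. q {g \<in> S. e g a}) ` A)"
      using A by (auto simp: Sup_two image_iff subset_eq)
  qed (simp add: two_def)
qed

text \<open>The converse of \<open>frame_map_two_trace\<close>: the trace map from \<open>K\<close>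
  onto the opens of \<open>T\<close> is surjective, and \<open>r\<close> factors through it once it
  respects inclusion of traces. That is the content of \<open>wd\<close>.\<close>

lemma frame_map_two_extend:
  assumes K: "frame K" and T: "\<And>U. openin T U \<longleftrightarrow> (\<exists>a\<in>carrier K. U = {g \<in> S. e g a})"
    and e: "\<And>g. g \<in> S \<Longrightarrow> frame_map K two (e g)"
    and r: "frame_map K two r"
    and wd: "\<And>a b. \<lbrakk>a \<in> carrier K; b \<in> carrier K; {g \<in> S. e g a} \<subseteq> {g \<in> S. e g b}; r a\<rbrakk> \<Longrightarrow> r b"
  obtains q where "frame_map (opens T) two q" "q \<in> extensional {U. openin T U}"
    "\<And>a. a \<in> carrier K \<Longrightarrow> q {g \<in> S. e g a} \<longleftrightarrow> r a"
proof
  let ?q = "\<lambda>U\<in>{U. openin T U}. \<exists>a\<in>carrier K. U = {g \<in> S. e g a} \<and> r a"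
  interpret K: frame K by (rule K)
  note I = frame_map_two_iff[OF e] and rI = frame_map_two_iff[OF r]
  have o: "openin T {g \<in> S. e g a}" if "a \<in> carrier K" for a using T that by blast
  \<comment> \<open>An open set may be the trace of many elements; \<open>wd\<close> shows that
    \<open>r\<close> gives all of them the same value.\<close>
  show q: "?q {g \<in> S. e g a} \<longleftrightarrow> r a" if "a \<in> carrier K" for a
    using wd that o[OF that] by auto
  show "frame_map (opens T) two ?q"
  proof (rule frame_mapI[OF frame_opens frame_two])
    have "{g \<in> S. e g \<top>\<^bsub>K\<^esub>} = topspace T"
    proof
      show "{g \<in> S. e g \<top>\<^bsub>K\<^esub>} \<subseteq> topspace T" using openin_subset[OF o[OF K.top_closed]] .
      have "topspace T \<subseteq> S" using T[of "topspace T"] by auto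
      then show "topspace T \<subseteq> {g \<in> S. e g \<top>\<^bsub>K\<^esub>}" using I(1) by auto
    qed
    then show "?q \<top>\<^bsub>opens T\<^esub> = \<top>\<^bsub>two\<^esub>"
      using q[OF K.top_closed] rI(1) by (simp only: top_opens top_two)
  next
    fix U V assume "U \<in> carrier (opens T)" "V \<in> carrier (opens T)"
    then obtain x y where xy: "x \<in> carrier K" "y \<in> carrier K"
      "U = {g \<in> S. e g x}" "V = {g \<in> S. e g y}" using T by (auto simp: carrier_opens)
    have "U \<sqinter>\<^bsub>opens T\<^esub> V = {g \<in> S. e g (x \<sqinter>\<^bsub>K\<^esub> y)}"
      using I(2) xy by (auto simp: meet_opens o)
    then show "?q (U \<sqinter>\<^bsub>opens T\<^esub> V) = ?q U \<sqinter>\<^bsub>two\<^esub> ?q V"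
      using q[OF xy(1)] q[OF xy(2)] q[OF K.meet_closed[OF xy(1,2)]] rI(2)[OF xy(1,2)]
      by (simp only: meet_two xy)
  next
    fix \<A> assume A: "\<A> \<subseteq> carrier (opens T)"
    \<comment> \<open>All elements whose trace lies in the family are collected, so no
      representatives have to be chosen.\<close>
    define A where "A = {a \<in> carrier K. {g \<in> S. e g a} \<in> \<A>}"
    have Ac: "A \<subseteq> carrier K" by (auto simp: A_def)
    have im: "\<A> = (\<lambda>a. {g \<in> S. e g a}) ` A"
      using A T unfolding A_def carrier_opens by (auto simp: subset_eq image_iff)
    have s: "\<A> \<subseteq> {U. openin T U}" using A by (simp add: carrier_opens)
    have "\<Squnion>\<^bsub>opens T\<^esub>\<A> = {g \<in> S. e g (\<Squnion>\<^bsub>K\<^esub>A)}"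
      unfolding Sup_opens[OF s] using I(3)[OF _ Ac] im by auto
    then have "?q (\<Squnion>\<^bsub>opens T\<^esub>\<A>) \<longleftrightarrow> (\<exists>a\<in>A. r a)"
      using q[of "\<Squnion>\<^bsub>K\<^esub>A"] rI(3)[OF Ac] Ac K.sup_closed by (simp only:)
    also have "\<dots> \<longleftrightarrow> (\<exists>U\<in>\<A>. ?q U)"
      unfolding im using q Ac by (simp only: bex_simps(7)) blast
    finally show "?q (\<Squnion>\<^bsub>opens T\<^esub>\<A>) = \<Squnion>\<^bsub>two\<^esub>(?q ` \<A>)"
      unfolding Sup_two by blast
  qed (simp add: two_def)
  show "?q \<in> extensional {U. openin T U}" by simp
qed

section \<open>Bisubspaces of the spectrum of a biframe\<close>

context biframe
begin

lemma points_bisubspace: "S \<subseteq> bpt_points L \<Longrightarrow> points (bisubspace (bpt L) S) = S"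
  by (auto simp: points_def bisubspace_def topspace_bpt frame_pos frame_neg)

lemma openin_bisubspace:
  assumes "S \<subseteq> bpt_points L"
  shows "openin (pos_top (bisubspace (bpt L) S)) U
      \<longleftrightarrow> (\<exists>a\<in>carrier (pos_part L). U = {g \<in> S. fst g a})"
    and "openin (neg_top (bisubspace (bpt L) S)) U
      \<longleftrightarrow> (\<exists>a\<in>carrier (neg_part L). U = {g \<in> S. snd g a})"
proof -
  have trace: "(\<exists>T. (\<exists>a\<in>A. T = {f \<in> bpt_points L. k f a}) \<and> U = T \<inter> S)
      \<longleftrightarrow> (\<exists>a\<in>A. U = {g \<in> S. k g a})" for A :: "'z set" and k
  proof -
    have "{f \<in> bpt_points L. k f a} \<inter> S = {g \<in> S. k g a}" for a using assms by auto
    moreover have "(\<exists>T. (\<exists>a\<in>A. T = {f \<in> bpt_points L. k f a}) \<and> U = T \<inter> S)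
      \<longleftrightarrow> (\<exists>a\<in>A. U = {f \<in> bpt_points L. k f a} \<inter> S)" by blast
    ultimately show ?thesis by simp
  qed
  show "openin (pos_top (bisubspace (bpt L) S)) U
      \<longleftrightarrow> (\<exists>a\<in>carrier (pos_part L). U = {g \<in> S. fst g a})"
    unfolding bisubspace_def bispace.simps openin_subtopology openin_bpt(1)[OF frame_pos frame_neg]
    by (rule trace)
  show "openin (neg_top (bisubspace (bpt L) S)) U
      \<longleftrightarrow> (\<exists>a\<in>carrier (neg_part L). U = {g \<in> S. snd g a})"
    unfolding bisubspace_def bispace.simps openin_subtopology openin_bpt(2)[OF frame_pos frame_neg]
    by (rule trace)
qed

text \<open>Once the opens of the bisubspace are indexed by elements of \<open>L\<close>, the
  neighbourhood map at \<open>g\<close> returns the values of \<open>g\<close>. Equal neighbourhood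
  maps therefore come from equal points.\<close>

lemma neighbourhood_map_bisubspace:
  assumes S: "S \<subseteq> bpt_points L" and g: "g \<in> S"
  shows "a \<in> carrier (pos_part L) \<Longrightarrow>
      fst (neighbourhood_map (bisubspace (bpt L) S) g) {h \<in> S. fst h a} \<longleftrightarrow> fst g a"
    and "b \<in> carrier (neg_part L) \<Longrightarrow>
      snd (neighbourhood_map (bisubspace (bpt L) S) g) {h \<in> S. snd h b} \<longleftrightarrow> snd g b"
proof -
  assume "a \<in> carrier (pos_part L)"
  then have "openin (pos_top (bisubspace (bpt L) S)) {h \<in> S. fst h a}"
    unfolding openin_bisubspace[OF S] by blast
  then show "fst (neighbourhood_map (bisubspace (bpt L) S) g) {h \<in> S. fst h a} \<longleftrightarrow> fst g a"
    using g by (simp add: neighbourhood_map_def)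
next
  assume "b \<in> carrier (neg_part L)"
  then have "openin (neg_top (bisubspace (bpt L) S)) {h \<in> S. snd h b}"
    unfolding openin_bisubspace[OF S] by blast
  then show "snd (neighbourhood_map (bisubspace (bpt L) S) g) {h \<in> S. snd h b} \<longleftrightarrow> snd g b"
    using g by (simp add: neighbourhood_map_def)
qed

text \<open>The quadruple excluding \<open>f\<close> is a failure, at \<open>f\<close>, of the
  four-element condition of \<open>bpt_points_iff\<close> with the order of \<open>L\<close>
  replaced by inclusion of traces on \<open>S\<close>.\<close>

lemma skula_closed_bpt_iff:
  "skula_closed (bpt L) S \<longleftrightarrow> S \<subseteq> bpt_points L \<and>
     (\<forall>f\<in>bpt_points L - S.
        \<exists>x\<in>carrier (pos_part L). \<exists>u\<in>carrier (pos_part L).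
        \<exists>y\<in>carrier (neg_part L). \<exists>v\<in>carrier (neg_part L).
          fst f x \<and> snd f y \<and> \<not> fst f u \<and> \<not> snd f v \<and>
          (\<forall>g\<in>S. fst g x \<longrightarrow> snd g y \<longrightarrow> fst g u \<or> snd g v))"
    (is "_ \<longleftrightarrow> ?r")
proof
  note simps = points_bpt[OF biframe_axioms] openin_bpt[OF frame_pos frame_neg]
  assume c: "skula_closed (bpt L) S"
  then have S: "S \<subseteq> bpt_points L" by (simp add: skula_closed_def simps)
  have "\<exists>x\<in>carrier (pos_part L). \<exists>u\<in>carrier (pos_part L).
        \<exists>y\<in>carrier (neg_part L). \<exists>v\<in>carrier (neg_part L).
          fst f x \<and> snd f y \<and> \<not> fst f u \<and> \<not> snd f v \<and>
          (\<forall>g\<in>S. fst g x \<longrightarrow> snd g y \<longrightarrow> fst g u \<or> snd g v)" if f: "f \<in> bpt_points L - S" for f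
  proof -
    obtain Up Vp Um Vm where o: "openin (pos_top (bpt L)) Up" "openin (pos_top (bpt L)) Vp"
        "openin (neg_top (bpt L)) Um" "openin (neg_top (bpt L)) Vm"
      and i: "f \<in> Up \<inter> Um \<inter> (points (bpt L) - Vp) \<inter> (points (bpt L) - Vm)"
      and sub: "S \<inter> Up \<inter> Um \<subseteq> Vp \<union> Vm"
      using c f unfolding skula_closed_def simps(1) by blast
    obtain x where x: "x \<in> carrier (pos_part L)" "Up = {f \<in> bpt_points L. fst f x}"
      using o(1) unfolding simps by blast
    obtain u where u: "u \<in> carrier (pos_part L)" "Vp = {f \<in> bpt_points L. fst f u}"
      using o(2) unfolding simps by blast
    obtain y where y: "y \<in> carrier (neg_part L)" "Um = {f \<in> bpt_points L. snd f y}"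
      using o(3) unfolding simps by blast
    obtain v where v: "v \<in> carrier (neg_part L)" "Vm = {f \<in> bpt_points L. snd f v}"
      using o(4) unfolding simps by blast
    have "\<forall>g\<in>S. fst g x \<longrightarrow> snd g y \<longrightarrow> fst g u \<or> snd g v"
      using sub S unfolding x(2) u(2) y(2) v(2) by blast
    moreover have "fst f x" "snd f y" "\<not> fst f u" "\<not> snd f v"
      using i f unfolding x(2) u(2) y(2) v(2) by auto
    ultimately show ?thesis using x(1) u(1) y(1) v(1) by blast
  qed
  then show ?r using S by blast
next
  note simps = points_bpt[OF biframe_axioms] openin_bpt[OF frame_pos frame_neg]
  assume r: ?r
  show "skula_closed (bpt L) S"
    unfolding skula_closed_def simps
  proof (intro conjI ballI)
    fix f assume f: "f \<in> bpt_points L - S"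
    then obtain x u y v where "x \<in> carrier (pos_part L)" "u \<in> carrier (pos_part L)"
        "y \<in> carrier (neg_part L)" "v \<in> carrier (neg_part L)"
      "fst f x \<and> snd f y \<and> \<not> fst f u \<and> \<not> snd f v \<and>
          (\<forall>g\<in>S. fst g x \<longrightarrow> snd g y \<longrightarrow> fst g u \<or> snd g v)"
      using r by meson
    then show "\<exists>Up Vp Um Vm.
        (\<exists>a\<in>carrier (pos_part L). Up = {f \<in> bpt_points L. fst f a}) \<and>
        (\<exists>a\<in>carrier (pos_part L). Vp = {f \<in> bpt_points L. fst f a}) \<and>
        (\<exists>a\<in>carrier (neg_part L). Um = {f \<in> bpt_points L. snd f a}) \<and>
        (\<exists>a\<in>carrier (neg_part L). Vm = {f \<in> bpt_points L. snd f a}) \<and>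
        f \<in> Up \<inter> Um \<inter> (bpt_points L - Vp) \<inter> (bpt_points L - Vm) \<and> S \<inter> Up \<inter> Um \<subseteq> Vp \<union> Vm"
      using f by (intro exI[of _ "{f \<in> bpt_points L. fst f x}"] exI[of _ "{f \<in> bpt_points L. fst f u}"]
          exI[of _ "{f \<in> bpt_points L. snd f y}"] exI[of _ "{f \<in> bpt_points L. snd f v}"]) auto
  qed (use r in blast)
qed

text \<open>A point \<open>f\<close> of the Skula closure outside \<open>S\<close> still assigns
  consistent values to the traces on \<open>S\<close>, so it induces a point of the biframe of opens
  of \<open>S\<close>. Bisobriety would realise that point by some \<open>f'\<close> in
  \<open>S\<close>, which then has the same values as \<open>f\<close> and equals it.\<close>

lemma skula_closed_if_bisober:
  assumes S: "S \<subseteq> bpt_points L" and bs: "bisober (bisubspace (bpt L) S)"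
  shows "skula_closed (bpt L) S"
proof (rule ccontr)
  let ?X = "bisubspace (bpt L) S"
  let ?P = "pos_part L" and ?N = "neg_part L"
  interpret P: frame ?P by (rule frame_pos)
  interpret N: frame ?N by (rule frame_neg)
  interpret X: bispace ?X by (rule bispace_bisubspace[OF bispace_bpt[OF biframe_axioms]])
  note op = openin_bisubspace[OF S]
  assume "\<not> skula_closed (bpt L) S"
  \<comment> \<open>The condition \<open>cl\<close> negates the existence of a separating quadruple:
    \<open>f\<close> lies in the Skula closure of \<open>S\<close>.\<close>
  then obtain f where f: "f \<in> bpt_points L" "f \<notin> S"
    and cl: "\<And>x u y v. \<lbrakk>x \<in> carrier ?P; u \<in> carrier ?P; y \<in> carrier ?N; v \<in> carrier ?N;
        \<forall>g\<in>S. fst g x \<longrightarrow> snd g y \<longrightarrow> fst g u \<or> snd g v; fst f x; snd f y\<rbrakk>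
      \<Longrightarrow> fst f u \<or> snd f v"
    using S unfolding skula_closed_bpt_iff by blast
  note pf = bpt_pointsD(1) and nf = bpt_pointsD(2)
  note pI = frame_map_two_iff[OF pf] and nI = frame_map_two_iff[OF nf]
  have nbot: "\<not> snd g \<bottom>\<^bsub>?N\<^esub>" if "g \<in> bpt_points L" for g
    using nI(3)[OF that, of "{}"] N.Sup_empty by simp
  have pbot: "\<not> fst g \<bottom>\<^bsub>?P\<^esub>" if "g \<in> bpt_points L" for g
    using pI(3)[OF that, of "{}"] P.Sup_empty by simp
  obtain q where q: "frame_map (opens (pos_top ?X)) two q" "q \<in> extensional {U. openin (pos_top ?X) U}"
    "\<And>a. a \<in> carrier ?P \<Longrightarrow> q {g \<in> S. fst g a} \<longleftrightarrow> fst f a"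
  proof (rule frame_map_two_extend[OF frame_pos op(1) _ pf[OF f(1)]])
    \<comment> \<open>An inclusion of positive traces is the case of \<open>cl\<close> whose
      negative slots hold top, which \<open>f\<close> accepts, and bottom, which \<open>f\<close>
      rejects.\<close>
    show "fst f b" if "a \<in> carrier ?P" "b \<in> carrier ?P"
      "{g \<in> S. fst g a} \<subseteq> {g \<in> S. fst g b}" "fst f a" for a b
      using cl[OF that(1,2) N.top_closed N.bottom_closed _ that(4) nI(1)[OF f(1)]] that(3)
        nbot[OF f(1)] by blast
  qed (use pf S that in blast)+
  obtain r where r: "frame_map (opens (neg_top ?X)) two r" "r \<in> extensional {U. openin (neg_top ?X) U}"
    "\<And>a. a \<in> carrier ?N \<Longrightarrow> r {g \<in> S. snd g a} \<longleftrightarrow> snd f a"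
  proof (rule frame_map_two_extend[OF frame_neg op(2) _ nf[OF f(1)]])
    show "snd f b" if "a \<in> carrier ?N" "b \<in> carrier ?N"
      "{g \<in> S. snd g a} \<subseteq> {g \<in> S. snd g b}" "snd f a" for a b
      using cl[OF P.top_closed P.bottom_closed that(1,2) _ pI(1)[OF f(1)] that(4)] that(3)
        pbot[OF f(1)] by blast
  qed (use nf S that in blast)+
  have "(q, r) \<in> bpt_points (bOmega_fin ?X)"
    unfolding X.bpt_points_bOmega_fin_iff
  proof (intro conjI allI impI)
    fix Up Um Vp Vm assume "openin (pos_top ?X) Up" "openin (pos_top ?X) Vp"
      "openin (neg_top ?X) Um" "openin (neg_top ?X) Vm"
    then obtain x u y v where c: "x \<in> carrier ?P" "u \<in> carrier ?P" "y \<in> carrier ?N" "v \<in> carrier ?N"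
      and eq: "Up = {g \<in> S. fst g x}" "Vp = {g \<in> S. fst g u}"
        "Um = {g \<in> S. snd g y}" "Vm = {g \<in> S. snd g v}"
      unfolding op by blast
    assume "Up \<inter> Um \<subseteq> Vp \<union> Vm" "q Up" "r Um"
    then show "q Vp \<or> r Vm" using cl[OF c] q(3) r(3) c unfolding eq by blast
  qed (use q r in auto)
  moreover have "neighbourhood_map ?X ` S = bpt_points (bOmega_fin ?X)"
    using bs unfolding X.bisober_iff_bij points_bisubspace[OF S] bij_betw_def ..
  ultimately have "(q, r) \<in> neighbourhood_map ?X ` S" by simp
  then obtain f' where f': "f' \<in> S" "neighbourhood_map ?X f' = (q, r)" by (elim imageE) simp
  have "fst f' a = fst f a" if "a \<in> carrier ?P" for a
    using q(3)[OF that] neighbourhood_map_bisubspace(1)[OF S f'(1) that] f'(2) by simp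
  moreover have "snd f' a = snd f a" if "a \<in> carrier ?N" for a
    using r(3)[OF that] neighbourhood_map_bisubspace(2)[OF S f'(1) that] f'(2) by simp
  ultimately have "f' = f" using f' f(1) S by (intro bpt_points_eqI) auto
  then show False using f f' by blast
qed

text \<open>Injectivity holds for every \<open>S\<close> by evaluation. For surjectivity, a point
  \<open>(q, r)\<close> of the biframe of opens is pulled back along traces to a point
  \<open>(p, n)\<close> of \<open>L\<close>. No basic Skula neighbourhood separates
  \<open>(p, n)\<close> from \<open>S\<close>, so closedness puts it in \<open>S\<close>, and its
  neighbourhood map is \<open>(q, r)\<close>.\<close>

lemma bisober_if_skula_closed:
  assumes cl: "skula_closed (bpt L) S"
  shows "bisober (bisubspace (bpt L) S)"
proof -
  let ?X = "bisubspace (bpt L) S"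
  let ?P = "pos_part L" and ?N = "neg_part L" and ?M = "main_part L"
  have S: "S \<subseteq> bpt_points L" using cl unfolding skula_closed_bpt_iff by blast
  interpret X: bispace ?X by (rule bispace_bisubspace[OF bispace_bpt[OF biframe_axioms]])
  note op = openin_bisubspace[OF S]
  note nbhd = neighbourhood_map_bisubspace(1)[OF S] and nbhd' = neighbourhood_map_bisubspace(2)[OF S]
  have inj: "inj_on (neighbourhood_map ?X) S"
  proof (rule inj_onI)
    fix f g assume fg: "f \<in> S" "g \<in> S" "neighbourhood_map ?X f = neighbourhood_map ?X g"
    show "f = g"
    proof (rule bpt_points_eqI)
      show "fst f a = fst g a" if "a \<in> carrier ?P" for a
        using nbhd[OF fg(1) that] nbhd[OF fg(2) that] fg(3) by simp
      show "snd f a = snd g a" if "a \<in> carrier ?N" for a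
        using nbhd'[OF fg(1) that] nbhd'[OF fg(2) that] fg(3) by simp
    qed (use fg S in auto)
  qed
  have surj: "\<exists>f\<in>S. neighbourhood_map ?X f = (q, r)" if qr: "(q, r) \<in> bpt_points (bOmega_fin ?X)" for q r
  proof -
    have q: "frame_map (opens (pos_top ?X)) two q" "q \<in> extensional {U. openin (pos_top ?X) U}"
      and r: "frame_map (opens (neg_top ?X)) two r" "r \<in> extensional {U. openin (neg_top ?X) U}"
      and ok: "\<And>Up Um Vp Vm. \<lbrakk>openin (pos_top ?X) Up; openin (pos_top ?X) Vp;
        openin (neg_top ?X) Um; openin (neg_top ?X) Vm; Up \<inter> Um \<subseteq> Vp \<union> Vm; q Up; r Um\<rbrakk>
        \<Longrightarrow> q Vp \<or> r Vm"
      using qr unfolding X.bpt_points_bOmega_fin_iff by blast+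
    define p where "p = (\<lambda>a\<in>carrier ?P. q {g \<in> S. fst g a})"
    define n where "n = (\<lambda>a\<in>carrier ?N. r {g \<in> S. snd g a})"
    have p_fm: "frame_map ?P two p" unfolding p_def
      by (rule frame_map_two_trace[OF frame_pos op(1) _ q(1)]) (use S bpt_pointsD in blast)
    have n_fm: "frame_map ?N two n" unfolding n_def
      by (rule frame_map_two_trace[OF frame_neg op(2) _ r(1)]) (use S bpt_pointsD in blast)
    \<comment> \<open>The hypothesis is inclusion of traces on \<open>S\<close>, which is weaker
      than the inequality in \<open>L\<close>. The inequality version makes \<open>(p, n)\<close> a
      point of \<open>L\<close>; the trace version puts it in \<open>S\<close>.\<close>
    have ok': "p u \<or> n v" if c: "x \<in> carrier ?P" "u \<in> carrier ?P" "y \<in> carrier ?N" "v \<in> carrier ?N"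
      and le: "\<forall>g\<in>S. fst g x \<longrightarrow> snd g y \<longrightarrow> fst g u \<or> snd g v" and "p x" "n y" for x u y v
    proof -
      have "{g \<in> S. fst g x} \<inter> {g \<in> S. snd g y} \<subseteq> {g \<in> S. fst g u} \<union> {g \<in> S. snd g v}"
        using le by blast
      moreover have "openin (pos_top ?X) {g \<in> S. fst g x}" "openin (pos_top ?X) {g \<in> S. fst g u}"
        "openin (neg_top ?X) {g \<in> S. snd g y}" "openin (neg_top ?X) {g \<in> S. snd g v}"
        using c unfolding op by blast+
      ultimately show ?thesis using ok that by (simp add: p_def n_def)
    qed
    have f: "(p, n) \<in> bpt_points L"
      unfolding bpt_points_iff
    proof (intro conjI ballI impI)
      fix x u y v assume c: "x \<in> carrier ?P" "u \<in> carrier ?P" "y \<in> carrier ?N" "v \<in> carrier ?N"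
        and le: "pos_emb L x \<sqinter>\<^bsub>?M\<^esub> neg_emb L y \<sqsubseteq>\<^bsub>?M\<^esub> pos_emb L u \<squnion>\<^bsub>?M\<^esub> neg_emb L v"
        and pn: "p x" "n y"
      \<comment> \<open>Every \<open>g\<close> in \<open>S\<close> is itself a point of
        \<open>L\<close>, so an inequality in \<open>L\<close> implies the inclusion of
        traces.\<close>
      have "fst g u \<or> snd g v" if g: "g \<in> S" and "fst g x" "snd g y" for g
      proof -
        have "(fst g, snd g) \<in> bpt_points L" using g S by auto
        then show ?thesis using c le that unfolding bpt_points_iff by blast
      qed
      then show "p u \<or> n v" using ok'[OF c _ pn] by blast
    qed (use p_fm n_fm in \<open>auto simp: p_def n_def\<close>)
    have fS: "(p, n) \<in> S"
    proof (rule ccontr)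
      assume "(p, n) \<notin> S"
      then obtain x u y v where "x \<in> carrier ?P" "u \<in> carrier ?P" "y \<in> carrier ?N" "v \<in> carrier ?N"
        "p x" "n y" "\<not> p u" "\<not> n v" "\<forall>g\<in>S. fst g x \<longrightarrow> snd g y \<longrightarrow> fst g u \<or> snd g v"
        using conjunct2[OF cl[unfolded skula_closed_bpt_iff], rule_format, of "(p, n)"] f
        unfolding fst_conv snd_conv by blast
      then show False using ok' by blast
    qed
    have "neighbourhood_map ?X (p, n) = (q, r)"
    proof (rule prod_eqI; unfold fst_conv snd_conv)
      show "fst (neighbourhood_map ?X (p, n)) = q"
      proof (rule extensionalityI[OF _ q(2)])
        fix U assume "U \<in> {U. openin (pos_top ?X) U}"
        then obtain a where a: "a \<in> carrier ?P" "U = {g \<in> S. fst g a}" using op(1) by blast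
        show "fst (neighbourhood_map ?X (p, n)) U = q U"
          using nbhd[OF fS a(1)] a by (simp add: p_def)
      qed (simp add: neighbourhood_map_def)
      show "snd (neighbourhood_map ?X (p, n)) = r"
      proof (rule extensionalityI[OF _ r(2)])
        fix U assume "U \<in> {U. openin (neg_top ?X) U}"
        then obtain a where a: "a \<in> carrier ?N" "U = {g \<in> S. snd g a}" using op(2) by blast
        show "snd (neighbourhood_map ?X (p, n)) U = r U"
          using nbhd'[OF fS a(1)] a by (simp add: n_def)
      qed (simp add: neighbourhood_map_def)
    qed
    then show ?thesis using fS by blast
  qed
  have "neighbourhood_map ?X ` S = bpt_points (bOmega_fin ?X)"
  proof
    show "neighbourhood_map ?X ` S \<subseteq> bpt_points (bOmega_fin ?X)"
      using X.neighbourhood_map_in by (auto simp: points_bisubspace[OF S])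
    show "bpt_points (bOmega_fin ?X) \<subseteq> neighbourhood_map ?X ` S" using surj by force
  qed
  then show ?thesis using inj
    by (simp add: X.bisober_iff_bij bij_betw_def points_bisubspace[OF S])
qed

lemma bisober_bisubspaces_bpt: "bisober_bisubspaces (bpt L) = {S. skula_closed (bpt L) S}"
proof -
  have "S \<subseteq> bpt_points L" if "skula_closed (bpt L) S" for S
    using that by (simp add: skula_closed_def points_bpt[OF biframe_axioms])
  then show ?thesis
    using skula_closed_if_bisober bisober_if_skula_closed
    unfolding bisober_bisubspaces_def points_bpt[OF biframe_axioms] by blast
qed

text \<open>Two distinct points differ at some element \<open>a\<close> of an outer component. If
  \<open>g\<close> accepts \<open>a\<close>, it serves as \<open>x\<close> or \<open>y\<close>, and
  otherwise as \<open>u\<close> or \<open>v\<close>. Tops and bottoms fill the remaining slots, as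
  every point accepts top and rejects bottom.\<close>

lemma skula_closed_singleton:
  assumes f: "f \<in> bpt_points L"
  shows "skula_closed (bpt L) {f}"
  unfolding skula_closed_bpt_iff
proof (intro conjI ballI)
  fix g assume g: "g \<in> bpt_points L - {f}"
  interpret P: frame "pos_part L" by (rule frame_pos)
  interpret N: frame "neg_part L" by (rule frame_neg)
  have tb: "fst g \<top>\<^bsub>pos_part L\<^esub>" "snd g \<top>\<^bsub>neg_part L\<^esub>"
    "\<not> fst g \<bottom>\<^bsub>pos_part L\<^esub>" "\<not> snd g \<bottom>\<^bsub>neg_part L\<^esub>"
    using g frame_map_two_iff(1,3)[OF bpt_pointsD(1), of g L]
      frame_map_two_iff(1,3)[OF bpt_pointsD(2), of g L]
    by (auto simp flip: P.Sup_empty N.Sup_empty)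
  have "(\<exists>a\<in>carrier (pos_part L). fst g a \<noteq> fst f a) \<or> (\<exists>a\<in>carrier (neg_part L). snd g a \<noteq> snd f a)"
    using bpt_points_eqI[of g L f] f g by blast
  then show "\<exists>x\<in>carrier (pos_part L). \<exists>u\<in>carrier (pos_part L).
      \<exists>y\<in>carrier (neg_part L). \<exists>v\<in>carrier (neg_part L).
        fst g x \<and> snd g y \<and> \<not> fst g u \<and> \<not> snd g v \<and>
        (\<forall>h\<in>{f}. fst h x \<longrightarrow> snd h y \<longrightarrow> fst h u \<or> snd h v)"
  proof (elim disjE bexE)
    fix a assume a: "a \<in> carrier (pos_part L)" "fst g a \<noteq> fst f a"
    show ?thesis
    proof (cases "fst g a")
      case True
      then show ?thesis using a tb P.bottom_closed N.top_closed N.bottom_closed by blast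
    next
      case False
      then show ?thesis using a tb P.top_closed N.top_closed N.bottom_closed by blast
    qed
  next
    fix a assume a: "a \<in> carrier (neg_part L)" "snd g a \<noteq> snd f a"
    show ?thesis
    proof (cases "snd g a")
      case True
      then show ?thesis using a tb P.top_closed P.bottom_closed N.bottom_closed by blast
    next
      case False
      then show ?thesis using a tb P.top_closed P.bottom_closed N.top_closed by blast
    qed
  qed
qed (use f in simp)

end

section \<open>Bi-T_D as discreteness of the Skula topology\<close>

lemma skula_closed_if_bi_TD:
  assumes td: "bi_TD X" and S: "S \<subseteq> points X"
  shows "skula_closed X S"
  unfolding skula_closed_def
proof (intro conjI ballI S)
  fix x assume x: "x \<in> points X - S"
  then have "x \<in> points X" by simp
  \<comment> \<open>The witnesses isolate \<open>x\<close>, so the same four opens give a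
    neighbourhood missing any set that omits \<open>x\<close>.\<close>
  from bspec[OF td[unfolded bi_TD_def] this]
  obtain Up Vp Um Vm where o: "openin (pos_top X) Up" "openin (pos_top X) Vp"
      "openin (neg_top X) Um" "openin (neg_top X) Vm"
    and eq: "{x} = Up \<inter> Um \<inter> (points X - Vp) \<inter> (points X - Vm)"
    by (elim exE conjE) (rule that)
  have "x \<in> Up \<inter> Um \<inter> (points X - Vp) \<inter> (points X - Vm)" unfolding eq[symmetric] by simp
  moreover have "y \<in> Vp \<union> Vm" if "y \<in> S \<inter> Up \<inter> Um" for y
  proof (rule ccontr)
    assume "y \<notin> Vp \<union> Vm"
    then have "y \<in> {x}" unfolding eq using that S by auto
    then show False using that x by blast
  qed
  ultimately show "\<exists>Up Vp Um Vm. openin (pos_top X) Up \<and> openin (pos_top X) Vp \<and>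
      openin (neg_top X) Um \<and> openin (neg_top X) Vm \<and>
      x \<in> Up \<inter> Um \<inter> (points X - Vp) \<inter> (points X - Vm) \<and> S \<inter> Up \<inter> Um \<subseteq> Vp \<union> Vm"
    by (intro exI[of _ Up] exI[of _ Vp] exI[of _ Um] exI[of _ Vm] conjI o subsetI)
qed

text \<open>The complement of \<open>{x}\<close> has \<open>x\<close> as its only outside point, and
  a basic Skula neighbourhood of \<open>x\<close> that misses this complement can only be
  \<open>{x}\<close>.\<close>

lemma bi_TD_iff_skula_closed:
  "bi_TD X \<longleftrightarrow> (\<forall>x\<in>points X. skula_closed X (points X - {x}))"
proof
  assume "bi_TD X"
  then show "\<forall>x\<in>points X. skula_closed X (points X - {x})"
    by (intro ballI skula_closed_if_bi_TD) auto
next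
  assume c: "\<forall>x\<in>points X. skula_closed X (points X - {x})"
  show "bi_TD X"
    unfolding bi_TD_def
  proof
    fix x assume x: "x \<in> points X"
    then have "x \<in> points X - (points X - {x})" by simp
    then obtain Up Vp Um Vm where o: "openin (pos_top X) Up" "openin (pos_top X) Vp"
        "openin (neg_top X) Um" "openin (neg_top X) Vm"
      and i: "x \<in> Up \<inter> Um \<inter> (points X - Vp) \<inter> (points X - Vm)"
        "(points X - {x}) \<inter> Up \<inter> Um \<subseteq> Vp \<union> Vm"
      using c[rule_format, OF x] unfolding skula_closed_def by meson
    have "{x} = Up \<inter> Um \<inter> (points X - Vp) \<inter> (points X - Vm)" using i by auto
    then show "\<exists>Up Vp Um Vm. openin (pos_top X) Up \<and> openin (pos_top X) Vp \<and>
        openin (neg_top X) Um \<and> openin (neg_top X) Vm \<and>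
        {x} = Up \<inter> Um \<inter> (points X - Vp) \<inter> (points X - Vm)"
      by (intro exI[of _ Up] exI[of _ Vp] exI[of _ Um] exI[of _ Vm] conjI o)
  qed
qed

section \<open>The five equivalent conditions\<close>

theorem proposition5p10:
  fixes L :: "('p, 'n, 'm) biframe"
  assumes "finitary_biframe L"
  shows
    "((\<forall>S\<subseteq>points (bpt L). bisober (bisubspace (bpt L) S)) \<longleftrightarrow>
      (\<forall>\<S>\<subseteq>bisober_bisubspaces (bpt L). \<Union>\<S> \<in> bisober_bisubspaces (bpt L))) \<and>
     ((\<forall>\<S>\<subseteq>bisober_bisubspaces (bpt L). \<Union>\<S> \<in> bisober_bisubspaces (bpt L)) \<longleftrightarrow>
      (\<forall>S\<in>bisober_bisubspaces (bpt L). points (bpt L) - S \<in> bisober_bisubspaces (bpt L))) \<and>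
     ((\<forall>S\<in>bisober_bisubspaces (bpt L). points (bpt L) - S \<in> bisober_bisubspaces (bpt L)) \<longleftrightarrow>
      (\<forall>f\<in>points (bpt L). bisober (bisubspace (bpt L) (points (bpt L) - {f})))) \<and>
     ((\<forall>f\<in>points (bpt L). bisober (bisubspace (bpt L) (points (bpt L) - {f}))) \<longleftrightarrow>
      bi_TD (bpt L))"
proof -
  have "biframe L" using assms by (simp add: finitary_biframe_def)
  then interpret biframe L .
  let ?X = "bpt L"
  have bs: "S \<in> bisober_bisubspaces ?X \<longleftrightarrow> skula_closed ?X S" for S
    by (simp add: bisober_bisubspaces_bpt)
  have bi: "bisober (bisubspace ?X S) \<longleftrightarrow> skula_closed ?X S" if "S \<subseteq> points ?X" for S
    using that bs[of S] by (simp add: bisober_bisubspaces_def)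
  have sub: "S \<subseteq> points ?X" if "skula_closed ?X S" for S
    using that by (simp add: skula_closed_def)
  have sing: "skula_closed ?X {f}" if "f \<in> points ?X" for f
    using that skula_closed_singleton by (simp add: points_bpt[OF biframe_axioms])
  let ?C1 = "\<forall>S\<subseteq>points ?X. bisober (bisubspace ?X S)"
    and ?C2 = "\<forall>\<S>\<subseteq>bisober_bisubspaces ?X. \<Union>\<S> \<in> bisober_bisubspaces ?X"
    and ?C3 = "\<forall>S\<in>bisober_bisubspaces ?X. points ?X - S \<in> bisober_bisubspaces ?X"
    and ?C4 = "\<forall>f\<in>points ?X. bisober (bisubspace ?X (points ?X - {f}))"
  have 51: ?C1 if "bi_TD ?X" using skula_closed_if_bi_TD[OF that] bi by blast
  have 12: ?C2 if ?C1
  proof (intro allI impI)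
    fix \<S> assume "\<S> \<subseteq> bisober_bisubspaces ?X"
    then have "\<Union>\<S> \<subseteq> points ?X" by (auto simp: bisober_bisubspaces_def)
    then show "\<Union>\<S> \<in> bisober_bisubspaces ?X" using that by (simp add: bisober_bisubspaces_def)
  qed
  have 21: ?C1 if C2: ?C2
  proof (intro allI impI)
    fix S assume S: "S \<subseteq> points ?X"
    \<comment> \<open>Every subset is the union of its singletons, so unions lead back to all
      subsets without passing through bi-T_D.\<close>
    have "(\<lambda>f. {f}) ` S \<subseteq> bisober_bisubspaces ?X" using sing S bs by auto
    then have "\<Union>((\<lambda>f. {f}) ` S) \<in> bisober_bisubspaces ?X" using C2 by blast
    then show "bisober (bisubspace ?X S)" by (simp add: bisober_bisubspaces_def)
  qed
  have 13: ?C3 if ?C1 using that by (simp add: bisober_bisubspaces_def)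
  have 34: ?C4 if C3: ?C3
  \<comment> \<open>Complementation is applied to singletons only; the way back to arbitrary subsets
    is through bi-T_D, by \<open>45\<close> and \<open>51\<close>.\<close>
  proof
    fix f assume "f \<in> points ?X"
    then have "points ?X - {f} \<in> bisober_bisubspaces ?X" using C3 sing bs by blast
    then show "bisober (bisubspace ?X (points ?X - {f}))" by (simp add: bisober_bisubspaces_def)
  qed
  have 45: "?C4 \<longleftrightarrow> bi_TD ?X" by (simp add: bi_TD_iff_skula_closed bi)
  show ?thesis using 51 12 21 13 34 45 by argo
qed

end
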